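(* Let $(E,\mathcal L,\mathcal B)$ be a set-finite, receiver set-finite, weakly left-resolving labelled space such that $E$ has no sinks and $\mathcal B$ is closed under relative complements. Let $(E,\mathcal L,[\mathcal B]_R)$ be a weakly left-resolving quotient labelled space of $(E,\mathcal L,\mathcal B)$ and let $C^*(E,\mathcal L,[\mathcal B]_R)=C^*(t_b,q_{[A]})$. If $C^*(E,\mathcal L,\mathcal B)=C^*(s_a,p_A)$ and $I$ is the ideal of $C^*(E,\mathcal L,\mathcal B)$ generated by the projections $p_A$ with $[A]=[\emptyset]$, then $\mathcal A_R=\mathcal A_I$, where $\mathcal A_I=\{a\in\mathcal A:p_{r(a)}\notin I\}$, and there is a surjective isomorphism $$\phi:C^*(E,\mathcal L,[\mathcal B]_R)\to C^*(E,\mathcal L,\mathcal B)/I$$ such that $\phi(t_b)=s_b+I$ and $\phi(q_{[A]})=p_A+I$ for $b\in\mathcal A_R$, $[A]\in[\mathcal B]_R$.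
   Context: Labelled spaces. A directed graph $E=(E^0,E^1,r,s)$ has countable sets $E^0$ (vertices), $E^1$ (edges) and range, source maps $r,s:E^1\to E^0$; $E$ has no sinks if every vertex emits an edge. $E^n$ is the set of paths $\lambda=\lambda_1\cdots\lambda_n$ ($r(\lambda_i)=s(\lambda_{i+1})$), $E^{\ge1}=\bigcup_{n\ge1}E^n$, and $r,s$ extend to paths. A labelled graph $(E,\mathcal L)$ over a countable alphabet $\mathcal A$ has a surjective labelling map $\mathcal L:E^1\to\mathcal A$, extended to paths by concatenation; $\mathcal L^*(E)=\mathcal L(E^{\ge1})$. For $\alpha\in\mathcal L^*(E)$ and $A\subset E^0$, $r(\alpha)=\{r(\lambda):\mathcal L(\lambda)=\alpha\}$ and $r(A,\alpha)=\{r(\lambda):\mathcal L(\lambda)=\alpha,\ s(\lambda)\in A\}$. A collection $\mathcal B\subset 2^{E^0}$ is accommodating if it contains $r(\alpha)$ for all $\alpha\in\mathcal L^*(E)$ and is closed under $A\mapsto r(A,\alpha)$, finite unions and finite intersections; then $(E,\mathcal L,\mathcal B)$ is a labelled space. It is weakly left-resolving if $r(A,\alpha)\cap r(B,\alpha)=r(A\cap B,\alpha)$ for all $A,B\in\mathcal B$, $\alpha\in\mathcal L^*(E)$. With $AE^1=\{e\in E^1:s(e)\in A\}$, $E^1A=\{e\in E^1:r(e)\in A\}$, it is set-finite (receiver set-finite) if $\mathcal L(AE^1)$ ($\mathcal L(E^1A)$) is finite for all $A\in\mathcal B$. $\mathcal B$ is closed under relative complements if $A\setminus B\in\mathcal B$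 for all $A,B\in\mathcal B$. $C^*$-algebra. A representation of $(E,\mathcal L,\mathcal B)$ consists of projections $\{p_A:A\in\mathcal B\}$ and partial isometries $\{s_a:a\in\mathcal A\}$ with: (i) $p_\emptyset=0$, $p_Ap_B=p_{A\cap B}$, $p_{A\cup B}=p_A+p_B-p_{A\cap B}$; (ii) $p_As_a=s_ap_{r(A,a)}$; (iii) $s_a^*s_a=p_{r(a)}$ and $s_a^*s_b=0$ unless $a=b$; (iv) if $\mathcal L(AE^1)$ is finite and non-empty, $p_A=\sum_{a\in\mathcal L(AE^1)}s_ap_{r(A,a)}s_a^*$. $C^*(E,\mathcal L,\mathcal B)=C^*(s_a,p_A)$ is the $C^*$-algebra generated by a universal representation. Ideals are closed and two-sided. Quotient labelled spaces. Let $\sim_R$ be an equivalence relation on $\mathcal B$, $[A]$ the class of $A$, $[\mathcal B]_R=\{[A]:A\in\mathcal B\}$, and $\mathcal A_R=\{a\in\mathcal A:[r(a)]\ne[\emptyset]\}$; $(\mathcal A_R)^*$ is the set of finite words of length $\ge1$ over $\mathcal A_R$. $(E,\mathcal L,[\mathcal B]_R)$ is a quotient labelled space of $(E,\mathcal L,\mathcal B)$ if $[A]\cup[B]:=[A\cup B]$, $[A]\cap[B]:=[A\cap B]$, $[A]\setminus[B]:=[A\setminus B]$ are well-defined on $[\mathcal B]_R$, the relative range $r([A],\alpha):=[r(A,\alpha)]$ is well-defined for $[A]\in[\mathcal B]_R$, $\alpha\in\mathcal L^*(E)\cap(\mathcal A_R)^*$, and $r([A],\alpha)=[\emptyset]$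 for all $\alpha\in\mathcal L^*(E)\cap(\mathcal A_R)^*$ implies $[A]=[\emptyset]$. It is weakly left-resolving if $r([A],\alpha)\cap r([B],\alpha)=r([A]\cap[B],\alpha)$ for all $[A],[B]\in[\mathcal B]_R$, $\alpha\in\mathcal L^*(E)\cap(\mathcal A_R)^*$. A representation of a weakly left-resolving quotient labelled space consists of projections $\{q_{[A]}:[A]\in[\mathcal B]_R\}$ and partial isometries $\{t_a:a\in\mathcal A_R\}$ with: (1) $q_{[\emptyset]}=0$, $q_{[A]}q_{[B]}=q_{[A]\cap[B]}$, $q_{[A]\cup[B]}=q_{[A]}+q_{[B]}-q_{[A]\cap[B]}$; (2) $q_{[A]}t_a=t_aq_{r([A],a)}$; (3) $t_a^*t_a=q_{[r(a)]}$, $t_a^*t_b=0$ unless $a=b$; (4) if $\mathcal L([A]E^1)\cap\mathcal A_R\ne\emptyset$, then $q_{[A]}=\sum_{a\in\mathcal L([A]E^1)\cap\mathcal A_R}t_aq_{r([A],a)}t_a^*$, where $\mathcal L([A]E^1)=\bigcup_{A'\sim_RA}\mathcal L(A'E^1)$ (only finitely many terms have $r([A],a)\neq[\emptyset]$, the others being zero). $C^*(E,\mathcal L,[\mathcal B]_R)=C^*(t_b,q_{[A]})$ is the $C^*$-algebra generated by a universal representation. *)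

theory Defs
  imports
    "HOL-Analysis.Abstract_Metric_Spaces"
    "HOL-Library.Equipollence"
    "HOL-Algebra.Coset"
    "HOL-Algebra.FiniteProduct"
    "Graph_Theory.Arc_Walk"
begin

section \<open>C*-algebras with explicit carriers\<close>

record 'x cstar_data = "'x partial_object" +
  czero :: 'x ("\<^bold>0\<index>")
  cadd :: "'x \<Rightarrow> 'x \<Rightarrow> 'x" (infixl "\<^bold>+\<index>" 65)
  cmul :: "'x \<Rightarrow> 'x \<Rightarrow> 'x" (infixl "\<^bold>*\<index>" 70)
  cscale :: "complex \<Rightarrow> 'x \<Rightarrow> 'x" (infixr "\<^bold>\<cdot>\<index>" 75)
  cadj :: "'x \<Rightarrow> 'x" ("_\<^sup>\<dagger>\<index>" [1000] 999)
  cnorm :: "'x \<Rightarrow> real"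

definition additive :: "'x cstar_data \<Rightarrow> 'x monoid" where
  "additive C = \<lparr>carrier = carrier C, monoid.mult = cadd C, one = czero C\<rparr>"

definition csub :: "'x cstar_data \<Rightarrow> 'x \<Rightarrow> 'x \<Rightarrow> 'x" (infixl "\<^bold>-\<index>" 65) where
  "x \<^bold>-\<^bsub>C\<^esub> y = x \<^bold>+\<^bsub>C\<^esub> (-1) \<^bold>\<cdot>\<^bsub>C\<^esub> y"

text \<open>
  The value 0 outside the carrier is there because \<^locale>\<open>Metric_space\<close> asks for
  nonnegativity and symmetry on the whole type.
\<close>
definition cdist :: "'x cstar_data \<Rightarrow> 'x \<Rightarrow> 'x \<Rightarrow> real" where
  "cdist C x y =
    (if x \<in> carrier C \<and> y \<in> carrier C then cnorm C (x \<^bold>-\<^bsub>C\<^esub> y) else 0)"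

text \<open>C*-algebras are not required to be unital.\<close>
locale cstar_algebra =
  fixes C :: "'x cstar_data" (structure)
  assumes additive_group: "comm_group (additive C)"
    and mul_closed: "x \<in> carrier C \<Longrightarrow> y \<in> carrier C \<Longrightarrow> x \<^bold>* y \<in> carrier C"
    and mul_assoc: "x \<in> carrier C \<Longrightarrow> y \<in> carrier C \<Longrightarrow> z \<in> carrier C \<Longrightarrow>
      (x \<^bold>* y) \<^bold>* z = x \<^bold>* (y \<^bold>* z)"
    and mul_distrib_left: "x \<in> carrier C \<Longrightarrow> y \<in> carrier C \<Longrightarrow> z \<in> carrier C \<Longrightarrow>
      x \<^bold>* (y \<^bold>+ z) = x \<^bold>* y \<^bold>+ x \<^bold>* z"
    and mul_distrib_right: "x \<in> carrier C \<Longrightarrow> y \<in> carrier C \<Longrightarrow> z \<in> carrier C \<Longrightarrow>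
      (x \<^bold>+ y) \<^bold>* z = x \<^bold>* z \<^bold>+ y \<^bold>* z"
    and scale_closed: "x \<in> carrier C \<Longrightarrow> c \<^bold>\<cdot> x \<in> carrier C"
    and scale_one: "x \<in> carrier C \<Longrightarrow> 1 \<^bold>\<cdot> x = x"
    and scale_scale: "x \<in> carrier C \<Longrightarrow> c \<^bold>\<cdot> (d \<^bold>\<cdot> x) = (c * d) \<^bold>\<cdot> x"
    and scale_add_left: "x \<in> carrier C \<Longrightarrow> (c + d) \<^bold>\<cdot> x = c \<^bold>\<cdot> x \<^bold>+ d \<^bold>\<cdot> x"
    and scale_add_right: "x \<in> carrier C \<Longrightarrow> y \<in> carrier C \<Longrightarrow>
      c \<^bold>\<cdot> (x \<^bold>+ y) = c \<^bold>\<cdot> x \<^bold>+ c \<^bold>\<cdot> y"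
    and scale_mul_left: "x \<in> carrier C \<Longrightarrow> y \<in> carrier C \<Longrightarrow>
      (c \<^bold>\<cdot> x) \<^bold>* y = c \<^bold>\<cdot> (x \<^bold>* y)"
    and scale_mul_right: "x \<in> carrier C \<Longrightarrow> y \<in> carrier C \<Longrightarrow>
      x \<^bold>* (c \<^bold>\<cdot> y) = c \<^bold>\<cdot> (x \<^bold>* y)"
    and adj_closed: "x \<in> carrier C \<Longrightarrow> x\<^sup>\<dagger> \<in> carrier C"
    and adj_adj: "x \<in> carrier C \<Longrightarrow> (x\<^sup>\<dagger>)\<^sup>\<dagger> = x"
    and adj_add: "x \<in> carrier C \<Longrightarrow> y \<in> carrier C \<Longrightarrow> (x \<^bold>+ y)\<^sup>\<dagger> = x\<^sup>\<dagger> \<^bold>+ y\<^sup>\<dagger>"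
    and adj_scale: "x \<in> carrier C \<Longrightarrow> (c \<^bold>\<cdot> x)\<^sup>\<dagger> = cnj c \<^bold>\<cdot> (x\<^sup>\<dagger>)"
    and adj_mul: "x \<in> carrier C \<Longrightarrow> y \<in> carrier C \<Longrightarrow> (x \<^bold>* y)\<^sup>\<dagger> = y\<^sup>\<dagger> \<^bold>* x\<^sup>\<dagger>"
    and nrm_eq_0_iff: "x \<in> carrier C \<Longrightarrow> cnorm C x = 0 \<longleftrightarrow> x = \<^bold>0"
    and nrm_triangle: "x \<in> carrier C \<Longrightarrow> y \<in> carrier C \<Longrightarrow> cnorm C (x \<^bold>+ y) \<le> cnorm C x + cnorm C y"
    and nrm_scale: "x \<in> carrier C \<Longrightarrow> cnorm C (c \<^bold>\<cdot> x) = cmod c * cnorm C x"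
    and nrm_mul: "x \<in> carrier C \<Longrightarrow> y \<in> carrier C \<Longrightarrow> cnorm C (x \<^bold>* y) \<le> cnorm C x * cnorm C y"
    and cstar_identity: "x \<in> carrier C \<Longrightarrow> cnorm C (x\<^sup>\<dagger> \<^bold>* x) = (cnorm C x)\<^sup>2"
    and complete: "Metric_space.mcomplete (carrier C) (cdist C)"

abbreviation norm_topology :: "'x cstar_data \<Rightarrow> 'x topology" where
  "norm_topology C \<equiv> Metric_space.mtopology (carrier C) (cdist C)"

definition is_projection :: "'x cstar_data \<Rightarrow> 'x \<Rightarrow> bool" where
  "is_projection C p \<longleftrightarrow> p \<in> carrier C \<and> p \<^bold>*\<^bsub>C\<^esub> p = p \<and> p\<^sup>\<dagger>\<^bsub>C\<^esub> = p"

definition is_partial_isometry :: "'x cstar_data \<Rightarrow> 'x \<Rightarrow> bool" where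
  "is_partial_isometry C s \<longleftrightarrow> s \<in> carrier C \<and> s \<^bold>*\<^bsub>C\<^esub> s\<^sup>\<dagger>\<^bsub>C\<^esub> \<^bold>*\<^bsub>C\<^esub> s = s"

definition linear_subspace :: "'x set \<Rightarrow> 'x cstar_data \<Rightarrow> bool" where
  "linear_subspace V C \<longleftrightarrow> V \<subseteq> carrier C \<and> \<^bold>0\<^bsub>C\<^esub> \<in> V \<and>
    (\<forall>x\<in>V. \<forall>y\<in>V. x \<^bold>+\<^bsub>C\<^esub> y \<in> V) \<and> (\<forall>c. \<forall>x\<in>V. c \<^bold>\<cdot>\<^bsub>C\<^esub> x \<in> V)"

definition cstar_subalgebra :: "'x set \<Rightarrow> 'x cstar_data \<Rightarrow> bool" where
  "cstar_subalgebra V C \<longleftrightarrow> linear_subspace V C \<and>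
    (\<forall>x\<in>V. \<forall>y\<in>V. x \<^bold>*\<^bsub>C\<^esub> y \<in> V) \<and> (\<forall>x\<in>V. x\<^sup>\<dagger>\<^bsub>C\<^esub> \<in> V) \<and>
    closedin (norm_topology C) V"

definition generated_cstar_subalgebra :: "'x cstar_data \<Rightarrow> 'x set \<Rightarrow> 'x set" where
  "generated_cstar_subalgebra C S = \<Inter>{V. cstar_subalgebra V C \<and> S \<subseteq> V}"

definition closed_ideal :: "'x set \<Rightarrow> 'x cstar_data \<Rightarrow> bool" where
  "closed_ideal J C \<longleftrightarrow> linear_subspace J C \<and>
    (\<forall>x\<in>carrier C. \<forall>j\<in>J. x \<^bold>*\<^bsub>C\<^esub> j \<in> J \<and> j \<^bold>*\<^bsub>C\<^esub> x \<in> J) \<and>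
    closedin (norm_topology C) J"

definition generated_ideal :: "'x cstar_data \<Rightarrow> 'x set \<Rightarrow> 'x set" where
  "generated_ideal C S = \<Inter>{J. closed_ideal J C \<and> S \<subseteq> J}"

definition coset :: "'x cstar_data \<Rightarrow> 'x set \<Rightarrow> 'x \<Rightarrow> 'x set" where
  "coset C J x = x <#\<^bsub>additive C\<^esub> J"

text \<open>
  The operations act on representatives; for a closed ideal each union below is over
  copies of one and the same coset.
\<close>
definition quotient_cstar :: "'x cstar_data \<Rightarrow> 'x set \<Rightarrow> 'x set cstar_data" where
  "quotient_cstar C J = \<lparr>
     carrier = coset C J ` carrier C,
     czero = coset C J \<^bold>0\<^bsub>C\<^esub>,
     cadd = (\<lambda>X Y. \<Union>x\<in>X. \<Union>y\<in>Y. coset C J (x \<^bold>+\<^bsub>C\<^esub> y)),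
     cmul = (\<lambda>X Y. \<Union>x\<in>X. \<Union>y\<in>Y. coset C J (x \<^bold>*\<^bsub>C\<^esub> y)),
     cscale = (\<lambda>c X. \<Union>x\<in>X. coset C J (c \<^bold>\<cdot>\<^bsub>C\<^esub> x)),
     cadj = (\<lambda>X. \<Union>x\<in>X. coset C J (x\<^sup>\<dagger>\<^bsub>C\<^esub>)),
     cnorm = (\<lambda>X. INF x\<in>X. cnorm C x)\<rparr>"

definition star_hom :: "'x cstar_data \<Rightarrow> 'y cstar_data \<Rightarrow> ('x \<Rightarrow> 'y) \<Rightarrow> bool" where
  "star_hom C D \<phi> \<longleftrightarrow> \<phi> \<in> carrier C \<rightarrow> carrier D \<and>
    (\<forall>x\<in>carrier C. \<forall>y\<in>carrier C. \<phi> (x \<^bold>+\<^bsub>C\<^esub> y) = \<phi> x \<^bold>+\<^bsub>D\<^esub> \<phi> y) \<and>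
    (\<forall>x\<in>carrier C. \<forall>y\<in>carrier C. \<phi> (x \<^bold>*\<^bsub>C\<^esub> y) = \<phi> x \<^bold>*\<^bsub>D\<^esub> \<phi> y) \<and>
    (\<forall>c. \<forall>x\<in>carrier C. \<phi> (c \<^bold>\<cdot>\<^bsub>C\<^esub> x) = c \<^bold>\<cdot>\<^bsub>D\<^esub> \<phi> x) \<and>
    (\<forall>x\<in>carrier C. \<phi> (x\<^sup>\<dagger>\<^bsub>C\<^esub>) = (\<phi> x)\<^sup>\<dagger>\<^bsub>D\<^esub>)"

definition star_iso :: "'x cstar_data \<Rightarrow> 'y cstar_data \<Rightarrow> ('x \<Rightarrow> 'y) \<Rightarrow> bool" where
  "star_iso C D \<phi> \<longleftrightarrow> star_hom C D \<phi> \<and> bij_betw \<phi> (carrier C) (carrier D)"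


section \<open>Labelled spaces\<close>

text \<open>The source and range maps are \<^const>\<open>tail\<close> and \<^const>\<open>head\<close>.\<close>
record ('v, 'e, 'a) lgraph =
  digraph_of :: "('v, 'e) pre_digraph"
  label :: "'e \<Rightarrow> 'a"
  alphabet :: "'a set"

locale labelled_graph = wf_digraph "digraph_of E" for E :: "('v, 'e, 'a) lgraph" +
  assumes countable_verts: "countable (verts (digraph_of E))"
    and countable_arcs: "countable (arcs (digraph_of E))"
    and countable_alphabet: "countable (alphabet E)"
    and label_surj: "label E ` arcs (digraph_of E) = alphabet E"

definition no_sinks :: "('v, 'e, 'a) lgraph \<Rightarrow> bool" where
  "no_sinks E \<longleftrightarrow> (\<forall>v\<in>verts (digraph_of E). \<exists>e\<in>arcs (digraph_of E). tail (digraph_of E) e = v)"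

text \<open>The set $\mathcal L^*(E)$ of labels of paths of length at least 1.\<close>
definition labelled_paths :: "('v, 'e, 'a) lgraph \<Rightarrow> 'a list set" where
  "labelled_paths E = {map (label E) \<pi> | \<pi> u v. pre_digraph.awalk (digraph_of E) u \<pi> v \<and> \<pi> \<noteq> []}"

definition path_range :: "('v, 'e, 'a) lgraph \<Rightarrow> 'a list \<Rightarrow> 'v set" where
  "path_range E \<alpha> = {v. \<exists>u \<pi>. pre_digraph.awalk (digraph_of E) u \<pi> v \<and> \<pi> \<noteq> [] \<and> map (label E) \<pi> = \<alpha>}"

definition rel_range :: "('v, 'e, 'a) lgraph \<Rightarrow> 'v set \<Rightarrow> 'a list \<Rightarrow> 'v set" where
  "rel_range E A \<alpha> =
    {v. \<exists>u\<in>A. \<exists>\<pi>. pre_digraph.awalk (digraph_of E) u \<pi> v \<and> \<pi> \<noteq> [] \<and> map (label E) \<pi> = \<alpha>}"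

definition emitted_labels :: "('v, 'e, 'a) lgraph \<Rightarrow> 'v set \<Rightarrow> 'a set" where
  "emitted_labels E A = label E ` {e \<in> arcs (digraph_of E). tail (digraph_of E) e \<in> A}"

definition received_labels :: "('v, 'e, 'a) lgraph \<Rightarrow> 'v set \<Rightarrow> 'a set" where
  "received_labels E A = label E ` {e \<in> arcs (digraph_of E). head (digraph_of E) e \<in> A}"

text \<open>
  The empty union counts as a finite union, so \<open>{} \<in> \<B>\<close>; otherwise the
  relation $p_\emptyset = 0$ below would make no sense.
\<close>
locale labelled_space = labelled_graph E for E :: "('v, 'e, 'a) lgraph" +
  fixes \<B> :: "'v set set"
  assumes subsets: "\<B> \<subseteq> Pow (verts (digraph_of E))"
    and empty_in: "{} \<in> \<B>"
    and range_in: "\<alpha> \<in> labelled_paths E \<Longrightarrow> path_range E \<alpha> \<in> \<B>"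
    and rel_range_in: "A \<in> \<B> \<Longrightarrow> \<alpha> \<in> labelled_paths E \<Longrightarrow> rel_range E A \<alpha> \<in> \<B>"
    and union_in: "A \<in> \<B> \<Longrightarrow> B \<in> \<B> \<Longrightarrow> A \<union> B \<in> \<B>"
    and inter_in: "A \<in> \<B> \<Longrightarrow> B \<in> \<B> \<Longrightarrow> A \<inter> B \<in> \<B>"

definition weakly_left_resolving :: "('v, 'e, 'a) lgraph \<Rightarrow> 'v set set \<Rightarrow> bool" where
  "weakly_left_resolving E \<B> \<longleftrightarrow> (\<forall>A\<in>\<B>. \<forall>B\<in>\<B>. \<forall>\<alpha>\<in>labelled_paths E.
    rel_range E A \<alpha> \<inter> rel_range E B \<alpha> = rel_range E (A \<inter> B) \<alpha>)"

definition set_finite :: "('v, 'e, 'a) lgraph \<Rightarrow> 'v set set \<Rightarrow> bool" where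
  "set_finite E \<B> \<longleftrightarrow> (\<forall>A\<in>\<B>. finite (emitted_labels E A))"

definition receiver_set_finite :: "('v, 'e, 'a) lgraph \<Rightarrow> 'v set set \<Rightarrow> bool" where
  "receiver_set_finite E \<B> \<longleftrightarrow> (\<forall>A\<in>\<B>. finite (received_labels E A))"

definition closed_under_relative_complements :: "'v set set \<Rightarrow> bool" where
  "closed_under_relative_complements \<B> \<longleftrightarrow> (\<forall>A\<in>\<B>. \<forall>B\<in>\<B>. A - B \<in> \<B>)"


section \<open>Quotient labelled spaces\<close>

text \<open>
  For an equivalence relation \<open>R\<close> on \<open>\<B>\<close> the class $[A]$ is \<open>R `` {A}\<close> and the set of
  classes is \<open>\<B> // R\<close>.
\<close>

definition quotient_alphabet :: "('v, 'e, 'a) lgraph \<Rightarrow> 'v set rel \<Rightarrow> 'a set" where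
  "quotient_alphabet E R = {a \<in> alphabet E. R `` {path_range E [a]} \<noteq> R `` {{}}}"

abbreviation quotient_paths :: "('v, 'e, 'a) lgraph \<Rightarrow> 'v set rel \<Rightarrow> 'a list set" where
  "quotient_paths E R \<equiv> labelled_paths E \<inter> lists (quotient_alphabet E R)"

locale quotient_labelled_space = labelled_space E \<B>
  for E :: "('v, 'e, 'a) lgraph" and \<B> :: "'v set set" +
  fixes R :: "'v set rel"
  assumes equiv: "equiv \<B> R"
    and union_respects: "(\<lambda>A B. R `` {A \<union> B}) respects2 R"
    and inter_respects: "(\<lambda>A B. R `` {A \<inter> B}) respects2 R"
    and diff_respects: "(\<lambda>A B. R `` {A - B}) respects2 R"
    and rel_range_respects:
      "\<alpha> \<in> quotient_paths E R \<Longrightarrow> (\<lambda>A. R `` {rel_range E A \<alpha>}) respects R"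
    and class_empty: "A \<in> \<B> \<Longrightarrow>
      (\<And>\<alpha>. \<alpha> \<in> quotient_paths E R \<Longrightarrow> R `` {rel_range E A \<alpha>} = R `` {{}}) \<Longrightarrow>
      R `` {A} = R `` {{}}"

definition quotient_weakly_left_resolving ::
    "('v, 'e, 'a) lgraph \<Rightarrow> 'v set set \<Rightarrow> 'v set rel \<Rightarrow> bool" where
  "quotient_weakly_left_resolving E \<B> R \<longleftrightarrow> (\<forall>A\<in>\<B>. \<forall>B\<in>\<B>. \<forall>\<alpha>\<in>quotient_paths E R.
    R `` {rel_range E A \<alpha> \<inter> rel_range E B \<alpha>} = R `` {rel_range E (A \<inter> B) \<alpha>})"

text \<open>The set $\mathcal L([A]E^1)$.\<close>
definition class_emitted_labels ::
    "('v, 'e, 'a) lgraph \<Rightarrow> 'v set rel \<Rightarrow> 'v set \<Rightarrow> 'a set" where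
  "class_emitted_labels E R A = (\<Union>A'\<in>R `` {A}. emitted_labels E A')"


section \<open>Representations and universal C*-algebras\<close>

text \<open>
  Only the values of \<open>p\<close> on \<open>\<B>\<close> and of \<open>s\<close> on the alphabet matter.
\<close>
definition labelled_space_rep ::
    "('v, 'e, 'a) lgraph \<Rightarrow> 'v set set \<Rightarrow> 'x cstar_data \<Rightarrow> ('a \<Rightarrow> 'x) \<Rightarrow> ('v set \<Rightarrow> 'x) \<Rightarrow> bool" where
  "labelled_space_rep E \<B> C s p \<longleftrightarrow>
    (\<forall>A\<in>\<B>. is_projection C (p A)) \<and>
    (\<forall>a\<in>alphabet E. is_partial_isometry C (s a)) \<and>
    p {} = \<^bold>0\<^bsub>C\<^esub> \<and>
    (\<forall>A\<in>\<B>. \<forall>B\<in>\<B>. p A \<^bold>*\<^bsub>C\<^esub> p B = p (A \<inter> B)) \<and>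
    (\<forall>A\<in>\<B>. \<forall>B\<in>\<B>. p (A \<union> B) = p A \<^bold>+\<^bsub>C\<^esub> p B \<^bold>-\<^bsub>C\<^esub> p (A \<inter> B)) \<and>
    (\<forall>A\<in>\<B>. \<forall>a\<in>alphabet E. p A \<^bold>*\<^bsub>C\<^esub> s a = s a \<^bold>*\<^bsub>C\<^esub> p (rel_range E A [a])) \<and>
    (\<forall>a\<in>alphabet E. (s a)\<^sup>\<dagger>\<^bsub>C\<^esub> \<^bold>*\<^bsub>C\<^esub> s a = p (path_range E [a])) \<and>
    (\<forall>a\<in>alphabet E. \<forall>b\<in>alphabet E. a \<noteq> b \<longrightarrow> (s a)\<^sup>\<dagger>\<^bsub>C\<^esub> \<^bold>*\<^bsub>C\<^esub> s b = \<^bold>0\<^bsub>C\<^esub>) \<and>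
    (\<forall>A\<in>\<B>. finite (emitted_labels E A) \<and> emitted_labels E A \<noteq> {} \<longrightarrow>
      p A = finprod (additive C)
        (\<lambda>a. s a \<^bold>*\<^bsub>C\<^esub> p (rel_range E A [a]) \<^bold>*\<^bsub>C\<^esub> (s a)\<^sup>\<dagger>\<^bsub>C\<^esub>) (emitted_labels E A))"

text \<open>
  In the last relation the index set may be infinite; the sum is taken over the
  letters \<open>a\<close> with $r([A],a) \neq [\emptyset]$, of which there are finitely many in the
  set-finite case, all other terms being zero.
\<close>
definition quotient_rep ::
    "('v, 'e, 'a) lgraph \<Rightarrow> 'v set set \<Rightarrow> 'v set rel \<Rightarrow> 'x cstar_data \<Rightarrow>
      ('a \<Rightarrow> 'x) \<Rightarrow> ('v set set \<Rightarrow> 'x) \<Rightarrow> bool" where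
  "quotient_rep E \<B> R C t q \<longleftrightarrow>
    (\<forall>X\<in>\<B> // R. is_projection C (q X)) \<and>
    (\<forall>a\<in>quotient_alphabet E R. is_partial_isometry C (t a)) \<and>
    q (R `` {{}}) = \<^bold>0\<^bsub>C\<^esub> \<and>
    (\<forall>A\<in>\<B>. \<forall>B\<in>\<B>. q (R `` {A}) \<^bold>*\<^bsub>C\<^esub> q (R `` {B}) = q (R `` {A \<inter> B})) \<and>
    (\<forall>A\<in>\<B>. \<forall>B\<in>\<B>. q (R `` {A \<union> B}) =
      q (R `` {A}) \<^bold>+\<^bsub>C\<^esub> q (R `` {B}) \<^bold>-\<^bsub>C\<^esub> q (R `` {A \<inter> B})) \<and>
    (\<forall>A\<in>\<B>. \<forall>a\<in>quotient_alphabet E R.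
      q (R `` {A}) \<^bold>*\<^bsub>C\<^esub> t a = t a \<^bold>*\<^bsub>C\<^esub> q (R `` {rel_range E A [a]})) \<and>
    (\<forall>a\<in>quotient_alphabet E R. (t a)\<^sup>\<dagger>\<^bsub>C\<^esub> \<^bold>*\<^bsub>C\<^esub> t a = q (R `` {path_range E [a]})) \<and>
    (\<forall>a\<in>quotient_alphabet E R. \<forall>b\<in>quotient_alphabet E R. a \<noteq> b \<longrightarrow>
      (t a)\<^sup>\<dagger>\<^bsub>C\<^esub> \<^bold>*\<^bsub>C\<^esub> t b = \<^bold>0\<^bsub>C\<^esub>) \<and>
    (\<forall>A\<in>\<B>. class_emitted_labels E R A \<inter> quotient_alphabet E R \<noteq> {} \<longrightarrow>
      q (R `` {A}) = finprod (additive C)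
        (\<lambda>a. t a \<^bold>*\<^bsub>C\<^esub> q (R `` {rel_range E A [a]}) \<^bold>*\<^bsub>C\<^esub> (t a)\<^sup>\<dagger>\<^bsub>C\<^esub>)
        {a \<in> class_emitted_labels E R A \<inter> quotient_alphabet E R.
          R `` {rel_range E A [a]} \<noteq> R `` {{}}})"

text \<open>
  HOL cannot quantify over types inside a formula, so the universal property ranges over
  all C*-algebras whose carrier is a set of elements of the type \<open>'x\<close>, which plays the
  role of a universe.  The letters form a countable set, and \<open>\<B>\<close> has at most continuum many
  elements because there are countably many vertices; hence a C*-algebra generated by a
  representation has at most continuum many elements.  So if \<open>'x\<close> has at least continuum
  many elements, this universal property is the one with respect to all C*-algebras.
\<close>
definition is_labelled_space_cstar ::
    "('v, 'e, 'a) lgraph \<Rightarrow> 'v set set \<Rightarrow> 'x cstar_data \<Rightarrow> ('a \<Rightarrow> 'x) \<Rightarrow> ('v set \<Rightarrow> 'x) \<Rightarrow> bool" where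
  "is_labelled_space_cstar E \<B> C s p \<longleftrightarrow>
    cstar_algebra C \<and> labelled_space_rep E \<B> C s p \<and>
    generated_cstar_subalgebra C (s ` alphabet E \<union> p ` \<B>) = carrier C \<and>
    (\<forall>(D :: 'x cstar_data) S P. cstar_algebra D \<and> labelled_space_rep E \<B> D S P \<longrightarrow>
      (\<exists>\<pi>. star_hom C D \<pi> \<and> (\<forall>a\<in>alphabet E. \<pi> (s a) = S a) \<and> (\<forall>A\<in>\<B>. \<pi> (p A) = P A)))"

definition is_quotient_cstar ::
    "('v, 'e, 'a) lgraph \<Rightarrow> 'v set set \<Rightarrow> 'v set rel \<Rightarrow> 'x cstar_data \<Rightarrow>
      ('a \<Rightarrow> 'x) \<Rightarrow> ('v set set \<Rightarrow> 'x) \<Rightarrow> bool" where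
  "is_quotient_cstar E \<B> R C t q \<longleftrightarrow>
    cstar_algebra C \<and> quotient_rep E \<B> R C t q \<and>
    generated_cstar_subalgebra C (t ` quotient_alphabet E R \<union> q ` (\<B> // R)) = carrier C \<and>
    (\<forall>(D :: 'x cstar_data) T Q. cstar_algebra D \<and> quotient_rep E \<B> R D T Q \<longrightarrow>
      (\<exists>\<pi>. star_hom C D \<pi> \<and> (\<forall>a\<in>quotient_alphabet E R. \<pi> (t a) = T a) \<and>
        (\<forall>X\<in>\<B> // R. \<pi> (q X) = Q X)))"

end

theory Submission
  imports
    Defs
    "HOL-Analysis.Urysohn"
    "HOL-Analysis.Bounded_Linear_Function"
    "HOL-Analysis.Infinite_Sum"
begin

text \<open>
  The \<open>t\<^sub>a\<close>, \<open>q\<^sub>[\<^sub>A\<^sub>]\<close>, with \<open>t\<^sub>a = 0\<close> for letters outside \<open>\<A>\<^sub>R\<close>, represent the labelled space in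
  \<open>D\<close>, and the cosets of the \<open>s\<^sub>a\<close>, \<open>p\<^sub>A\<close> represent the quotient labelled space in \<open>C/I\<close>; the two
  universal properties give homomorphisms \<open>C \<rightarrow> D\<close> and \<open>D \<rightarrow> C/I\<close>, the former annihilates \<open>I\<close>, and on
  generators the induced maps are inverse to each other.

  Spectral theory is avoided in the two places where it is customary. Homomorphisms are continuous
  because for a small self-adjoint \<open>h\<close> a contraction argument solves \<open>2 g = h\<^sup>2 + g\<^sup>2\<close>, which makes
  \<open>h \<plusminus> \<i> (1 - g)\<close> unitary. The norm of \<open>C/I\<close> satisfies the C*-identity because \<open>I\<close> has an
  approximate unit of projections: sums of \<open>s\<^sub>\<alpha> p\<^sub>A s\<^sub>\<alpha>\<^sup>\<dagger>\<close> over words \<open>\<alpha>\<close> of fixed length.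

  For \<open>\<A>\<^sub>R = \<A>\<^sub>I\<close> one needs \<open>q\<^sub>[\<^sub>A\<^sub>] \<noteq> 0\<close> whenever \<open>[A] \<noteq> [{}]\<close>. This is witnessed by operators on
  \<open>\<ell>\<^sup>2\<close> over infinite sequences of letters and prime filters of the generalized Boolean algebra
  of classes.
\<close>

section \<open>Elementary theory of C*-algebras\<close>

text \<open>The equation 2g = h^2 + g^2 says (1 - g)^2 = 1 - h^2, so g plays 1 - sqrt(1 - h^2), with
  a fixed point in place of a square root; being algebraic, the equation survives every
  homomorphism. The p_A of null sets alone are no approximate unit of I: for x = p_A
  s_\<alpha>\<dagger> one has x p_B = p_A p_{r(B,\<alpha>)} s_\<alpha>\<dagger>, which need not be
  close to x, whereas s_\<alpha> p_A s_\<alpha>\<dagger> absorbs x. The universal property yields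
  maps out of D but no lower bound, so q_[A] could vanish unless a representation is exhibited. A
  quotient labelled space has no underlying graph whose vertices could index a basis; prime filters
  of classes take their place. The summation relation forces a basis vector under q_[A] to lie under
  exactly one t_a t_a\<dagger>, thus to begin with a letter, and likewise after that letter: hence
  infinite sequences.\<close>

lemma (in Metric_space) mcomplete_sequence:
  "mcomplete \<longleftrightarrow> (\<forall>\<sigma>::nat \<Rightarrow> 'a. range \<sigma> \<subseteq> M \<longrightarrow> (\<forall>e>0. \<exists>N. \<forall>m\<ge>N. \<forall>n\<ge>N. d (\<sigma> m) (\<sigma> n) < e) \<longrightarrow>
    (\<exists>l\<in>M. \<forall>e>0. \<exists>N. \<forall>n\<ge>N. d (\<sigma> n) l < e))"
  unfolding mcomplete_def MCauchy_def limit_metric_sequentially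
  by (intro iffI allI impI; drule_tac x=\<sigma> in spec) (simp_all add: image_subset_iff Bex_def)

text \<open>The axioms of a C*-algebra without completeness, with the additive group spelled out as
  equations and -x given as (-1)x. Quotients, transported copies and operator algebras are checked
  against these identities first; completeness is a separate argument in each case.\<close>

locale pre_cstar_algebra =
  fixes C :: "'x cstar_data" (structure)
  assumes zero_closed [simp, intro]: "\<^bold>0 \<in> carrier C"
    and add_closed [simp, intro]: "x \<in> carrier C \<Longrightarrow> y \<in> carrier C \<Longrightarrow> x \<^bold>+ y \<in> carrier C"
    and add_assoc: "x \<in> carrier C \<Longrightarrow> y \<in> carrier C \<Longrightarrow> z \<in> carrier C \<Longrightarrow>
      (x \<^bold>+ y) \<^bold>+ z = x \<^bold>+ (y \<^bold>+ z)"
    and add_comm: "x \<in> carrier C \<Longrightarrow> y \<in> carrier C \<Longrightarrow> x \<^bold>+ y = y \<^bold>+ x"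
    and zero_add [simp]: "x \<in> carrier C \<Longrightarrow> \<^bold>0 \<^bold>+ x = x"
    and add_minus [simp]: "x \<in> carrier C \<Longrightarrow> x \<^bold>+ (-1) \<^bold>\<cdot> x = \<^bold>0"
    and mul_closed [simp, intro]: "x \<in> carrier C \<Longrightarrow> y \<in> carrier C \<Longrightarrow> x \<^bold>* y \<in> carrier C"
    and mul_assoc: "x \<in> carrier C \<Longrightarrow> y \<in> carrier C \<Longrightarrow> z \<in> carrier C \<Longrightarrow>
      (x \<^bold>* y) \<^bold>* z = x \<^bold>* (y \<^bold>* z)"
    and mul_distrib_left: "x \<in> carrier C \<Longrightarrow> y \<in> carrier C \<Longrightarrow> z \<in> carrier C \<Longrightarrow>
      x \<^bold>* (y \<^bold>+ z) = x \<^bold>* y \<^bold>+ x \<^bold>* z"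
    and mul_distrib_right: "x \<in> carrier C \<Longrightarrow> y \<in> carrier C \<Longrightarrow> z \<in> carrier C \<Longrightarrow>
      (x \<^bold>+ y) \<^bold>* z = x \<^bold>* z \<^bold>+ y \<^bold>* z"
    and scale_closed [simp, intro]: "x \<in> carrier C \<Longrightarrow> c \<^bold>\<cdot> x \<in> carrier C"
    and scale_one [simp]: "x \<in> carrier C \<Longrightarrow> 1 \<^bold>\<cdot> x = x"
    and scale_scale: "x \<in> carrier C \<Longrightarrow> c \<^bold>\<cdot> (d \<^bold>\<cdot> x) = (c * d) \<^bold>\<cdot> x"
    and scale_add_left: "x \<in> carrier C \<Longrightarrow> (c + d) \<^bold>\<cdot> x = c \<^bold>\<cdot> x \<^bold>+ d \<^bold>\<cdot> x"
    and scale_add_right: "x \<in> carrier C \<Longrightarrow> y \<in> carrier C \<Longrightarrow>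
      c \<^bold>\<cdot> (x \<^bold>+ y) = c \<^bold>\<cdot> x \<^bold>+ c \<^bold>\<cdot> y"
    and scale_mul_left: "x \<in> carrier C \<Longrightarrow> y \<in> carrier C \<Longrightarrow>
      (c \<^bold>\<cdot> x) \<^bold>* y = c \<^bold>\<cdot> (x \<^bold>* y)"
    and scale_mul_right: "x \<in> carrier C \<Longrightarrow> y \<in> carrier C \<Longrightarrow>
      x \<^bold>* (c \<^bold>\<cdot> y) = c \<^bold>\<cdot> (x \<^bold>* y)"
    and adj_closed [simp, intro]: "x \<in> carrier C \<Longrightarrow> x\<^sup>\<dagger> \<in> carrier C"
    and adj_adj [simp]: "x \<in> carrier C \<Longrightarrow> (x\<^sup>\<dagger>)\<^sup>\<dagger> = x"
    and adj_add: "x \<in> carrier C \<Longrightarrow> y \<in> carrier C \<Longrightarrow> (x \<^bold>+ y)\<^sup>\<dagger> = x\<^sup>\<dagger> \<^bold>+ y\<^sup>\<dagger>"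
    and adj_scale: "x \<in> carrier C \<Longrightarrow> (c \<^bold>\<cdot> x)\<^sup>\<dagger> = cnj c \<^bold>\<cdot> (x\<^sup>\<dagger>)"
    and adj_mul: "x \<in> carrier C \<Longrightarrow> y \<in> carrier C \<Longrightarrow> (x \<^bold>* y)\<^sup>\<dagger> = y\<^sup>\<dagger> \<^bold>* x\<^sup>\<dagger>"
    and nrm_eq_0_iff: "x \<in> carrier C \<Longrightarrow> cnorm C x = 0 \<longleftrightarrow> x = \<^bold>0"
    and nrm_triangle: "x \<in> carrier C \<Longrightarrow> y \<in> carrier C \<Longrightarrow> cnorm C (x \<^bold>+ y) \<le> cnorm C x + cnorm C y"
    and nrm_scale: "x \<in> carrier C \<Longrightarrow> cnorm C (c \<^bold>\<cdot> x) = cmod c * cnorm C x"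
    and nrm_mul: "x \<in> carrier C \<Longrightarrow> y \<in> carrier C \<Longrightarrow> cnorm C (x \<^bold>* y) \<le> cnorm C x * cnorm C y"
    and cstar_identity: "x \<in> carrier C \<Longrightarrow> cnorm C (x\<^sup>\<dagger> \<^bold>* x) = (cnorm C x)\<^sup>2"
begin

lemma add_zero [simp]: "x \<in> carrier C \<Longrightarrow> x \<^bold>+ \<^bold>0 = x"
  using add_comm zero_add by auto

lemma minus_add [simp]: "x \<in> carrier C \<Longrightarrow> (-1) \<^bold>\<cdot> x \<^bold>+ x = \<^bold>0"
  using add_comm add_minus by auto

lemma add_lcomm:
  "x \<in> carrier C \<Longrightarrow> y \<in> carrier C \<Longrightarrow> z \<in> carrier C \<Longrightarrow> x \<^bold>+ (y \<^bold>+ z) = y \<^bold>+ (x \<^bold>+ z)"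
  by (metis add_assoc add_comm)

lemmas add_ac = add_assoc add_comm add_lcomm

lemma add_minus_cancel [simp]:
  "x \<in> carrier C \<Longrightarrow> z \<in> carrier C \<Longrightarrow> x \<^bold>+ ((-1) \<^bold>\<cdot> x \<^bold>+ z) = z"
  "x \<in> carrier C \<Longrightarrow> z \<in> carrier C \<Longrightarrow> (-1) \<^bold>\<cdot> x \<^bold>+ (x \<^bold>+ z) = z"
  by (simp_all flip: add_assoc)

lemma comm_group_additive: "comm_group (additive C)"
proof (rule comm_groupI)
  show "\<exists>y\<in>carrier (additive C). y \<otimes>\<^bsub>additive C\<^esub> x = \<one>\<^bsub>additive C\<^esub>"
    if "x \<in> carrier (additive C)" for x
    using that by (intro bexI [of _ "(-1) \<^bold>\<cdot> x"]) (auto simp: additive_def)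
qed (auto simp: additive_def add_ac)

sublocale add: comm_group "additive C"
  rewrites "carrier (additive C) = carrier C"
    and "monoid.mult (additive C) = cadd C"
    and "one (additive C) = \<^bold>0"
  by (rule comm_group_additive) (simp_all add: additive_def)

lemma scale_0 [simp]: "x \<in> carrier C \<Longrightarrow> 0 \<^bold>\<cdot> x = \<^bold>0"
  using nrm_eq_0_iff [of "0 \<^bold>\<cdot> x"] by (simp add: nrm_scale)

lemma scale_zero [simp]: "c \<^bold>\<cdot> \<^bold>0 = \<^bold>0"
  using nrm_eq_0_iff [of "c \<^bold>\<cdot> \<^bold>0"] nrm_eq_0_iff [of "\<^bold>0"] by (simp add: nrm_scale)

lemma nrm_zero [simp]: "cnorm C \<^bold>0 = 0"
  using nrm_eq_0_iff by blast

lemma zero_mul [simp]: "x \<in> carrier C \<Longrightarrow> \<^bold>0 \<^bold>* x = \<^bold>0"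
  by (metis mul_closed scale_0 scale_mul_left zero_closed)

lemma mul_zero [simp]: "x \<in> carrier C \<Longrightarrow> x \<^bold>* \<^bold>0 = \<^bold>0"
  by (metis mul_closed scale_0 scale_mul_right zero_closed)

lemma adj_zero [simp]: "\<^bold>0\<^sup>\<dagger> = \<^bold>0"
  by (metis adj_closed adj_scale complex_cnj_zero scale_0 zero_closed)

lemma nrm_nonneg [simp]: "x \<in> carrier C \<Longrightarrow> 0 \<le> cnorm C x"
  using nrm_triangle [of x "(-1) \<^bold>\<cdot> x"] by (simp add: nrm_scale)

lemma nrm_pos_iff: "x \<in> carrier C \<Longrightarrow> 0 < cnorm C x \<longleftrightarrow> x \<noteq> \<^bold>0"
  using nrm_eq_0_iff [of x] nrm_nonneg [of x] by linarith

lemma sub_closed [simp, intro]: "x \<in> carrier C \<Longrightarrow> y \<in> carrier C \<Longrightarrow> x \<^bold>- y \<in> carrier C"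
  by (simp add: csub_def)

lemma sub_self [simp]: "x \<in> carrier C \<Longrightarrow> x \<^bold>- x = \<^bold>0"
  by (simp add: csub_def)

lemma sub_zero [simp]: "x \<in> carrier C \<Longrightarrow> x \<^bold>- \<^bold>0 = x"
  by (simp add: csub_def)

lemma add_sub_cancel [simp]:
  "x \<in> carrier C \<Longrightarrow> y \<in> carrier C \<Longrightarrow> x \<^bold>+ y \<^bold>- y = x"
  "x \<in> carrier C \<Longrightarrow> y \<in> carrier C \<Longrightarrow> x \<^bold>- y \<^bold>+ y = x"
  by (simp_all add: csub_def add_assoc)

lemma add_sub_cancel_left [simp]:
  "x \<in> carrier C \<Longrightarrow> y \<in> carrier C \<Longrightarrow> x \<^bold>+ (y \<^bold>- x) = y"
  by (metis add_comm add_sub_cancel(2) sub_closed)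

lemma add_sub_add_left [simp]:
  assumes "x \<in> carrier C" "y \<in> carrier C" "z \<in> carrier C"
  shows "(x \<^bold>+ y) \<^bold>- (x \<^bold>+ z) = y \<^bold>- z"
proof -
  have "x \<^bold>+ y = y \<^bold>+ x"
    using assms add_comm by simp
  with assms show ?thesis
    by (simp add: csub_def scale_add_right add_assoc)
qed

lemma sub_sub_swap:
  assumes "x \<in> carrier C" "y \<in> carrier C" "z \<in> carrier C" "w \<in> carrier C"
  shows "(x \<^bold>- y) \<^bold>- (z \<^bold>- w) = (x \<^bold>- z) \<^bold>- (y \<^bold>- w)"
  using assms by (simp add: csub_def scale_add_right scale_scale add_assoc add_lcomm)

lemma sub_eq_zero_iff: "x \<in> carrier C \<Longrightarrow> y \<in> carrier C \<Longrightarrow> x \<^bold>- y = \<^bold>0 \<longleftrightarrow> x = y"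
  by (metis add_sub_cancel(2) sub_self zero_add)

lemma eq_of_nrm_sub_le:
  assumes "x \<in> carrier C" "y \<in> carrier C" "\<And>e. e > 0 \<Longrightarrow> cnorm C (x \<^bold>- y) \<le> e"
  shows "x = y"
proof -
  have "cnorm C (x \<^bold>- y) \<le> 0"
    using field_le_epsilon [of "cnorm C (x \<^bold>- y)" 0] assms(3) by simp
  then show ?thesis
    using assms(1,2) nrm_pos_iff [of "x \<^bold>- y"] sub_eq_zero_iff [of x y] by simp
qed

lemma mul_sub: "x \<in> carrier C \<Longrightarrow> y \<in> carrier C \<Longrightarrow> z \<in> carrier C \<Longrightarrow>
    x \<^bold>* (y \<^bold>- z) = x \<^bold>* y \<^bold>- x \<^bold>* z"
  by (simp add: csub_def mul_distrib_left scale_mul_right)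

lemma sub_mul: "x \<in> carrier C \<Longrightarrow> y \<in> carrier C \<Longrightarrow> z \<in> carrier C \<Longrightarrow>
    (x \<^bold>- y) \<^bold>* z = x \<^bold>* z \<^bold>- y \<^bold>* z"
  by (simp add: csub_def mul_distrib_right scale_mul_left)

lemma adj_sub: "x \<in> carrier C \<Longrightarrow> y \<in> carrier C \<Longrightarrow> (x \<^bold>- y)\<^sup>\<dagger> = x\<^sup>\<dagger> \<^bold>- y\<^sup>\<dagger>"
  by (simp add: csub_def adj_add adj_scale)

lemma scale_sub: "x \<in> carrier C \<Longrightarrow> y \<in> carrier C \<Longrightarrow> c \<^bold>\<cdot> (x \<^bold>- y) = c \<^bold>\<cdot> x \<^bold>- c \<^bold>\<cdot> y"
  by (simp add: csub_def scale_add_right scale_scale mult.commute)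

lemma nrm_sub_commute: "x \<in> carrier C \<Longrightarrow> y \<in> carrier C \<Longrightarrow> cnorm C (x \<^bold>- y) = cnorm C (y \<^bold>- x)"
proof -
  assume *: "x \<in> carrier C" "y \<in> carrier C"
  then have "x \<^bold>- y = (-1) \<^bold>\<cdot> (y \<^bold>- x)"
    by (simp add: csub_def scale_add_right scale_scale add_comm)
  with * show ?thesis
    by (simp add: nrm_scale)
qed

lemma nrm_sub_triangle: "x \<in> carrier C \<Longrightarrow> y \<in> carrier C \<Longrightarrow> z \<in> carrier C \<Longrightarrow>
    cnorm C (x \<^bold>- z) \<le> cnorm C (x \<^bold>- y) + cnorm C (y \<^bold>- z)"
  using nrm_triangle [of "x \<^bold>- y" "y \<^bold>- z"] by (simp add: csub_def add_assoc)

text \<open>The C*-identity and submultiplicativity give |y|^2 \<le> |y\<dagger>| |y|; cancelling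
  |y| and exchanging y with y\<dagger> yields both inequalities.\<close>

lemma nrm_adj [simp]:
  assumes "x \<in> carrier C"
  shows "cnorm C (x\<^sup>\<dagger>) = cnorm C x"
proof -
  have le: "cnorm C y \<le> cnorm C (y\<^sup>\<dagger>)" if "y \<in> carrier C" for y
  proof -
    have "(cnorm C y)\<^sup>2 \<le> cnorm C (y\<^sup>\<dagger>) * cnorm C y"
      using cstar_identity [OF that] nrm_mul [of "y\<^sup>\<dagger>" y] that by simp
    moreover have "0 \<le> cnorm C y" "0 \<le> cnorm C (y\<^sup>\<dagger>)"
      using that by auto
    ultimately show ?thesis
      by (cases "cnorm C y = 0") (auto simp: power2_eq_square)
  qed
  show ?thesis
    using le [of x] le [of "x\<^sup>\<dagger>"] assms by simp
qed

text \<open>An element \<open>e\<close> with \<open>e\<^sup>\<dagger> = e = e\<^sup>2\<close> makes \<open>1 - e\<close> a projection of the unitization.\<close>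
lemma nrm_sub_projection_le:
  assumes "is_projection C e" "y \<in> carrier C"
  shows "cnorm C (y \<^bold>- y \<^bold>* e) \<le> cnorm C y"
proof -
  from assms have e: "e \<in> carrier C" "e \<^bold>* e = e" "e\<^sup>\<dagger> = e"
    by (auto simp: is_projection_def)
  have ee: "e \<^bold>* (e \<^bold>* z) = e \<^bold>* z" if "z \<in> carrier C" for z
    using e that by (simp flip: mul_assoc)
  define z where "z = (y \<^bold>- y \<^bold>* e)\<^sup>\<dagger>"
  have z: "z \<in> carrier C" "z\<^sup>\<dagger> = y \<^bold>- y \<^bold>* e"
    using e assms by (auto simp: z_def)
  \<comment> \<open>Here z = (1 - e)y\<dagger> with 1 - e idempotent, so z\<dagger>z = y(1 -
    e)y\<dagger>; one factor is now y\<dagger> itself.\<close>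
  have "z\<^sup>\<dagger> \<^bold>* z = z\<^sup>\<dagger> \<^bold>* y\<^sup>\<dagger>"
    using e assms(2) ee
    by (simp add: z_def adj_sub adj_mul mul_sub sub_mul mul_assoc)
  then have "(cnorm C z)\<^sup>2 \<le> cnorm C z * cnorm C y"
    using cstar_identity [OF z(1)] nrm_mul [of "z\<^sup>\<dagger>" "y\<^sup>\<dagger>"] z(1) assms(2) by auto
  then have "cnorm C z \<le> cnorm C y"
    using nrm_nonneg [OF z(1)] nrm_nonneg [OF assms(2)]
    by (cases "cnorm C z = 0") (auto simp: power2_eq_square)
  then show ?thesis
    using e assms by (simp add: z_def)
qed

section \<open>Metric, closed sets and completeness\<close>

sublocale metric: Metric_space "carrier C" "cdist C"
  by standard (auto simp: cdist_def nrm_sub_commute nrm_eq_0_iff sub_eq_zero_iff intro: nrm_sub_triangle)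

lemma closedin_norm_topology_iff:
  "closedin (norm_topology C) V \<longleftrightarrow> V \<subseteq> carrier C \<and>
    (\<forall>x\<in>carrier C. (\<forall>e>0. \<exists>v\<in>V. cnorm C (x \<^bold>- v) < e) \<longrightarrow> x \<in> V)"
proof -
  have "(\<exists>r>0. disjnt V (metric.mball x r)) \<longleftrightarrow> \<not> (\<forall>e>0. \<exists>v\<in>V. cnorm C (x \<^bold>- v) < e)"
    if "V \<subseteq> carrier C" "x \<in> carrier C" for x
  proof -
    have "disjnt V (metric.mball x r) \<longleftrightarrow> \<not> (\<exists>v\<in>V. cnorm C (x \<^bold>- v) < r)" for r
      using that by (force simp: disjnt_def cdist_def)
    then show ?thesis by blast
  qed
  then show ?thesis
    unfolding metric.closedin_metric by blast
qed

lemma closedinD: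
  assumes "closedin (norm_topology C) V" "x \<in> carrier C" "\<And>e. e > 0 \<Longrightarrow> \<exists>v\<in>V. cnorm C (x \<^bold>- v) < e"
  shows "x \<in> V"
  using assms unfolding closedin_norm_topology_iff by blast

lemma mcomplete_iff:
  "metric.mcomplete \<longleftrightarrow> (\<forall>\<sigma>::nat \<Rightarrow> 'x. range \<sigma> \<subseteq> carrier C \<longrightarrow>
      (\<forall>e>0. \<exists>N. \<forall>m\<ge>N. \<forall>n\<ge>N. cnorm C (\<sigma> m \<^bold>- \<sigma> n) < e) \<longrightarrow>
      (\<exists>l\<in>carrier C. \<forall>e>0. \<exists>N. \<forall>n\<ge>N. cnorm C (\<sigma> n \<^bold>- l) < e))"
proof -
  have *: "cdist C (\<sigma> m) (\<sigma> n) = cnorm C (\<sigma> m \<^bold>- \<sigma> n)" "l \<in> carrier C \<Longrightarrow> cdist C (\<sigma> n) l = cnorm C (\<sigma> n \<^bold>- l)"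
    if "range \<sigma> \<subseteq> carrier C" for \<sigma> :: "nat \<Rightarrow> _" and m n l
    using that by (auto simp: cdist_def image_subset_iff)
  show ?thesis
    unfolding metric.mcomplete_sequence by (intro iff_allI imp_cong refl) (simp_all add: * cong: bex_cong)
qed

end

lemma (in pre_cstar_algebra) cstar_algebraI:
  assumes "\<And>\<sigma>::nat \<Rightarrow> 'x. (\<And>n. \<sigma> n \<in> carrier C) \<Longrightarrow>
      (\<And>e. e > 0 \<Longrightarrow> \<exists>N. \<forall>m\<ge>N. \<forall>n\<ge>N. cnorm C (\<sigma> m \<^bold>- \<sigma> n) < e) \<Longrightarrow>
      \<exists>l\<in>carrier C. \<forall>e>0. \<exists>N. \<forall>n\<ge>N. cnorm C (\<sigma> n \<^bold>- l) < e"
  shows "cstar_algebra C"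
proof (rule cstar_algebra.intro)
  show "metric.mcomplete"
    unfolding mcomplete_iff using assms by (auto simp: image_subset_iff)
qed (fact comm_group_additive mul_closed mul_assoc mul_distrib_left mul_distrib_right scale_closed
    scale_one scale_scale scale_add_left scale_add_right scale_mul_left scale_mul_right adj_closed
    adj_adj adj_add adj_scale adj_mul nrm_eq_0_iff nrm_triangle nrm_scale nrm_mul cstar_identity)+

sublocale cstar_algebra \<subseteq> pre_cstar_algebra
proof -
  interpret add: comm_group "additive C"
    rewrites "carrier (additive C) = carrier C"
      and "monoid.mult (additive C) = cadd C"
      and "one (additive C) = \<^bold>0"
    by (rule additive_group) (simp_all add: additive_def)
  have scale_0: "0 \<^bold>\<cdot> x = \<^bold>0" if "x \<in> carrier C" for x
    using that nrm_eq_0_iff [of "0 \<^bold>\<cdot> x"] by (simp add: nrm_scale scale_closed)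
  have "x \<^bold>+ (-1) \<^bold>\<cdot> x = \<^bold>0" if "x \<in> carrier C" for x
    using that scale_add_left [of x 1 "-1"] by (simp add: scale_one scale_0)
  then show "pre_cstar_algebra C"
    by unfold_locales
      (use additive_group mul_closed mul_assoc mul_distrib_left mul_distrib_right scale_closed
    scale_one scale_scale scale_add_left scale_add_right scale_mul_left scale_mul_right adj_closed
    adj_adj adj_add adj_scale adj_mul nrm_eq_0_iff nrm_triangle nrm_scale nrm_mul cstar_identity
      in \<open>auto simp: add.m_assoc intro: add.m_comm\<close>)
qed

context cstar_algebra
begin

lemma Cauchy_converges:
  fixes \<sigma> :: "nat \<Rightarrow> 'x"
  assumes "\<And>n. \<sigma> n \<in> carrier C"
    and "\<And>e. e > 0 \<Longrightarrow> \<exists>N. \<forall>m\<ge>N. \<forall>n\<ge>N. cnorm C (\<sigma> m \<^bold>- \<sigma> n) < e"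
  shows "\<exists>l\<in>carrier C. \<forall>e>0. \<exists>N. \<forall>n\<ge>N. cnorm C (\<sigma> n \<^bold>- l) < e"
  using complete assms unfolding mcomplete_iff by (auto simp: image_subset_iff)

end

section \<open>Continuity of homomorphisms\<close>

context cstar_algebra
begin

text \<open>The map g -> (h^2 + g^2)/2 sends the ball of radius 1/2 into itself, because (1/4 +
  1/4)/2 \<le> 1/2, and contracts by 1/2 there, because |x^2 - y^2| \<le> (|x| + |y|) |x - y|.
  Self-adjointness and commutation with h are built into the set \<open>S\<close>, so the fixed
  point inherits them.\<close>

lemma ex_half_sum_of_squares:
  assumes h: "h \<in> carrier C" "h\<^sup>\<dagger> = h" "cnorm C h \<le> 1/2"
  obtains g where "g \<in> carrier C" "g\<^sup>\<dagger> = g" "g \<^bold>* h = h \<^bold>* g" "g \<^bold>+ g = h \<^bold>* h \<^bold>+ g \<^bold>* g"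
proof -
  define S where "S = {g \<in> carrier C. g\<^sup>\<dagger> = g \<and> g \<^bold>* h = h \<^bold>* g \<and> cnorm C g \<le> 1/2}"
  define F where "F g = (1/2) \<^bold>\<cdot> (h \<^bold>* h \<^bold>+ g \<^bold>* g)" for g
  \<comment> \<open>Each of the three conditions passes to norm limits; a closed subset of the
    complete carrier is a complete metric space, as Banach's theorem requires.\<close>
  have cl: "closedin (norm_topology C) S"
    unfolding closedin_norm_topology_iff
  proof (intro conjI ballI impI)
    show "S \<subseteq> carrier C" by (auto simp: S_def)
    fix x assume x: "x \<in> carrier C" and *: "\<forall>e>0. \<exists>v\<in>S. cnorm C (x \<^bold>- v) < e"
    have "cnorm C (x\<^sup>\<dagger> \<^bold>- x) \<le> e" if e: "e > 0" for e
    proof -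
      obtain v where v: "v \<in> S" "cnorm C (x \<^bold>- v) < e/2"
        using * e by (meson half_gt_zero)
      then have v': "v \<in> carrier C" "v\<^sup>\<dagger> = v" by (auto simp: S_def)
      have "cnorm C (x\<^sup>\<dagger> \<^bold>- v) = cnorm C ((x \<^bold>- v)\<^sup>\<dagger>)"
        using x v' by (simp add: adj_sub)
      also have "\<dots> = cnorm C (x \<^bold>- v)"
        using x v' by (intro nrm_adj) auto
      finally show ?thesis
        using nrm_sub_triangle [of "x\<^sup>\<dagger>" v x] nrm_sub_commute [of x v] x v' v by simp
    qed
    then have 1: "x\<^sup>\<dagger> = x"
      using x eq_of_nrm_sub_le [of "x\<^sup>\<dagger>" x] by simp
    have "cnorm C (x \<^bold>* h \<^bold>- h \<^bold>* x) \<le> e" if e: "e > 0" for e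
    proof -
      obtain v where v: "v \<in> S" "cnorm C (x \<^bold>- v) < e"
        using * e by blast
      then have v': "v \<in> carrier C" "v \<^bold>* h = h \<^bold>* v" by (auto simp: S_def)
      have "cnorm C (x \<^bold>* h \<^bold>- h \<^bold>* v) \<le> cnorm C (x \<^bold>- v) * (1/2)"
        using nrm_mul [of "x \<^bold>- v" h] x v' h(1) mult_left_mono [OF h(3), of "cnorm C (x \<^bold>- v)"]
        by (simp add: sub_mul)
      moreover have "cnorm C (h \<^bold>* v \<^bold>- h \<^bold>* x) \<le> (1/2) * cnorm C (x \<^bold>- v)"
        using nrm_mul [of h "v \<^bold>- x"] nrm_sub_commute [of x v] x v' h(1)
          mult_right_mono [OF h(3), of "cnorm C (x \<^bold>- v)"]
        by (simp add: mul_sub)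
      ultimately show ?thesis
        using nrm_sub_triangle [of "x \<^bold>* h" "h \<^bold>* v" "h \<^bold>* x"] x v' h v by simp
    qed
    then have 2: "x \<^bold>* h = h \<^bold>* x"
      using x h eq_of_nrm_sub_le [of "x \<^bold>* h" "h \<^bold>* x"] by simp
    have "cnorm C x \<le> 1/2 + e" if e: "e > 0" for e
    proof -
      obtain v where v: "v \<in> S" "cnorm C (x \<^bold>- v) < e"
        using * e by blast
      then show ?thesis
        using x nrm_triangle [of "x \<^bold>- v" v] by (simp add: S_def)
    qed
    then have "cnorm C x \<le> 1/2"
      using field_le_epsilon by blast
    with 1 2 x show "x \<in> S"
      by (simp add: S_def)
  qed
  interpret S: Submetric "carrier C" "cdist C" S
    by standard (auto simp: S_def)
  have compl: "S.sub.mcomplete"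
    using S.closedin_eq_mcomplete [OF complete] cl by simp
  have hh: "cnorm C (h \<^bold>* h) \<le> 1/4"
    using nrm_mul [of h h] mult_mono [OF h(3) h(3)] h by simp
  have F: "F \<in> S \<rightarrow> S"
  proof
    fix g assume "g \<in> S"
    then have g: "g \<in> carrier C" "g\<^sup>\<dagger> = g" "g \<^bold>* h = h \<^bold>* g" "cnorm C g \<le> 1/2"
      by (auto simp: S_def)
    have "cnorm C (g \<^bold>* g) \<le> 1/4"
      using nrm_mul [of g g] mult_mono [OF g(4) g(4)] g by simp
    then have "cnorm C (F g) \<le> 1/2"
      using nrm_triangle [of "h \<^bold>* h" "g \<^bold>* g"] hh g h by (simp add: F_def nrm_scale norm_divide)
    moreover have "(F g)\<^sup>\<dagger> = F g"
      using g h by (simp add: F_def adj_scale adj_add adj_mul)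
    moreover have "g \<^bold>* g \<^bold>* h = h \<^bold>* (g \<^bold>* g)"
      using g(1,3) h(1) by (metis mul_assoc)
    then have "F g \<^bold>* h = h \<^bold>* F g"
      using g(1) h(1) by (simp add: F_def scale_mul_left scale_mul_right mul_distrib_left mul_distrib_right
         mul_assoc [of h h h])
    moreover have "F g \<in> carrier C"
      using g h by (simp add: F_def)
    ultimately show "F g \<in> S"
      by (simp add: S_def)
  qed
  have lip: "cdist C (F x) (F y) \<le> 1/2 * cdist C x y" if xy: "x \<in> S" "y \<in> S" for x y
  proof -
    from xy have c: "x \<in> carrier C" "y \<in> carrier C" "cnorm C x \<le> 1/2" "cnorm C y \<le> 1/2"
      by (auto simp: S_def)
    have Fc: "F x \<in> carrier C" "F y \<in> carrier C"
      using c h by (auto simp: F_def)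
    have "F x \<^bold>- F y = (1/2) \<^bold>\<cdot> (x \<^bold>* x \<^bold>- y \<^bold>* y)"
      using c h by (simp add: F_def scale_add_right scale_sub)
    \<comment> \<open>Members of \<open>S\<close> need not commute with each other, so the
      difference of squares is split one factor at a time.\<close>
    moreover have "x \<^bold>* x \<^bold>- y \<^bold>* y = x \<^bold>* (x \<^bold>- y) \<^bold>+ (x \<^bold>- y) \<^bold>* y"
      using c by (simp add: mul_sub sub_mul) (simp add: csub_def add_assoc)
    moreover have "cnorm C (x \<^bold>* (x \<^bold>- y)) \<le> 1/2 * cnorm C (x \<^bold>- y)"
      using nrm_mul [of x "x \<^bold>- y"] c mult_right_mono [OF c(3), of "cnorm C (x \<^bold>- y)"] by simp
    moreover have "cnorm C ((x \<^bold>- y) \<^bold>* y) \<le> 1/2 * cnorm C (x \<^bold>- y)"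
      using nrm_mul [of "x \<^bold>- y" y] c mult_left_mono [OF c(4), of "cnorm C (x \<^bold>- y)"] by simp
    ultimately have "cnorm C (F x \<^bold>- F y) \<le> 1/2 * cnorm C (x \<^bold>- y)"
      using nrm_triangle [of "x \<^bold>* (x \<^bold>- y)" "(x \<^bold>- y) \<^bold>* y"] c by (simp add: nrm_scale norm_divide)
    then show ?thesis
      using c Fc by (simp add: cdist_def)
  qed
  have "\<^bold>0 \<in> S"
    using h by (auto simp: S_def)
  then obtain g where g: "g \<in> S" "F g = g"
    using S.sub.Banach_fixedpoint_thm [OF compl _ F _ lip] by auto
  then have "g \<^bold>+ g = F g \<^bold>+ F g" "g \<in> carrier C" by (auto simp: S_def)
  then have "g \<^bold>+ g = h \<^bold>* h \<^bold>+ g \<^bold>* g"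
    using h by (simp add: F_def flip: scale_add_left)
  with g that show thesis
    by (auto simp: S_def)
qed

text \<open>
  For commuting self-adjoint \<open>k, g\<close> with \<open>2 g = k\<^sup>2 + g\<^sup>2\<close> the elements
  \<open>k \<plusminus> \<i> (1 - g)\<close> of the unitization are unitary.
\<close>
lemma nrm_le_1_of_half_sum_of_squares:
  assumes k: "k \<in> carrier C" "k\<^sup>\<dagger> = k" and g: "g \<in> carrier C" "g\<^sup>\<dagger> = g"
    and comm: "g \<^bold>* k = k \<^bold>* g" and eq: "g \<^bold>+ g = k \<^bold>* k \<^bold>+ g \<^bold>* g"
  shows "cnorm C k \<le> 1"
proof -
  \<comment> \<open>With u = k + c(1 - g) for c = \<i> or c = -\<i>, the product u k is z + c y.
    Working with u k instead of u avoids adjoining a unit.\<close>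
  define z y where "z = k \<^bold>* k" and "y = k \<^bold>- g \<^bold>* k"
  have zy: "z \<in> carrier C" "y \<in> carrier C"
    using k g by (auto simp: z_def y_def)
  \<comment> \<open>Makes the mixed terms of the product of z + c y with its adjoint cancel, since
    cnj c = -c.\<close>
  have cross: "z\<^sup>\<dagger> \<^bold>* y = y\<^sup>\<dagger> \<^bold>* z"
  proof -
    have "k \<^bold>* (g \<^bold>* x) = g \<^bold>* (k \<^bold>* x)" if "x \<in> carrier C" for x
      using comm that k g by (metis mul_assoc)
    then show ?thesis
      using k g by (simp add: z_def y_def adj_mul adj_sub mul_sub sub_mul mul_assoc flip: comm)
  qed
  \<comment> \<open>This is k u\<dagger>u k = k k, for u\<dagger>u = k^2 + (1 - g)^2 = 1 by
    \<open>eq\<close>.\<close>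
  have sum: "z\<^sup>\<dagger> \<^bold>* z \<^bold>+ y\<^sup>\<dagger> \<^bold>* y = k\<^sup>\<dagger> \<^bold>* k"
  proof -
    define w where "w = k \<^bold>* k"
    have w: "w \<in> carrier C" "w \<^bold>* g = g \<^bold>* w"
      using k g mul_assoc [of k k g] mul_assoc [of k g k] mul_assoc [of g k k]
      by (simp_all add: w_def flip: comm)
    have 1: "z\<^sup>\<dagger> \<^bold>* z = w \<^bold>* w"
      using k by (simp add: z_def w_def adj_mul)
    have 2: "y\<^sup>\<dagger> \<^bold>* y = w \<^bold>- g \<^bold>* w \<^bold>- (g \<^bold>* w \<^bold>- g \<^bold>* (g \<^bold>* w))"
    proof -
      have kg: "k \<^bold>* (g \<^bold>* x) = g \<^bold>* (k \<^bold>* x)" if "x \<in> carrier C" for x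
        using comm that k g by (metis mul_assoc)
      show ?thesis
        using k g by (simp add: y_def w_def adj_sub adj_mul sub_mul mul_sub mul_assoc kg flip: comm)
    qed
    have 3: "(g \<^bold>+ g) \<^bold>* w = w \<^bold>* w \<^bold>+ g \<^bold>* (g \<^bold>* w)"
      using eq k g w by (simp add: mul_distrib_right mul_assoc flip: w_def)
    then have ww: "w \<^bold>* w = g \<^bold>* w \<^bold>+ g \<^bold>* w \<^bold>- g \<^bold>* (g \<^bold>* w)"
      using w g by (simp add: mul_distrib_right)
    show ?thesis
      unfolding 1 2 ww using w(1) g
      by (simp add: csub_def scale_add_right scale_scale add_ac k flip: w_def)
  qed
  have *: "cnorm C (z \<^bold>+ c \<^bold>\<cdot> y) = cnorm C k" if c: "c = \<i> \<or> c = - \<i>" for c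
  proof -
    have cc: "cnj c = - c" "c * c = - 1" using c by auto
    have "(z \<^bold>+ c \<^bold>\<cdot> y)\<^sup>\<dagger> \<^bold>* (z \<^bold>+ c \<^bold>\<cdot> y)
        = z\<^sup>\<dagger> \<^bold>* z \<^bold>+ c \<^bold>\<cdot> (z\<^sup>\<dagger> \<^bold>* y) \<^bold>+ ((- c) \<^bold>\<cdot> (y\<^sup>\<dagger> \<^bold>* z) \<^bold>+ y\<^sup>\<dagger> \<^bold>* y)"
      using zy by (simp add: adj_add adj_scale mul_distrib_left mul_distrib_right scale_mul_left
          scale_mul_right scale_scale scale_add_right cc add_ac)
    also have "\<dots> = z\<^sup>\<dagger> \<^bold>* z \<^bold>+ (c \<^bold>\<cdot> (y\<^sup>\<dagger> \<^bold>* z) \<^bold>+ (- c) \<^bold>\<cdot> (y\<^sup>\<dagger> \<^bold>* z)) \<^bold>+ y\<^sup>\<dagger> \<^bold>* y"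
      using zy unfolding cross by (simp add: add_assoc)
    also have "\<dots> = k\<^sup>\<dagger> \<^bold>* k"
      using zy by (simp add: sum flip: scale_add_left)
    finally have "(cnorm C (z \<^bold>+ c \<^bold>\<cdot> y))\<^sup>2 = (cnorm C k)\<^sup>2"
      using cstar_identity [of "z \<^bold>+ c \<^bold>\<cdot> y"] cstar_identity [of k] zy k by simp
    then show ?thesis
      using zy k by (simp add: power2_eq_iff_nonneg)
  qed
  \<comment> \<open>Averaging over both signs of c removes y, so that 2|k|^2 = |2z| \<le>
    2|k|.\<close>
  have "2 \<^bold>\<cdot> z = (z \<^bold>+ \<i> \<^bold>\<cdot> y) \<^bold>+ (z \<^bold>+ (- \<i>) \<^bold>\<cdot> y)"
  proof -
    have "(z \<^bold>+ \<i> \<^bold>\<cdot> y) \<^bold>+ (z \<^bold>+ (- \<i>) \<^bold>\<cdot> y) = (z \<^bold>+ z) \<^bold>+ (\<i> \<^bold>\<cdot> y \<^bold>+ (- \<i>) \<^bold>\<cdot> y)"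
      using zy by (simp add: add_ac)
    then show ?thesis
      using zy scale_add_left [of z 1 1] by (simp flip: scale_add_left [of y])
  qed
  then have "2 * cnorm C z \<le> cnorm C k + cnorm C k"
    using * [of \<i>] * [of "- \<i>"] nrm_triangle [of "z \<^bold>+ \<i> \<^bold>\<cdot> y" "z \<^bold>+ (- \<i>) \<^bold>\<cdot> y"] zy nrm_scale [of z 2]
    by (metis (no_types, lifting) add_closed norm_numeral scale_closed)
  then have "(cnorm C k)\<^sup>2 \<le> cnorm C k"
    using cstar_identity [of k] k by (simp add: z_def)
  then show ?thesis
    using nrm_nonneg [OF k(1)] by (cases "cnorm C k = 0") (auto simp: power2_eq_square)
qed

end

locale cstar_hom = C: cstar_algebra C + D: cstar_algebra D
  for C :: "'x cstar_data" and D :: "'y cstar_data" +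
  fixes \<phi> :: "'x \<Rightarrow> 'y"
  assumes hom: "star_hom C D \<phi>"
begin

lemma hom_closed [simp, intro]: "x \<in> carrier C \<Longrightarrow> \<phi> x \<in> carrier D"
  and hom_add: "x \<in> carrier C \<Longrightarrow> y \<in> carrier C \<Longrightarrow> \<phi> (x \<^bold>+\<^bsub>C\<^esub> y) = \<phi> x \<^bold>+\<^bsub>D\<^esub> \<phi> y"
  and hom_mul: "x \<in> carrier C \<Longrightarrow> y \<in> carrier C \<Longrightarrow> \<phi> (x \<^bold>*\<^bsub>C\<^esub> y) = \<phi> x \<^bold>*\<^bsub>D\<^esub> \<phi> y"
  and hom_scale: "x \<in> carrier C \<Longrightarrow> \<phi> (c \<^bold>\<cdot>\<^bsub>C\<^esub> x) = c \<^bold>\<cdot>\<^bsub>D\<^esub> \<phi> x"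
  and hom_adj: "x \<in> carrier C \<Longrightarrow> \<phi> (x\<^sup>\<dagger>\<^bsub>C\<^esub>) = (\<phi> x)\<^sup>\<dagger>\<^bsub>D\<^esub>"
  using hom by (auto simp: star_hom_def)

lemma hom_zero [simp]: "\<phi> \<^bold>0\<^bsub>C\<^esub> = \<^bold>0\<^bsub>D\<^esub>"
  using hom_scale [of "\<^bold>0\<^bsub>C\<^esub>" 0] by simp

lemma hom_sub: "x \<in> carrier C \<Longrightarrow> y \<in> carrier C \<Longrightarrow> \<phi> (x \<^bold>-\<^bsub>C\<^esub> y) = \<phi> x \<^bold>-\<^bsub>D\<^esub> \<phi> y"
  by (simp add: csub_def hom_add hom_scale)

text \<open>The equation for \<open>g\<close> uses only the algebraic operations, so \<phi> carries
  it to D, where it bounds the norm of the image.\<close>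

lemma hom_selfadjoint_bound:
  assumes "h \<in> carrier C" "h\<^sup>\<dagger>\<^bsub>C\<^esub> = h" "cnorm C h \<le> 1/2"
  shows "cnorm D (\<phi> h) \<le> 1"
proof -
  obtain g where g: "g \<in> carrier C" "g\<^sup>\<dagger>\<^bsub>C\<^esub> = g" "g \<^bold>*\<^bsub>C\<^esub> h = h \<^bold>*\<^bsub>C\<^esub> g"
      "g \<^bold>+\<^bsub>C\<^esub> g = h \<^bold>*\<^bsub>C\<^esub> h \<^bold>+\<^bsub>C\<^esub> g \<^bold>*\<^bsub>C\<^esub> g"
    using C.ex_half_sum_of_squares assms by blast
  show ?thesis
  proof (rule D.nrm_le_1_of_half_sum_of_squares [of _ "\<phi> g"])
    show "\<phi> g \<^bold>*\<^bsub>D\<^esub> \<phi> h = \<phi> h \<^bold>*\<^bsub>D\<^esub> \<phi> g"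
      using g assms by (simp flip: hom_mul)
    show "\<phi> g \<^bold>+\<^bsub>D\<^esub> \<phi> g = \<phi> h \<^bold>*\<^bsub>D\<^esub> \<phi> h \<^bold>+\<^bsub>D\<^esub> \<phi> g \<^bold>*\<^bsub>D\<^esub> \<phi> g"
      using g assms by (simp flip: hom_mul hom_add)
  qed (use g assms hom_adj [of h] hom_adj [of g] in auto)
qed

text \<open>
  Homomorphisms of C*-algebras are contractive; the constant 2 suffices for continuity and spares
  the approximation of norms up to 1 by fixed points.
\<close>
lemma hom_bound:
  assumes "x \<in> carrier C"
  shows "cnorm D (\<phi> x) \<le> 2 * cnorm C x"
proof (cases "x = \<^bold>0\<^bsub>C\<^esub>")
  case False
  define r where "r = cnorm C x"
  have r: "r > 0"
    unfolding r_def C.nrm_pos_iff [OF assms] by (rule False)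
  \<comment> \<open>The factor makes |h| = 1/2 by the C*-identity.\<close>
  define h where "h = complex_of_real (1 / (2 * r\<^sup>2)) \<^bold>\<cdot>\<^bsub>C\<^esub> (x\<^sup>\<dagger>\<^bsub>C\<^esub> \<^bold>*\<^bsub>C\<^esub> x)"
  have "cnorm D (\<phi> h) \<le> 1"
  proof (rule hom_selfadjoint_bound)
    show "cnorm C h \<le> 1/2"
      using assms r
      by (simp add: h_def C.nrm_scale C.cstar_identity norm_divide norm_mult norm_power flip: r_def)
    show "h \<in> carrier C"
      using assms by (simp add: h_def)
    show "h\<^sup>\<dagger>\<^bsub>C\<^esub> = h"
      using assms by (simp add: h_def C.adj_scale C.adj_mul)
  qed
  moreover have "\<phi> h = complex_of_real (1 / (2 * r\<^sup>2)) \<^bold>\<cdot>\<^bsub>D\<^esub> ((\<phi> x)\<^sup>\<dagger>\<^bsub>D\<^esub> \<^bold>*\<^bsub>D\<^esub> \<phi> x)"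
    using assms by (simp add: h_def hom_scale hom_mul hom_adj)
  ultimately have "(cnorm D (\<phi> x))\<^sup>2 \<le> 2 * r\<^sup>2"
    using assms r by (simp add: D.nrm_scale D.cstar_identity norm_divide norm_mult norm_power divide_le_eq)
  \<comment> \<open>The bound obtained is sqrt 2 times r; rounding it up to 2r keeps square roots
    away.\<close>
  moreover have "2 * r\<^sup>2 \<le> (2 * r)\<^sup>2"
    unfolding power_mult_distrib by (rule mult_right_mono) simp_all
  ultimately have "(cnorm D (\<phi> x))\<^sup>2 \<le> (2 * r)\<^sup>2"
    by (rule order_trans)
  then show ?thesis
    unfolding r_def by (rule power2_le_imp_le) (use assms in simp)
next
  case True
  then show ?thesis
    by (simp only: hom_zero C.nrm_zero D.nrm_zero mult_zero_right order_refl)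
qed

end

section \<open>Quotients by ideals with an approximate unit of projections\<close>

context cstar_hom
begin

lemma hom_finprod:
  assumes "finite F" "\<And>a. a \<in> F \<Longrightarrow> f a \<in> carrier C"
  shows "\<phi> (finprod (additive C) f F) = finprod (additive D) (\<lambda>a. \<phi> (f a)) F"
  using assms
proof (induction F)
  case empty
  then show ?case by simp
next
  case (insert a F)
  have "f \<in> F \<rightarrow> carrier C" "(\<lambda>a. \<phi> (f a)) \<in> F \<rightarrow> carrier D"
    using insert.prems by auto
  with insert show ?case
    by (simp add: C.add.finprod_insert D.add.finprod_insert hom_add C.add.finprod_closed)
qed

lemma hom_projection: "is_projection C p \<Longrightarrow> is_projection D (\<phi> p)"
  by (auto simp: is_projection_def simp flip: hom_mul hom_adj)

lemma hom_partial_isometry: "is_partial_isometry C s \<Longrightarrow> is_partial_isometry D (\<phi> s)"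
  by (auto simp: is_partial_isometry_def simp flip: hom_mul hom_adj)

text \<open>Only closedness is more than algebra; it rests on \<open>hom_bound\<close>, whose factor
  2 is the reason for e/2.\<close>

lemma closed_ideal_kernel: "closed_ideal {x \<in> carrier C. \<phi> x = \<^bold>0\<^bsub>D\<^esub>} C"
  unfolding closed_ideal_def linear_subspace_def
proof (intro conjI)
  show "closedin (norm_topology C) {x \<in> carrier C. \<phi> x = \<^bold>0\<^bsub>D\<^esub>}"
    unfolding C.closedin_norm_topology_iff
  proof (intro conjI ballI impI)
    fix x assume x: "x \<in> carrier C"
      and *: "\<forall>e>0. \<exists>v\<in>{x \<in> carrier C. \<phi> x = \<^bold>0\<^bsub>D\<^esub>}. cnorm C (x \<^bold>-\<^bsub>C\<^esub> v) < e"
    have "\<phi> x = \<^bold>0\<^bsub>D\<^esub>"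
    proof (rule D.eq_of_nrm_sub_le)
      fix e :: real assume "e > 0"
      then have "e / 2 > 0" by simp
      then obtain v where v: "v \<in> carrier C" "\<phi> v = \<^bold>0\<^bsub>D\<^esub>" "cnorm C (x \<^bold>-\<^bsub>C\<^esub> v) < e / 2"
        using * by blast
      then show "cnorm D (\<phi> x \<^bold>-\<^bsub>D\<^esub> \<^bold>0\<^bsub>D\<^esub>) \<le> e"
        using x hom_bound [of "x \<^bold>-\<^bsub>C\<^esub> v"] by (simp add: hom_sub)
    qed (use x in auto)
    with x show "x \<in> {x \<in> carrier C. \<phi> x = \<^bold>0\<^bsub>D\<^esub>}" by simp
  qed auto
qed (auto simp: hom_add hom_mul hom_scale)

end

text \<open>The elements on which both maps agree form a subalgebra closed under adjoints, and norm
  closed by \<open>hom_bound\<close>; so they include everything generated by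
  \<open>S\<close>.\<close>

lemma star_hom_eq_on_generated:
  assumes "cstar_hom C D \<phi>" "cstar_hom C D \<psi>"
    and gen: "generated_cstar_subalgebra C S = carrier C"
    and S: "S \<subseteq> carrier C" "\<And>x. x \<in> S \<Longrightarrow> \<phi> x = \<psi> x"
    and "x \<in> carrier C"
  shows "\<phi> x = \<psi> x"
proof -
  interpret \<phi>: cstar_hom C D \<phi> by fact
  interpret \<psi>: cstar_hom C D \<psi> by fact
  let ?V = "{x \<in> carrier C. \<phi> x = \<psi> x}"
  have "closedin (norm_topology C) ?V"
    unfolding \<phi>.C.closedin_norm_topology_iff
  proof (intro conjI ballI impI)
    fix x assume x: "x \<in> carrier C" and *: "\<forall>e>0. \<exists>v\<in>?V. cnorm C (x \<^bold>-\<^bsub>C\<^esub> v) < e"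
    have "\<phi> x = \<psi> x"
    proof (rule \<phi>.D.eq_of_nrm_sub_le)
      fix e :: real assume "e > 0"
      \<comment> \<open>Each map at most doubles the distance from x to v, and two such distances
        are added.\<close>
      then have "e / 4 > 0" by simp
      then obtain v where v: "v \<in> carrier C" "\<phi> v = \<psi> v" "cnorm C (x \<^bold>-\<^bsub>C\<^esub> v) < e / 4"
        using * by blast
      have "cnorm D (\<phi> x \<^bold>-\<^bsub>D\<^esub> \<phi> v) \<le> e / 2" "cnorm D (\<psi> x \<^bold>-\<^bsub>D\<^esub> \<phi> v) \<le> e / 2"
        using x v \<phi>.hom_bound [of "x \<^bold>-\<^bsub>C\<^esub> v"] \<psi>.hom_bound [of "x \<^bold>-\<^bsub>C\<^esub> v"]
        by (simp_all add: \<phi>.hom_sub \<psi>.hom_sub)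
      then show "cnorm D (\<phi> x \<^bold>-\<^bsub>D\<^esub> \<psi> x) \<le> e"
        using \<phi>.D.nrm_sub_triangle [of "\<phi> x" "\<phi> v" "\<psi> x"]
          \<phi>.D.nrm_sub_commute [of "\<phi> v" "\<psi> x"] x v(1) \<phi>.hom_closed \<psi>.hom_closed by simp
    qed (use x in auto)
    with x show "x \<in> ?V" by simp
  qed auto
  then have "cstar_subalgebra ?V C"
    by (auto simp: cstar_subalgebra_def linear_subspace_def \<phi>.hom_add \<psi>.hom_add \<phi>.hom_mul
        \<psi>.hom_mul \<phi>.hom_scale \<psi>.hom_scale \<phi>.hom_adj \<psi>.hom_adj)
  then have "carrier C \<subseteq> ?V"
    unfolding gen [symmetric] generated_cstar_subalgebra_def using S by (intro Inter_lower) auto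
  with assms show ?thesis by auto
qed

lemma star_hom_comp: "star_hom C D \<phi> \<Longrightarrow> star_hom D E \<psi> \<Longrightarrow> star_hom C E (\<lambda>x. \<psi> (\<phi> x))"
  by (auto simp: star_hom_def Pi_iff)

text \<open>Serves the submultiplicativity of an infimum norm, where bounds on the factors are
  available only strictly above the infima; both are approached from above at the same rate.\<close>

lemma le_mult_of_dense:
  fixes a b c :: real
  assumes "\<And>r s. r > b \<Longrightarrow> s > c \<Longrightarrow> a \<le> r * s"
  shows "a \<le> b * c"
proof (rule tendsto_lowerbound)
  have "((\<lambda>e. (b + e) * (c + e)) \<longlongrightarrow> (b + 0) * (c + 0)) (at_right 0)"
    by (intro tendsto_intros)
  then show "((\<lambda>e. (b + e) * (c + e)) \<longlongrightarrow> b * c) (at_right 0)"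
    by simp
  show "\<forall>\<^sub>F e in at_right 0. a \<le> (b + e) * (c + e)"
    using assms by (auto simp: eventually_at_right_less eventually_at_filter)
qed simp

section \<open>Cosets and the infimum norm\<close>

locale cstar_ideal = cstar_algebra C for C :: "'x cstar_data" (structure) +
  fixes J :: "'x set"
  assumes ideal: "closed_ideal J C"
begin

abbreviation "Q \<equiv> quotient_cstar C J"

lemma ideal_subset: "x \<in> J \<Longrightarrow> x \<in> carrier C"
  and ideal_zero [simp, intro]: "\<^bold>0 \<in> J"
  and ideal_add [intro]: "x \<in> J \<Longrightarrow> y \<in> J \<Longrightarrow> x \<^bold>+ y \<in> J"
  and ideal_scale [intro]: "x \<in> J \<Longrightarrow> c \<^bold>\<cdot> x \<in> J"
  and ideal_mul_left [intro]: "x \<in> carrier C \<Longrightarrow> j \<in> J \<Longrightarrow> x \<^bold>* j \<in> J"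
  and ideal_mul_right [intro]: "x \<in> carrier C \<Longrightarrow> j \<in> J \<Longrightarrow> j \<^bold>* x \<in> J"
  and ideal_closed: "closedin (norm_topology C) J"
  using ideal by (auto simp: closed_ideal_def linear_subspace_def)

lemma mem_coset_iff:
  assumes "x \<in> carrier C"
  shows "y \<in> coset C J x \<longleftrightarrow> y \<in> carrier C \<and> y \<^bold>- x \<in> J"
proof -
  have "y \<in> coset C J x \<longleftrightarrow> (\<exists>j\<in>J. y = x \<^bold>+ j)"
    by (simp add: coset_def l_coset_def additive_def)
  also have "\<dots> \<longleftrightarrow> y \<in> carrier C \<and> y \<^bold>- x \<in> J"
  proof
    assume "\<exists>j\<in>J. y = x \<^bold>+ j"
    then obtain j where "j \<in> J" "y = j \<^bold>+ x"
      using assms ideal_subset add_comm by auto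
    then show "y \<in> carrier C \<and> y \<^bold>- x \<in> J"
      using assms ideal_subset by simp
  next
    assume "y \<in> carrier C \<and> y \<^bold>- x \<in> J"
    then show "\<exists>j\<in>J. y = x \<^bold>+ j"
      using assms by (intro bexI [of _ "y \<^bold>- x"]) auto
  qed
  finally show ?thesis .
qed

lemma sub_in_ideal_commute:
  assumes "x \<in> carrier C" "y \<in> carrier C" "x \<^bold>- y \<in> J"
  shows "y \<^bold>- x \<in> J"
proof -
  have "y \<^bold>- x = (-1) \<^bold>\<cdot> (x \<^bold>- y)"
    using assms by (simp add: csub_def scale_add_right scale_scale add_comm)
  with assms show ?thesis by auto
qed

lemma sub_in_ideal_trans:
  assumes "x \<in> carrier C" "y \<in> carrier C" "z \<in> carrier C" "x \<^bold>- y \<in> J" "y \<^bold>- z \<in> J"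
  shows "x \<^bold>- z \<in> J"
proof -
  have "x \<^bold>- z = (x \<^bold>- y) \<^bold>+ (y \<^bold>- z)"
    using assms by (simp add: csub_def add_assoc)
  with assms show ?thesis by auto
qed

lemma coset_eq_iff:
  assumes "x \<in> carrier C" "y \<in> carrier C"
  shows "coset C J x = coset C J y \<longleftrightarrow> x \<^bold>- y \<in> J"
proof
  assume "coset C J x = coset C J y"
  then show "x \<^bold>- y \<in> J"
    using assms mem_coset_iff [of x x] mem_coset_iff [of y x] by simp
next
  assume *: "x \<^bold>- y \<in> J"
  have "z \<^bold>- x \<in> J \<longleftrightarrow> z \<^bold>- y \<in> J" if z: "z \<in> carrier C" for z
    using sub_in_ideal_trans [OF z assms] sub_in_ideal_trans [OF z assms(2,1)]
      sub_in_ideal_commute [OF assms *] * by argo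
  then show "coset C J x = coset C J y"
    using assms by (auto simp: mem_coset_iff)
qed

lemma coset_zero: "x \<in> J \<Longrightarrow> coset C J x = coset C J \<^bold>0"
  by (simp add: coset_eq_iff ideal_subset)

lemma self_in_coset [simp, intro]: "x \<in> carrier C \<Longrightarrow> x \<in> coset C J x"
  by (simp add: mem_coset_iff)

lemma coset_eqI: "x \<in> carrier C \<Longrightarrow> y \<in> coset C J x \<Longrightarrow> coset C J y = coset C J x"
  by (simp add: mem_coset_iff coset_eq_iff)

lemma coset_subset: "x \<in> carrier C \<Longrightarrow> y \<in> coset C J x \<Longrightarrow> y \<in> carrier C"
  by (simp add: mem_coset_iff)

text \<open>The quotient operations are unions over representatives. All members of the union are
  the same coset and the index sets are nonempty, so the union collapses; the other operations are
  treated alike.\<close>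

lemma coset_add:
  assumes "x \<in> carrier C" "y \<in> carrier C"
  shows "coset C J x \<^bold>+\<^bsub>Q\<^esub> coset C J y = coset C J (x \<^bold>+ y)"
proof -
  have "coset C J (a \<^bold>+ b) = coset C J (x \<^bold>+ y)" if "a \<in> coset C J x" "b \<in> coset C J y" for a b
  proof -
    have ab: "a \<in> carrier C" "b \<in> carrier C" "a \<^bold>- x \<in> J" "b \<^bold>- y \<in> J"
      using that assms by (simp_all add: mem_coset_iff)
    have "a \<^bold>+ b \<^bold>- (x \<^bold>+ y) = (a \<^bold>- x) \<^bold>+ (b \<^bold>- y)"
      using ab(1,2) assms by (simp add: csub_def scale_add_right add_ac)
    then show ?thesis
      using ab assms by (simp add: coset_eq_iff ideal_add)
  qed
  moreover have "coset C J x \<noteq> {}" "coset C J y \<noteq> {}"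
    using assms self_in_coset by auto
  ultimately show ?thesis
    unfolding quotient_cstar_def by (simp add: SUP_eq_const)
qed

lemma coset_mul:
  assumes "x \<in> carrier C" "y \<in> carrier C"
  shows "coset C J x \<^bold>*\<^bsub>Q\<^esub> coset C J y = coset C J (x \<^bold>* y)"
proof -
  have "coset C J (a \<^bold>* b) = coset C J (x \<^bold>* y)" if "a \<in> coset C J x" "b \<in> coset C J y" for a b
  proof -
    have ab: "a \<in> carrier C" "b \<in> carrier C" "a \<^bold>- x \<in> J" "b \<^bold>- y \<in> J"
      using that assms by (simp_all add: mem_coset_iff)
    \<comment> \<open>Changing one factor at a time uses both sides of the two-sided ideal.\<close>
    have "a \<^bold>* b \<^bold>- x \<^bold>* y = (a \<^bold>- x) \<^bold>* b \<^bold>+ x \<^bold>* (b \<^bold>- y)"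
      using ab(1,2) assms by (simp add: sub_mul mul_sub) (simp add: csub_def add_assoc)
    then show ?thesis
      using ab assms by (simp add: coset_eq_iff ideal_add ideal_mul_left ideal_mul_right)
  qed
  moreover have "coset C J x \<noteq> {}" "coset C J y \<noteq> {}"
    using assms self_in_coset by auto
  ultimately show ?thesis
    unfolding quotient_cstar_def by (simp add: SUP_eq_const)
qed

lemma coset_scale:
  assumes "x \<in> carrier C"
  shows "c \<^bold>\<cdot>\<^bsub>Q\<^esub> coset C J x = coset C J (c \<^bold>\<cdot> x)"
proof -
  have "coset C J (c \<^bold>\<cdot> a) = coset C J (c \<^bold>\<cdot> x)" if "a \<in> coset C J x" for a
    using that assms by (simp add: mem_coset_iff coset_eq_iff ideal_scale flip: scale_sub)
  moreover have "coset C J x \<noteq> {}"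
    using assms self_in_coset by auto
  ultimately show ?thesis
    unfolding quotient_cstar_def by (simp add: SUP_eq_const)
qed

lemma carrier_quotient [simp]: "carrier Q = coset C J ` carrier C"
  and zero_quotient [simp]: "\<^bold>0\<^bsub>Q\<^esub> = coset C J \<^bold>0"
  by (simp_all add: quotient_cstar_def)

text \<open>The form in which the infimum is mostly used: a strict bound is realized by a
  representative, a weak one in general is not.\<close>

lemma quotient_norm_less_iff:
  assumes "x \<in> carrier C"
  shows "cnorm Q (coset C J x) < r \<longleftrightarrow> (\<exists>y\<in>coset C J x. cnorm C y < r)"
proof -
  have "coset C J x \<noteq> {}" "bdd_below (cnorm C ` coset C J x)"
    using assms coset_subset by (auto intro!: bdd_belowI [of _ 0])
  then show ?thesis
    by (simp add: quotient_cstar_def cINF_less_iff)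
qed

lemma quotient_norm_le:
  assumes "x \<in> carrier C" "y \<in> coset C J x"
  shows "cnorm Q (coset C J x) \<le> cnorm C y"
proof (rule field_le_epsilon)
  fix e :: real assume "e > 0"
  then have "cnorm C y < cnorm C y + e" by simp
  then have "\<exists>y'\<in>coset C J x. cnorm C y' < cnorm C y + e"
    using assms(2) by (rule bexI)
  then show "cnorm Q (coset C J x) \<le> cnorm C y + e"
    using quotient_norm_less_iff [OF assms(1)] less_imp_le by blast
qed

lemma quotient_norm_nonneg:
  assumes "x \<in> carrier C"
  shows "0 \<le> cnorm Q (coset C J x)"
proof (rule ccontr)
  assume "\<not> ?thesis"
  then obtain y where "y \<in> coset C J x" "cnorm C y < 0"
    using quotient_norm_less_iff [OF assms, of 0] by auto
  then show False
    using nrm_nonneg [OF coset_subset [OF assms]] by fastforce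
qed

end

text \<open>A substitute for the approximate unit that functional calculus would supply in any
  closed ideal. Approximating one element at a time from the right is enough for the C*-identity of
  the quotient.\<close>

locale cstar_ideal_projections = cstar_ideal +
  assumes approx: "j \<in> J \<Longrightarrow> e > 0 \<Longrightarrow> \<exists>p\<in>J. is_projection C p \<and> cnorm C (j \<^bold>- j \<^bold>* p) < e"
begin

lemma ideal_adj [intro]:
  assumes "j \<in> J"
  shows "j\<^sup>\<dagger> \<in> J"
proof (rule closedinD [OF ideal_closed])
  show "j\<^sup>\<dagger> \<in> carrier C"
    using assms ideal_subset by simp
  fix e :: real assume "e > 0"
  then obtain p where p: "p \<in> J" "is_projection C p" "cnorm C (j \<^bold>- j \<^bold>* p) < e"
    using approx assms by blast
  have c: "j \<in> carrier C" "p \<in> carrier C" "p\<^sup>\<dagger> = p"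
    using p assms ideal_subset by (auto simp: is_projection_def)
  have "j\<^sup>\<dagger> \<^bold>- p \<^bold>* j\<^sup>\<dagger> = (j \<^bold>- j \<^bold>* p)\<^sup>\<dagger>"
    using c by (simp add: adj_sub adj_mul)
  then have "cnorm C (j\<^sup>\<dagger> \<^bold>- p \<^bold>* j\<^sup>\<dagger>) < e"
    using p c by simp
  then show "\<exists>v\<in>J. cnorm C (j\<^sup>\<dagger> \<^bold>- v) < e"
    using p(1) c by (intro bexI [of _ "p \<^bold>* j\<^sup>\<dagger>"]) auto
qed

lemma coset_adj:
  assumes "x \<in> carrier C"
  shows "(coset C J x)\<^sup>\<dagger>\<^bsub>Q\<^esub> = coset C J (x\<^sup>\<dagger>)"
proof -
  have "coset C J (a\<^sup>\<dagger>) = coset C J (x\<^sup>\<dagger>)" if "a \<in> coset C J x" for a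
    using that assms by (simp add: mem_coset_iff coset_eq_iff ideal_adj flip: adj_sub)
  moreover have "coset C J x \<noteq> {}"
    using assms self_in_coset by auto
  ultimately show ?thesis
    unfolding quotient_cstar_def by (simp add: SUP_eq_const)
qed

text \<open>The hard half of the C*-identity. For a representative z = x\<dagger>x - j and a
  projection p in J that almost absorbs j, the element y = x(1 - p) represents x, and y\<dagger>y =
  (1 - p)(z + j)(1 - p) has norm at most |z| + |j(1 - p)|.\<close>

lemma quotient_norm_square_le:
  assumes x: "x \<in> carrier C"
  shows "(cnorm Q (coset C J x))\<^sup>2 \<le> cnorm Q (coset C J (x\<^sup>\<dagger> \<^bold>* x))"
proof (rule dense_ge)
  fix r assume "cnorm Q (coset C J (x\<^sup>\<dagger> \<^bold>* x)) < r"
  then obtain z where z: "z \<in> coset C J (x\<^sup>\<dagger> \<^bold>* x)" "cnorm C z < r"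
    using quotient_norm_less_iff x by auto
  define j where "j = x\<^sup>\<dagger> \<^bold>* x \<^bold>- z"
  have zj: "z \<in> carrier C" "j \<in> J" "x\<^sup>\<dagger> \<^bold>* x = z \<^bold>+ j"
    using z x sub_in_ideal_commute by (auto simp: mem_coset_iff j_def)
  then have j: "j \<in> carrier C"
    using ideal_subset by blast
  have "r - cnorm C z > 0"
    using z by simp
  then obtain p where p: "p \<in> J" "is_projection C p" "cnorm C (j \<^bold>- j \<^bold>* p) < r - cnorm C z"
    using approx [OF zj(2)] by blast
  have pc: "p \<in> carrier C" "p\<^sup>\<dagger> = p"
    using p ideal_subset by (auto simp: is_projection_def)
  define y where "y = x \<^bold>- x \<^bold>* p"
  define w where "w = x\<^sup>\<dagger> \<^bold>* x \<^bold>- (x\<^sup>\<dagger> \<^bold>* x) \<^bold>* p"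
  have yc: "y \<in> carrier C" and wc: "w \<in> carrier C"
    using x pc by (auto simp: y_def w_def)
  have "(cnorm C y)\<^sup>2 = cnorm C (y\<^sup>\<dagger> \<^bold>* y)"
    using yc by (simp add: cstar_identity)
  also have "y\<^sup>\<dagger> \<^bold>* y = w \<^bold>- p \<^bold>* w"
    using x pc
    by (simp add: y_def w_def adj_sub adj_mul sub_mul mul_sub mul_assoc
        sub_sub_swap [of "x\<^sup>\<dagger> \<^bold>* x" "p \<^bold>* (x\<^sup>\<dagger> \<^bold>* x)"])
  \<comment> \<open>\<open>nrm_sub_projection_le\<close> treats 1 - p as a right factor; the adjoint
    moves the left one there.\<close>
  also have "cnorm C (w \<^bold>- p \<^bold>* w) = cnorm C ((w \<^bold>- p \<^bold>* w)\<^sup>\<dagger>)"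
    using wc pc by (intro nrm_adj [symmetric]) auto
  also have "\<dots> = cnorm C (w\<^sup>\<dagger> \<^bold>- w\<^sup>\<dagger> \<^bold>* p)"
    using wc pc by (simp add: adj_sub adj_mul)
  also have "\<dots> \<le> cnorm C (w\<^sup>\<dagger>)"
    using wc by (intro nrm_sub_projection_le p) auto
  also have "\<dots> = cnorm C ((z \<^bold>- z \<^bold>* p) \<^bold>+ (j \<^bold>- j \<^bold>* p))"
  proof -
    have "w = (z \<^bold>- z \<^bold>* p) \<^bold>+ (j \<^bold>- j \<^bold>* p)"
      unfolding w_def zj(3) using zj(1) j pc
      by (simp add: mul_distrib_right csub_def scale_add_right add_ac)
    then show ?thesis
      using wc by simp
  qed
  also have "\<dots> \<le> cnorm C (z \<^bold>- z \<^bold>* p) + cnorm C (j \<^bold>- j \<^bold>* p)"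
    using zj(1) j pc by (intro nrm_triangle) auto
  also have "\<dots> \<le> cnorm C z + cnorm C (j \<^bold>- j \<^bold>* p)"
    using nrm_sub_projection_le [OF p(2) zj(1)] by simp
  also have "\<dots> \<le> r"
    using p(3) by simp
  finally have "(cnorm C y)\<^sup>2 \<le> r" .
  moreover have "y \<^bold>- x = (-1) \<^bold>\<cdot> (x \<^bold>* p)"
    using x pc by (simp add: y_def csub_def add_ac)
  then have "y \<in> coset C J x"
    using yc x p(1) by (simp add: mem_coset_iff ideal_scale ideal_mul_left)
  then have "(cnorm Q (coset C J x))\<^sup>2 \<le> (cnorm C y)\<^sup>2"
    using quotient_norm_le quotient_norm_nonneg x by (intro power_mono) auto
  ultimately show "(cnorm Q (coset C J x))\<^sup>2 \<le> r"
    by simp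
qed

text \<open>With submultiplicativity, this gives the easy half of the C*-identity.\<close>

lemma quotient_norm_adj_le:
  assumes x: "x \<in> carrier C"
  shows "cnorm Q (coset C J (x\<^sup>\<dagger>)) \<le> cnorm Q (coset C J x)"
proof (rule dense_ge)
  fix r assume "cnorm Q (coset C J x) < r"
  then obtain y where y: "y \<in> coset C J x" "cnorm C y < r"
    using quotient_norm_less_iff x by auto
  then have yc: "y \<in> carrier C"
    using coset_subset x by blast
  have "y\<^sup>\<dagger> \<in> coset C J (x\<^sup>\<dagger>)"
    using y(1) x by (simp add: mem_coset_iff ideal_adj flip: adj_sub)
  then have "cnorm Q (coset C J (x\<^sup>\<dagger>)) \<le> cnorm C (y\<^sup>\<dagger>)"
    using x by (intro quotient_norm_le) auto
  with y yc show "cnorm Q (coset C J (x\<^sup>\<dagger>)) \<le> r"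
    by simp
qed

lemma quotient_norm_triangle:
  assumes x: "x \<in> carrier C" and y: "y \<in> carrier C"
  shows "cnorm Q (coset C J (x \<^bold>+ y)) \<le> cnorm Q (coset C J x) + cnorm Q (coset C J y)"
proof (rule field_le_epsilon)
  fix e :: real assume "e > 0"
  then have "cnorm Q (coset C J x) < cnorm Q (coset C J x) + e / 2"
      "cnorm Q (coset C J y) < cnorm Q (coset C J y) + e / 2" by auto
  then obtain a b where a: "a \<in> coset C J x" "cnorm C a < cnorm Q (coset C J x) + e / 2"
    and b: "b \<in> coset C J y" "cnorm C b < cnorm Q (coset C J y) + e / 2"
    using quotient_norm_less_iff x y by meson
  have ab: "a \<in> carrier C" "b \<in> carrier C"
    using a b coset_subset x y by auto
  have "cnorm Q (coset C J (a \<^bold>+ b)) \<le> cnorm C (a \<^bold>+ b)"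
    using ab by (intro quotient_norm_le) auto
  moreover have "coset C J (a \<^bold>+ b) = coset C J (x \<^bold>+ y)"
    using coset_eqI [OF x a(1)] coset_eqI [OF y b(1)] ab x y by (simp flip: coset_add)
  ultimately show "cnorm Q (coset C J (x \<^bold>+ y)) \<le> cnorm Q (coset C J x) + cnorm Q (coset C J y) + e"
    using nrm_triangle [OF ab] a b by simp
qed

lemma quotient_norm_mul:
  assumes x: "x \<in> carrier C" and y: "y \<in> carrier C"
  shows "cnorm Q (coset C J (x \<^bold>* y)) \<le> cnorm Q (coset C J x) * cnorm Q (coset C J y)"
proof (rule le_mult_of_dense)
  fix r s assume "cnorm Q (coset C J x) < r" "cnorm Q (coset C J y) < s"
  then obtain a b where a: "a \<in> coset C J x" "cnorm C a < r"
    and b: "b \<in> coset C J y" "cnorm C b < s"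
    using quotient_norm_less_iff x y by meson
  have ab: "a \<in> carrier C" "b \<in> carrier C"
    using a b coset_subset x y by auto
  have "cnorm Q (coset C J (a \<^bold>* b)) \<le> cnorm C (a \<^bold>* b)"
    using ab by (intro quotient_norm_le) auto
  also have "\<dots> \<le> r * s"
    using nrm_mul [OF ab] mult_mono [of "cnorm C a" r "cnorm C b" s] a b ab nrm_nonneg [OF ab(1)] by simp
  also have "coset C J (a \<^bold>* b) = coset C J (x \<^bold>* y)"
    using coset_eqI [OF x a(1)] coset_eqI [OF y b(1)] ab x y by (simp flip: coset_mul)
  finally show "cnorm Q (coset C J (x \<^bold>* y)) \<le> r * s" .
qed

lemma quotient_norm_scale_le:
  assumes x: "x \<in> carrier C"
  shows "cnorm Q (coset C J (c \<^bold>\<cdot> x)) \<le> cmod c * cnorm Q (coset C J x)"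
proof (cases "c = 0")
  case True
  then show ?thesis
    using x quotient_norm_le [of "\<^bold>0" "\<^bold>0"] by simp
next
  case False
  have "cnorm Q (coset C J (c \<^bold>\<cdot> x)) / cmod c \<le> cnorm Q (coset C J x)"
  proof (rule dense_ge)
    fix r assume "cnorm Q (coset C J x) < r"
    then obtain y where y: "y \<in> coset C J x" "cnorm C y < r"
      using quotient_norm_less_iff x by auto
    then have yc: "y \<in> carrier C"
      using coset_subset x by blast
    have "c \<^bold>\<cdot> y \<in> coset C J (c \<^bold>\<cdot> x)"
      using y(1) x by (simp add: mem_coset_iff ideal_scale flip: scale_sub)
    then have "cnorm Q (coset C J (c \<^bold>\<cdot> x)) \<le> cnorm C (c \<^bold>\<cdot> y)"
      using x by (intro quotient_norm_le) auto
    also have "\<dots> \<le> r * cmod c"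
      using y yc mult_left_mono [of "cnorm C y" r "cmod c"] by (simp add: nrm_scale mult.commute)
    finally show "cnorm Q (coset C J (c \<^bold>\<cdot> x)) / cmod c \<le> r"
      using False by (simp add: divide_le_eq)
  qed
  then show ?thesis
    using False by (simp add: divide_le_eq mult.commute)
qed

lemma quotient_norm_scale:
  assumes x: "x \<in> carrier C"
  shows "cnorm Q (coset C J (c \<^bold>\<cdot> x)) = cmod c * cnorm Q (coset C J x)"
proof (cases "c = 0")
  case True
  then show ?thesis
    using quotient_norm_scale_le [OF x, of 0] quotient_norm_nonneg [of "0 \<^bold>\<cdot> x"] x by simp
next
  case False
  have "cnorm Q (coset C J x) \<le> cmod (1 / c) * cnorm Q (coset C J (c \<^bold>\<cdot> x))"
    using quotient_norm_scale_le [of "c \<^bold>\<cdot> x" "1 / c"] x False by (simp add: scale_scale)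
  then have "cmod c * cnorm Q (coset C J x) \<le> cnorm Q (coset C J (c \<^bold>\<cdot> x))"
    using False by (simp add: norm_divide field_simps)
  with quotient_norm_scale_le [OF x, of c] show ?thesis by simp
qed

text \<open>Small representatives y of the coset of x give elements x - y of J close to x;
  closedness of J does the rest.\<close>

lemma quotient_norm_eq_0_iff:
  assumes x: "x \<in> carrier C"
  shows "cnorm Q (coset C J x) = 0 \<longleftrightarrow> coset C J x = coset C J \<^bold>0"
proof
  assume *: "cnorm Q (coset C J x) = 0"
  have "x \<in> J"
  proof (rule closedinD [OF ideal_closed x])
    fix e :: real assume "e > 0"
    then obtain y where y: "y \<in> coset C J x" "cnorm C y < e"
      using quotient_norm_less_iff [OF x, of e] * by auto
    have yc: "y \<in> carrier C" "x \<^bold>- y \<in> J"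
      using y x sub_in_ideal_commute by (auto simp: mem_coset_iff)
    have "x \<^bold>- (x \<^bold>- y) = y"
      using x yc(1) by (simp add: csub_def scale_add_right scale_scale)
    then show "\<exists>v\<in>J. cnorm C (x \<^bold>- v) < e"
      using y yc by (intro bexI [of _ "x \<^bold>- y"]) auto
  qed
  then show "coset C J x = coset C J \<^bold>0"
    by (rule coset_zero)
next
  assume "coset C J x = coset C J \<^bold>0"
  then show "cnorm Q (coset C J x) = 0"
    using quotient_norm_le [of "\<^bold>0" "\<^bold>0"] quotient_norm_nonneg [of "\<^bold>0"] by simp
qed

lemma pre_cstar_algebra_quotient: "pre_cstar_algebra Q"
proof
  fix X c d assume "X \<in> carrier Q"
  then obtain x where X: "X = coset C J x" and x: "x \<in> carrier C"
    by auto
  show "\<^bold>0\<^bsub>Q\<^esub> \<^bold>+\<^bsub>Q\<^esub> X = X" "X \<^bold>+\<^bsub>Q\<^esub> (-1) \<^bold>\<cdot>\<^bsub>Q\<^esub> X = \<^bold>0\<^bsub>Q\<^esub>"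
      "c \<^bold>\<cdot>\<^bsub>Q\<^esub> X \<in> carrier Q" "1 \<^bold>\<cdot>\<^bsub>Q\<^esub> X = X" "c \<^bold>\<cdot>\<^bsub>Q\<^esub> (d \<^bold>\<cdot>\<^bsub>Q\<^esub> X) = (c * d) \<^bold>\<cdot>\<^bsub>Q\<^esub> X"
      "(c + d) \<^bold>\<cdot>\<^bsub>Q\<^esub> X = c \<^bold>\<cdot>\<^bsub>Q\<^esub> X \<^bold>+\<^bsub>Q\<^esub> d \<^bold>\<cdot>\<^bsub>Q\<^esub> X"
      "X\<^sup>\<dagger>\<^bsub>Q\<^esub> \<in> carrier Q" "(X\<^sup>\<dagger>\<^bsub>Q\<^esub>)\<^sup>\<dagger>\<^bsub>Q\<^esub> = X"
      "(c \<^bold>\<cdot>\<^bsub>Q\<^esub> X)\<^sup>\<dagger>\<^bsub>Q\<^esub> = cnj c \<^bold>\<cdot>\<^bsub>Q\<^esub> (X\<^sup>\<dagger>\<^bsub>Q\<^esub>)"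
    unfolding X zero_quotient carrier_quotient using x
    by (simp_all add: coset_add coset_scale coset_adj scale_scale scale_add_left adj_scale)
  show "cnorm Q X = 0 \<longleftrightarrow> X = \<^bold>0\<^bsub>Q\<^esub>"
    unfolding X zero_quotient using x by (rule quotient_norm_eq_0_iff)
  show "cnorm Q (c \<^bold>\<cdot>\<^bsub>Q\<^esub> X) = cmod c * cnorm Q X"
    unfolding X coset_scale [OF x] using x by (rule quotient_norm_scale)
  show "cnorm Q (X\<^sup>\<dagger>\<^bsub>Q\<^esub> \<^bold>*\<^bsub>Q\<^esub> X) = (cnorm Q X)\<^sup>2"
  proof (rule antisym)
    show "(cnorm Q X)\<^sup>2 \<le> cnorm Q (X\<^sup>\<dagger>\<^bsub>Q\<^esub> \<^bold>*\<^bsub>Q\<^esub> X)"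
      using quotient_norm_square_le [OF x] x by (simp add: X coset_adj coset_mul)
    have "cnorm Q (X\<^sup>\<dagger>\<^bsub>Q\<^esub> \<^bold>*\<^bsub>Q\<^esub> X) \<le> cnorm Q (coset C J (x\<^sup>\<dagger>)) * cnorm Q (coset C J x)"
      using quotient_norm_mul [of "x\<^sup>\<dagger>" x] x by (simp add: X coset_adj coset_mul)
    also have "\<dots> \<le> cnorm Q (coset C J x) * cnorm Q (coset C J x)"
      using quotient_norm_adj_le [OF x] quotient_norm_nonneg [OF x] by (rule mult_right_mono)
    finally show "cnorm Q (X\<^sup>\<dagger>\<^bsub>Q\<^esub> \<^bold>*\<^bsub>Q\<^esub> X) \<le> (cnorm Q X)\<^sup>2"
      by (simp add: X power2_eq_square)
  qed
  fix Y assume "Y \<in> carrier Q"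
  then obtain y where Y: "Y = coset C J y" and y: "y \<in> carrier C"
    by auto
  show "X \<^bold>+\<^bsub>Q\<^esub> Y \<in> carrier Q" "X \<^bold>*\<^bsub>Q\<^esub> Y \<in> carrier Q"
      "c \<^bold>\<cdot>\<^bsub>Q\<^esub> (X \<^bold>+\<^bsub>Q\<^esub> Y) = c \<^bold>\<cdot>\<^bsub>Q\<^esub> X \<^bold>+\<^bsub>Q\<^esub> c \<^bold>\<cdot>\<^bsub>Q\<^esub> Y"
      "(c \<^bold>\<cdot>\<^bsub>Q\<^esub> X) \<^bold>*\<^bsub>Q\<^esub> Y = c \<^bold>\<cdot>\<^bsub>Q\<^esub> (X \<^bold>*\<^bsub>Q\<^esub> Y)"
      "X \<^bold>*\<^bsub>Q\<^esub> (c \<^bold>\<cdot>\<^bsub>Q\<^esub> Y) = c \<^bold>\<cdot>\<^bsub>Q\<^esub> (X \<^bold>*\<^bsub>Q\<^esub> Y)"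
      "(X \<^bold>+\<^bsub>Q\<^esub> Y)\<^sup>\<dagger>\<^bsub>Q\<^esub> = X\<^sup>\<dagger>\<^bsub>Q\<^esub> \<^bold>+\<^bsub>Q\<^esub> Y\<^sup>\<dagger>\<^bsub>Q\<^esub>"
      "(X \<^bold>*\<^bsub>Q\<^esub> Y)\<^sup>\<dagger>\<^bsub>Q\<^esub> = Y\<^sup>\<dagger>\<^bsub>Q\<^esub> \<^bold>*\<^bsub>Q\<^esub> X\<^sup>\<dagger>\<^bsub>Q\<^esub>"
    unfolding X Y carrier_quotient using x y
    by (simp_all add: coset_add coset_mul coset_scale coset_adj scale_add_right scale_mul_left
        scale_mul_right adj_add adj_mul)
  show "X \<^bold>+\<^bsub>Q\<^esub> Y = Y \<^bold>+\<^bsub>Q\<^esub> X"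
    unfolding X Y using x y by (simp add: coset_add add_comm [of x y])
  show "cnorm Q (X \<^bold>+\<^bsub>Q\<^esub> Y) \<le> cnorm Q X + cnorm Q Y"
    unfolding X Y coset_add [OF x y] using x y by (rule quotient_norm_triangle)
  show "cnorm Q (X \<^bold>*\<^bsub>Q\<^esub> Y) \<le> cnorm Q X * cnorm Q Y"
    unfolding X Y coset_mul [OF x y] using x y by (rule quotient_norm_mul)
  fix Z assume "Z \<in> carrier Q"
  then obtain z where Z: "Z = coset C J z" and z: "z \<in> carrier C"
    by auto
  show "X \<^bold>+\<^bsub>Q\<^esub> Y \<^bold>+\<^bsub>Q\<^esub> Z = X \<^bold>+\<^bsub>Q\<^esub> (Y \<^bold>+\<^bsub>Q\<^esub> Z)"
      "X \<^bold>*\<^bsub>Q\<^esub> Y \<^bold>*\<^bsub>Q\<^esub> Z = X \<^bold>*\<^bsub>Q\<^esub> (Y \<^bold>*\<^bsub>Q\<^esub> Z)"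
      "X \<^bold>*\<^bsub>Q\<^esub> (Y \<^bold>+\<^bsub>Q\<^esub> Z) = X \<^bold>*\<^bsub>Q\<^esub> Y \<^bold>+\<^bsub>Q\<^esub> X \<^bold>*\<^bsub>Q\<^esub> Z"
      "(X \<^bold>+\<^bsub>Q\<^esub> Y) \<^bold>*\<^bsub>Q\<^esub> Z = X \<^bold>*\<^bsub>Q\<^esub> Z \<^bold>+\<^bsub>Q\<^esub> Y \<^bold>*\<^bsub>Q\<^esub> Z"
    unfolding X Y Z using x y z
    by (simp_all add: coset_add coset_mul add_assoc mul_assoc mul_distrib_left mul_distrib_right)
qed (simp)

lemma quotient_sub:
  assumes "x \<in> carrier C" "y \<in> carrier C"
  shows "coset C J x \<^bold>-\<^bsub>Q\<^esub> coset C J y = coset C J (x \<^bold>- y)"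
  using assms by (simp add: csub_def coset_add coset_scale)

text \<open>A Cauchy sequence of cosets is lifted to a Cauchy sequence in C: along a subsequence
  with steps below (1/2)^k, representatives can be chosen with steps equally small, and the limit is
  projected back.\<close>

theorem cstar_algebra_quotient: "cstar_algebra Q"
proof -
  interpret Q: pre_cstar_algebra Q
    by (rule pre_cstar_algebra_quotient)
  show ?thesis
  proof (rule Q.cstar_algebraI)
    fix \<sigma> :: "nat \<Rightarrow> 'a set"
    assume \<sigma>: "\<And>n. \<sigma> n \<in> carrier Q"
      and Cauchy: "\<And>e. e > 0 \<Longrightarrow> \<exists>N. \<forall>m\<ge>N. \<forall>n\<ge>N. cnorm Q (\<sigma> m \<^bold>-\<^bsub>Q\<^esub> \<sigma> n) < e"
    have "\<exists>N. \<forall>k. \<forall>m\<ge>N k. \<forall>n\<ge>N k. cnorm Q (\<sigma> m \<^bold>-\<^bsub>Q\<^esub> \<sigma> n) < (1/2) ^ k"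
      by (intro choice allI Cauchy) simp
    then obtain N where N: "cnorm Q (\<sigma> m \<^bold>-\<^bsub>Q\<^esub> \<sigma> n) < (1/2) ^ k" if "m \<ge> N k" "n \<ge> N k" for k m n
      by blast
    \<comment> \<open>Summing makes M monotone and at least N, so both M k and M (Suc k) are past N
      k.\<close>
    define M where "M k = sum N {..k}" for k
    have M: "N k \<le> M k" "N k \<le> M (Suc k)" for k
    proof -
      show "N k \<le> M k"
        unfolding M_def by (rule member_le_sum) auto
      also have "\<dots> \<le> M (Suc k)"
        by (simp add: M_def)
      finally show "N k \<le> M (Suc k)" .
    qed
    have "\<exists>y. \<forall>k. y k \<in> carrier C \<and> coset C J (y k) = \<sigma> (M k) \<and> cnorm C (y (Suc k) \<^bold>- y k) < (1/2) ^ k"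
    proof -
      have "\<exists>y. \<forall>k. (y k \<in> carrier C \<and> coset C J (y k) = \<sigma> (M k)) \<and> cnorm C (y (Suc k) \<^bold>- y k) < (1/2) ^ k"
      proof (rule dependent_nat_choice)
        show "\<exists>x. x \<in> carrier C \<and> coset C J x = \<sigma> (M 0)"
          using \<sigma> [of "M 0"] by auto
        fix x n assume x: "x \<in> carrier C \<and> coset C J x = \<sigma> (M n)"
        obtain z where z: "z \<in> carrier C" "coset C J z = \<sigma> (M (Suc n))"
          using \<sigma> [of "M (Suc n)"] by auto
        have "cnorm Q (coset C J (z \<^bold>- x)) < (1/2) ^ n"
          using N [OF M(2) M(1)] x z by (simp flip: quotient_sub)
        \<comment> \<open>The next lift is the previous one x corrected by a small representative w
          of the difference; z itself may be far from x.\<close>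
        then obtain w where w: "w \<in> coset C J (z \<^bold>- x)" "cnorm C w < (1/2) ^ n"
          using quotient_norm_less_iff x z by blast
        have wc: "w \<in> carrier C"
          using w coset_subset x z by blast
        have "coset C J (w \<^bold>+ x) = coset C J (z \<^bold>- x) \<^bold>+\<^bsub>Q\<^esub> coset C J x"
          using coset_eqI [OF _ w(1)] wc x z coset_add [of w x] by simp
        also have "\<dots> = coset C J z"
          using x z coset_add [of "z \<^bold>- x" x] by simp
        finally have "coset C J (w \<^bold>+ x) = coset C J z" .
        with x z w wc show "\<exists>y. (y \<in> carrier C \<and> coset C J y = \<sigma> (M (Suc n))) \<and> cnorm C (y \<^bold>- x) < (1/2) ^ n"
          by (intro exI [of _ "w \<^bold>+ x"]) simp
      qed
      then show ?thesis by blast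
    qed
    then obtain y where y: "\<And>k. y k \<in> carrier C" "\<And>k. coset C J (y k) = \<sigma> (M k)"
      and step: "\<And>k. cnorm C (y (Suc k) \<^bold>- y k) < (1/2) ^ k"
      by blast
    \<comment> \<open>The exact geometric sum is kept, since the weaker bound 2 (1/2)^n alone is not
      inductive in d.\<close>
    have tail: "cnorm C (y (n + d) \<^bold>- y n) \<le> 2 * (1/2) ^ n - 2 * (1/2) ^ (n + d)" for n d
    proof (induction d)
      case 0
      then show ?case using y(1) by simp
    next
      case (Suc d)
      then show ?case
        using nrm_sub_triangle [OF y(1) y(1) y(1), of "Suc (n + d)" n "n + d"] step [of "n + d"] by simp
    qed
    have small: "\<exists>n. 2 * (1/2) ^ n < e" if "e > 0" for e :: real
      using real_arch_pow_inv [of "e/2" "1/2"] that by (auto simp: mult.commute)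
    have close: "cnorm C (y m \<^bold>- y n) \<le> 2 * (1/2) ^ n" if "m \<ge> n" for m n
    proof -
      have "cnorm C (y (n + (m - n)) \<^bold>- y n) \<le> 2 * (1/2) ^ n"
        using tail [of n "m - n"] by (rule order_trans) simp
      with that show ?thesis by simp
    qed
    have "\<exists>N. \<forall>m\<ge>N. \<forall>n\<ge>N. cnorm C (y m \<^bold>- y n) < e" if "e > 0" for e :: real
    proof -
      from that obtain n where n: "2 * (1/2) ^ n < e / 2"
        using small [of "e / 2"] by auto
      have "cnorm C (y a \<^bold>- y b) < e" if "a \<ge> n" "b \<ge> n" for a b
        using nrm_sub_triangle [OF y(1) y(1) y(1), of a b n] close [OF that(1)] close [OF that(2)]
          nrm_sub_commute [OF y(1) y(1), of n b] n by linarith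
      then show ?thesis
        by blast
    qed
    then have "\<exists>l\<in>carrier C. \<forall>e>0. \<exists>N. \<forall>n\<ge>N. cnorm C (y n \<^bold>- l) < e"
      by (rule Cauchy_converges [of y, OF y(1)])
    then obtain l where l: "l \<in> carrier C" "\<And>e. e > 0 \<Longrightarrow> \<exists>N. \<forall>n\<ge>N. cnorm C (y n \<^bold>- l) < e"
      by blast
    show "\<exists>L\<in>carrier Q. \<forall>e>0. \<exists>N. \<forall>n\<ge>N. cnorm Q (\<sigma> n \<^bold>-\<^bsub>Q\<^esub> L) < e"
    proof (intro bexI allI impI)
      show L: "coset C J l \<in> carrier Q"
        using l by simp
      fix e :: real assume e: "e > 0"
      then obtain N1 where N1: "cnorm C (y n \<^bold>- l) < e / 2" if "n \<ge> N1" for n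
        using l(2) [of "e / 2"] by auto
      obtain k where k: "2 * (1/2) ^ k < e / 2"
        using small [of "e / 2"] e by auto
      \<comment> \<open>K \<ge> k makes the Cauchy error (1/2)^K small, K \<ge> N1 the distance from
        y K to l; each takes half of e.\<close>
      define K where "K = max k N1"
      have "(1/2::real) ^ K \<le> (1/2) ^ k"
        by (rule power_decreasing) (auto simp: K_def)
      then have K: "(1/2::real) ^ K < e / 2"
        using k zero_less_power [of "1/2::real" k] by linarith
      have "cnorm Q (\<sigma> n \<^bold>-\<^bsub>Q\<^esub> coset C J l) < e" if "n \<ge> N K" for n
      proof -
        have "cnorm Q (\<sigma> (M K) \<^bold>-\<^bsub>Q\<^esub> coset C J l) \<le> cnorm C (y K \<^bold>- l)"
          unfolding y(2) [symmetric] quotient_sub [OF y(1) l(1)]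
          using y(1) l(1) by (intro quotient_norm_le) auto
        then show ?thesis
          using Q.nrm_sub_triangle [OF \<sigma> \<sigma> L, of n "M K"] N [OF that M(1)] N1 [of K] K
          by (simp add: K_def)
      qed
      then show "\<exists>N. \<forall>n\<ge>N. cnorm Q (\<sigma> n \<^bold>-\<^bsub>Q\<^esub> coset C J l) < e"
        by blast
    qed
  qed
qed

lemma star_hom_coset: "star_hom C Q (coset C J)"
  by (simp add: star_hom_def coset_add coset_mul coset_scale coset_adj)

end

section \<open>Transport along injections\<close>

text \<open>The universal property tests algebras over one type only. Copying along an injection
  brings algebras over other types, such as sets of cosets or operators, within its reach.\<close>

definition transport_cstar :: "('x \<Rightarrow> 'y) \<Rightarrow> 'x cstar_data \<Rightarrow> 'y cstar_data" where
  "transport_cstar f C = (let g = inv_into (carrier C) f in \<lparr>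
     carrier = f ` carrier C,
     czero = f \<^bold>0\<^bsub>C\<^esub>,
     cadd = (\<lambda>x y. f (g x \<^bold>+\<^bsub>C\<^esub> g y)),
     cmul = (\<lambda>x y. f (g x \<^bold>*\<^bsub>C\<^esub> g y)),
     cscale = (\<lambda>c x. f (c \<^bold>\<cdot>\<^bsub>C\<^esub> g x)),
     cadj = (\<lambda>x. f ((g x)\<^sup>\<dagger>\<^bsub>C\<^esub>)),
     cnorm = (\<lambda>x. cnorm C (g x))\<rparr>)"

context cstar_algebra
begin

context
  fixes f :: "'x \<Rightarrow> 'y"
  assumes inj: "inj_on f (carrier C)"
begin

private abbreviation "T \<equiv> transport_cstar f C"

lemma transport_simps:
  "carrier T = f ` carrier C"
  "\<^bold>0\<^bsub>T\<^esub> = f \<^bold>0"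
  "x \<in> carrier C \<Longrightarrow> y \<in> carrier C \<Longrightarrow> f x \<^bold>+\<^bsub>T\<^esub> f y = f (x \<^bold>+ y)"
  "x \<in> carrier C \<Longrightarrow> y \<in> carrier C \<Longrightarrow> f x \<^bold>*\<^bsub>T\<^esub> f y = f (x \<^bold>* y)"
  "x \<in> carrier C \<Longrightarrow> c \<^bold>\<cdot>\<^bsub>T\<^esub> f x = f (c \<^bold>\<cdot> x)"
  "x \<in> carrier C \<Longrightarrow> (f x)\<^sup>\<dagger>\<^bsub>T\<^esub> = f (x\<^sup>\<dagger>)"
  "x \<in> carrier C \<Longrightarrow> cnorm T (f x) = cnorm C x"
  "x \<in> carrier C \<Longrightarrow> y \<in> carrier C \<Longrightarrow> f x \<^bold>-\<^bsub>T\<^esub> f y = f (x \<^bold>- y)"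
  by (simp_all add: transport_cstar_def Let_def csub_def inv_into_f_f [OF inj])

lemma cstar_algebra_transport: "cstar_algebra T"
proof -
  have eq_iff: "f x = f y \<longleftrightarrow> x = y" if "x \<in> carrier C" "y \<in> carrier C" for x y
    using inj_on_eq_iff [OF inj that] .
  interpret T: pre_cstar_algebra T
  proof
    fix X c d assume "X \<in> carrier T"
    then obtain x where X: "X = f x" and x: "x \<in> carrier C"
      by (auto simp: transport_simps)
    show "\<^bold>0\<^bsub>T\<^esub> \<^bold>+\<^bsub>T\<^esub> X = X" "X \<^bold>+\<^bsub>T\<^esub> (-1) \<^bold>\<cdot>\<^bsub>T\<^esub> X = \<^bold>0\<^bsub>T\<^esub>"
      "c \<^bold>\<cdot>\<^bsub>T\<^esub> X \<in> carrier T" "1 \<^bold>\<cdot>\<^bsub>T\<^esub> X = X" "c \<^bold>\<cdot>\<^bsub>T\<^esub> (d \<^bold>\<cdot>\<^bsub>T\<^esub> X) = (c * d) \<^bold>\<cdot>\<^bsub>T\<^esub> X"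
      "(c + d) \<^bold>\<cdot>\<^bsub>T\<^esub> X = c \<^bold>\<cdot>\<^bsub>T\<^esub> X \<^bold>+\<^bsub>T\<^esub> d \<^bold>\<cdot>\<^bsub>T\<^esub> X"
      "X\<^sup>\<dagger>\<^bsub>T\<^esub> \<in> carrier T" "(X\<^sup>\<dagger>\<^bsub>T\<^esub>)\<^sup>\<dagger>\<^bsub>T\<^esub> = X"
      "(c \<^bold>\<cdot>\<^bsub>T\<^esub> X)\<^sup>\<dagger>\<^bsub>T\<^esub> = cnj c \<^bold>\<cdot>\<^bsub>T\<^esub> (X\<^sup>\<dagger>\<^bsub>T\<^esub>)"
      "cnorm T X = 0 \<longleftrightarrow> X = \<^bold>0\<^bsub>T\<^esub>" "cnorm T (c \<^bold>\<cdot>\<^bsub>T\<^esub> X) = cmod c * cnorm T X"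
      "cnorm T (X\<^sup>\<dagger>\<^bsub>T\<^esub> \<^bold>*\<^bsub>T\<^esub> X) = (cnorm T X)\<^sup>2"
      unfolding X using x
      by (simp_all add: transport_simps scale_scale scale_add_left adj_scale nrm_eq_0_iff eq_iff
          nrm_scale cstar_identity)
    fix Y assume "Y \<in> carrier T"
    then obtain y where Y: "Y = f y" and y: "y \<in> carrier C"
      by (auto simp: transport_simps)
    show "X \<^bold>+\<^bsub>T\<^esub> Y \<in> carrier T" "X \<^bold>*\<^bsub>T\<^esub> Y \<in> carrier T"
      "c \<^bold>\<cdot>\<^bsub>T\<^esub> (X \<^bold>+\<^bsub>T\<^esub> Y) = c \<^bold>\<cdot>\<^bsub>T\<^esub> X \<^bold>+\<^bsub>T\<^esub> c \<^bold>\<cdot>\<^bsub>T\<^esub> Y"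
      "(c \<^bold>\<cdot>\<^bsub>T\<^esub> X) \<^bold>*\<^bsub>T\<^esub> Y = c \<^bold>\<cdot>\<^bsub>T\<^esub> (X \<^bold>*\<^bsub>T\<^esub> Y)"
      "X \<^bold>*\<^bsub>T\<^esub> (c \<^bold>\<cdot>\<^bsub>T\<^esub> Y) = c \<^bold>\<cdot>\<^bsub>T\<^esub> (X \<^bold>*\<^bsub>T\<^esub> Y)"
      "(X \<^bold>+\<^bsub>T\<^esub> Y)\<^sup>\<dagger>\<^bsub>T\<^esub> = X\<^sup>\<dagger>\<^bsub>T\<^esub> \<^bold>+\<^bsub>T\<^esub> Y\<^sup>\<dagger>\<^bsub>T\<^esub>"
      "(X \<^bold>*\<^bsub>T\<^esub> Y)\<^sup>\<dagger>\<^bsub>T\<^esub> = Y\<^sup>\<dagger>\<^bsub>T\<^esub> \<^bold>*\<^bsub>T\<^esub> X\<^sup>\<dagger>\<^bsub>T\<^esub>"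
      "cnorm T (X \<^bold>+\<^bsub>T\<^esub> Y) \<le> cnorm T X + cnorm T Y"
      "cnorm T (X \<^bold>*\<^bsub>T\<^esub> Y) \<le> cnorm T X * cnorm T Y"
      unfolding X Y using x y
      by (simp_all add: transport_simps scale_add_right scale_mul_left scale_mul_right adj_add adj_mul
          nrm_triangle nrm_mul)
    show "X \<^bold>+\<^bsub>T\<^esub> Y = Y \<^bold>+\<^bsub>T\<^esub> X"
      unfolding X Y using x y by (simp add: transport_simps add_comm [of x y])
    fix Z assume "Z \<in> carrier T"
    then obtain z where Z: "Z = f z" and z: "z \<in> carrier C"
      by (auto simp: transport_simps)
    show "X \<^bold>+\<^bsub>T\<^esub> Y \<^bold>+\<^bsub>T\<^esub> Z = X \<^bold>+\<^bsub>T\<^esub> (Y \<^bold>+\<^bsub>T\<^esub> Z)"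
      "X \<^bold>*\<^bsub>T\<^esub> Y \<^bold>*\<^bsub>T\<^esub> Z = X \<^bold>*\<^bsub>T\<^esub> (Y \<^bold>*\<^bsub>T\<^esub> Z)"
      "X \<^bold>*\<^bsub>T\<^esub> (Y \<^bold>+\<^bsub>T\<^esub> Z) = X \<^bold>*\<^bsub>T\<^esub> Y \<^bold>+\<^bsub>T\<^esub> X \<^bold>*\<^bsub>T\<^esub> Z"
      "(X \<^bold>+\<^bsub>T\<^esub> Y) \<^bold>*\<^bsub>T\<^esub> Z = X \<^bold>*\<^bsub>T\<^esub> Z \<^bold>+\<^bsub>T\<^esub> Y \<^bold>*\<^bsub>T\<^esub> Z"
      unfolding X Y Z using x y z
      by (simp_all add: transport_simps add_assoc mul_assoc mul_distrib_left mul_distrib_right)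
  qed (simp add: transport_simps)
  show ?thesis
  proof (rule T.cstar_algebraI)
    fix \<sigma> :: "nat \<Rightarrow> 'y"
    assume \<sigma>: "\<And>n. \<sigma> n \<in> carrier T"
      and Cauchy: "\<And>e. e > 0 \<Longrightarrow> \<exists>N. \<forall>m\<ge>N. \<forall>n\<ge>N. cnorm T (\<sigma> m \<^bold>-\<^bsub>T\<^esub> \<sigma> n) < e"
    have "\<forall>n. \<exists>x. x \<in> carrier C \<and> \<sigma> n = f x"
      using \<sigma> by (auto simp: transport_simps)
    then obtain x where x: "\<And>n. x n \<in> carrier C" "\<And>n. \<sigma> n = f (x n)"
      by metis
    then have "\<exists>N. \<forall>m\<ge>N. \<forall>n\<ge>N. cnorm C (x m \<^bold>- x n) < e" if "e > 0" for e
      using Cauchy [OF that] by (simp add: transport_simps)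
    then have "\<exists>l\<in>carrier C. \<forall>e>0. \<exists>N. \<forall>n\<ge>N. cnorm C (x n \<^bold>- l) < e"
      by (rule Cauchy_converges [of x, OF x(1)])
    then obtain l where "l \<in> carrier C" "\<And>e. e > 0 \<Longrightarrow> \<exists>N. \<forall>n\<ge>N. cnorm C (x n \<^bold>- l) < e"
      by blast
    then show "\<exists>L\<in>carrier T. \<forall>e>0. \<exists>N. \<forall>n\<ge>N. cnorm T (\<sigma> n \<^bold>-\<^bsub>T\<^esub> L) < e"
      using x by (intro bexI [of _ "f l"]) (simp_all add: transport_simps)
  qed
qed

lemma star_hom_transport: "star_hom C T f"
  by (simp add: star_hom_def transport_simps)

lemma star_hom_transport_inv: "star_hom T C (inv_into (carrier C) f)"
  by (auto simp: star_hom_def transport_simps inv_into_f_f [OF inj])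

end

end

section \<open>The universal property for algebras over other types\<close>

context cstar_hom
begin

text \<open>Applied below to the copying map of a transport; finiteness of the index sets lets
  \<phi> pass through the sum.\<close>

lemma hom_quotient_rep:
  assumes rep: "quotient_rep E \<B> R C t q"
    and fin: "\<And>A. A \<in> \<B> \<Longrightarrow> finite {a \<in> class_emitted_labels E R A \<inter> quotient_alphabet E R.
          R `` {rel_range E A [a]} \<noteq> R `` {{}}}"
    and closed: "\<And>A a. A \<in> \<B> \<Longrightarrow> a \<in> quotient_alphabet E R \<Longrightarrow> rel_range E A [a] \<in> \<B>"
    and closed2: "\<And>A B. A \<in> \<B> \<Longrightarrow> B \<in> \<B> \<Longrightarrow> A \<union> B \<in> \<B> \<and> A \<inter> B \<in> \<B>"
  shows "quotient_rep E \<B> R D (\<lambda>a. \<phi> (t a)) (\<lambda>X. \<phi> (q X))"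
proof -
  have q: "q (R `` {A}) \<in> carrier C" if "A \<in> \<B>" for A
    using rep quotientI [OF that, of R] by (auto simp: quotient_rep_def is_projection_def)
  have t: "t a \<in> carrier C" if "a \<in> quotient_alphabet E R" for a
    using rep that by (auto simp: quotient_rep_def is_partial_isometry_def)
  show ?thesis
    unfolding quotient_rep_def
  proof (intro conjI ballI impI)
    show "is_projection D (\<phi> (q X))" if "X \<in> \<B> // R" for X
      using rep that by (simp add: quotient_rep_def hom_projection)
    show "is_partial_isometry D (\<phi> (t a))" if "a \<in> quotient_alphabet E R" for a
      using rep that by (simp add: quotient_rep_def hom_partial_isometry)
    show "\<phi> (q (R `` {{}})) = \<^bold>0\<^bsub>D\<^esub>"
      using rep by (simp add: quotient_rep_def)
    show "\<phi> (q (R `` {A})) \<^bold>*\<^bsub>D\<^esub> \<phi> (q (R `` {B})) = \<phi> (q (R `` {A \<inter> B}))"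
      if "A \<in> \<B>" "B \<in> \<B>" for A B
      using rep that q by (simp add: quotient_rep_def flip: hom_mul)
    show "\<phi> (q (R `` {A \<union> B})) = \<phi> (q (R `` {A})) \<^bold>+\<^bsub>D\<^esub> \<phi> (q (R `` {B})) \<^bold>-\<^bsub>D\<^esub> \<phi> (q (R `` {A \<inter> B}))"
      if "A \<in> \<B>" "B \<in> \<B>" for A B
      using rep that q closed2 by (simp add: quotient_rep_def flip: hom_add hom_sub)
    show "\<phi> (q (R `` {A})) \<^bold>*\<^bsub>D\<^esub> \<phi> (t a) = \<phi> (t a) \<^bold>*\<^bsub>D\<^esub> \<phi> (q (R `` {rel_range E A [a]}))"
      if "A \<in> \<B>" "a \<in> quotient_alphabet E R" for A a
      using rep that q t closed by (simp add: quotient_rep_def flip: hom_mul)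
    show "(\<phi> (t a))\<^sup>\<dagger>\<^bsub>D\<^esub> \<^bold>*\<^bsub>D\<^esub> \<phi> (t a) = \<phi> (q (R `` {path_range E [a]}))"
      if "a \<in> quotient_alphabet E R" for a
      using rep that t by (simp add: quotient_rep_def flip: hom_mul hom_adj)
    show "(\<phi> (t a))\<^sup>\<dagger>\<^bsub>D\<^esub> \<^bold>*\<^bsub>D\<^esub> \<phi> (t b) = \<^bold>0\<^bsub>D\<^esub>"
      if "a \<in> quotient_alphabet E R" "b \<in> quotient_alphabet E R" "a \<noteq> b" for a b
      using rep that t by (simp add: quotient_rep_def flip: hom_mul hom_adj)
    fix A assume A: "A \<in> \<B>" "class_emitted_labels E R A \<inter> quotient_alphabet E R \<noteq> {}"
    let ?F = "{a \<in> class_emitted_labels E R A \<inter> quotient_alphabet E R.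
          R `` {rel_range E A [a]} \<noteq> R `` {{}}}"
    let ?f = "\<lambda>a. t a \<^bold>*\<^bsub>C\<^esub> q (R `` {rel_range E A [a]}) \<^bold>*\<^bsub>C\<^esub> (t a)\<^sup>\<dagger>\<^bsub>C\<^esub>"
    have f: "?f a \<in> carrier C" if "a \<in> ?F" for a
      using that t q closed A(1) by auto
    have "q (R `` {A}) = finprod (additive C) ?f ?F"
      using rep A by (simp add: quotient_rep_def)
    then have "\<phi> (q (R `` {A})) = finprod (additive D) (\<lambda>a. \<phi> (?f a)) ?F"
      using hom_finprod [OF fin [OF A(1)] f] by simp
    also have "\<dots> = finprod (additive D) (\<lambda>a. \<phi> (t a) \<^bold>*\<^bsub>D\<^esub> \<phi> (q (R `` {rel_range E A [a]})) \<^bold>*\<^bsub>D\<^esub> (\<phi> (t a))\<^sup>\<dagger>\<^bsub>D\<^esub>) ?F"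
      using t q closed A(1) by (intro D.add.finprod_cong) (auto simp: hom_mul hom_adj simp_implies_def)
    finally show "\<phi> (q (R `` {A})) = \<dots>" .
  qed
qed

end

text \<open>The homomorphism is obtained into a copy of F inside the universe and then composed with
  the inverse of the copying map.\<close>

lemma quotient_cstar_universal:
  fixes D :: "'u cstar_data" and F :: "'y cstar_data"
  assumes D: "is_quotient_cstar E \<B> R D t q"
    and F: "cstar_algebra F" "quotient_rep E \<B> R F T P"
    and small: "carrier F \<lesssim> (UNIV :: 'u set)"
    and fin: "\<And>A. A \<in> \<B> \<Longrightarrow> finite {a \<in> class_emitted_labels E R A \<inter> quotient_alphabet E R.
          R `` {rel_range E A [a]} \<noteq> R `` {{}}}"
    and closed: "\<And>A a. A \<in> \<B> \<Longrightarrow> a \<in> quotient_alphabet E R \<Longrightarrow> rel_range E A [a] \<in> \<B>"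
    and closed2: "\<And>A B. A \<in> \<B> \<Longrightarrow> B \<in> \<B> \<Longrightarrow> A \<union> B \<in> \<B> \<and> A \<inter> B \<in> \<B>"
  obtains \<pi> where "star_hom D F \<pi>" "\<And>a. a \<in> quotient_alphabet E R \<Longrightarrow> \<pi> (t a) = T a"
    "\<And>A. A \<in> \<B> \<Longrightarrow> \<pi> (q (R `` {A})) = P (R `` {A})"
proof -
  interpret F: cstar_algebra F by fact
  obtain f :: "'y \<Rightarrow> 'u" where f: "inj_on f (carrier F)"
    using small by (auto simp: lepoll_def)
  let ?T = "transport_cstar f F"
  interpret f: cstar_hom F ?T f
    by (intro cstar_hom.intro cstar_hom_axioms.intro F F.cstar_algebra_transport F.star_hom_transport f)
  have "quotient_rep E \<B> R ?T (\<lambda>a. f (T a)) (\<lambda>X. f (P X))"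
    by (rule f.hom_quotient_rep [OF F(2) fin closed closed2])
  then obtain \<pi> where \<pi>: "star_hom D ?T \<pi>" "\<forall>a\<in>quotient_alphabet E R. \<pi> (t a) = f (T a)"
      "\<forall>X\<in>\<B> // R. \<pi> (q X) = f (P X)"
    using D f.D.cstar_algebra_axioms unfolding is_quotient_cstar_def by metis
  show thesis
  proof (rule that)
    show "star_hom D F (\<lambda>x. inv_into (carrier F) f (\<pi> x))"
      by (rule star_hom_comp [OF \<pi>(1) F.star_hom_transport_inv [OF f]])
    fix a assume a: "a \<in> quotient_alphabet E R"
    then have "T a \<in> carrier F"
      using F(2) by (auto simp: quotient_rep_def is_partial_isometry_def)
    with a \<pi> f show "inv_into (carrier F) f (\<pi> (t a)) = T a"
      by simp
  next
    fix A assume A: "A \<in> \<B>"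
    then have X: "R `` {A} \<in> \<B> // R"
      by (rule quotientI)
    then have "P (R `` {A}) \<in> carrier F"
      using F(2) by (auto simp: quotient_rep_def is_projection_def)
    with X \<pi> f show "inv_into (carrier F) f (\<pi> (q (R `` {A}))) = P (R `` {A})"
      by simp
  qed
qed

section \<open>Operators on \<open>\<ell>\<^sup>2\<close>\<close>

text \<open>Sequences indexed by the naturals are enough because the orbits to be represented are
  countable.\<close>

typedef ell2 = "{f :: nat \<Rightarrow> complex. summable (\<lambda>n. (cmod (f n))\<^sup>2)}"
  morphisms ell2_nth Abs_ell2
  by (rule exI [of _ "\<lambda>_. 0"]) simp

setup_lifting type_definition_ell2

lemma summable_ell2 [simp]: "summable (\<lambda>n. (cmod (ell2_nth x n))\<^sup>2)"
  using ell2_nth [of x] by simp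

lemma ell2_eqI: "(\<And>n. ell2_nth x n = ell2_nth y n) \<Longrightarrow> x = y"
  by (simp add: ell2_nth_inject [symmetric] fun_eq_iff)

lemma summable_square_add:
  assumes "summable (\<lambda>n. (cmod (f n))\<^sup>2)" "summable (\<lambda>n. (cmod (g n))\<^sup>2)"
  shows "summable (\<lambda>n. (cmod (f n + g n))\<^sup>2)"
proof (rule summable_comparison_test')
  show "summable (\<lambda>n. 2 * (cmod (f n))\<^sup>2 + 2 * (cmod (g n))\<^sup>2)"
    using assms by (intro summable_add summable_mult)
  fix n
  have "(cmod (f n + g n))\<^sup>2 \<le> (cmod (f n) + cmod (g n))\<^sup>2"
    by (intro power_mono norm_triangle_ineq) simp
  also have "\<dots> \<le> 2 * (cmod (f n))\<^sup>2 + 2 * (cmod (g n))\<^sup>2"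
    using sum_squares_bound [of "cmod (f n)" "cmod (g n)"] unfolding power2_sum by linarith
  finally show "norm ((cmod (f n + g n))\<^sup>2) \<le> 2 * (cmod (f n))\<^sup>2 + 2 * (cmod (g n))\<^sup>2"
    by simp
qed

lemma summable_square_mult: "summable (\<lambda>n. (cmod (f n))\<^sup>2) \<Longrightarrow> summable (\<lambda>n. (cmod (c * f n))\<^sup>2)"
  by (simp add: norm_mult power_mult_distrib summable_mult)

lemma summable_norm_inner:
  assumes "summable (\<lambda>n. (cmod (f n))\<^sup>2)" "summable (\<lambda>n. (cmod (g n))\<^sup>2)"
  shows "summable (\<lambda>n. norm (f n \<bullet> g n))"
proof (rule summable_comparison_test')
  show "summable (\<lambda>n. (cmod (f n))\<^sup>2 + (cmod (g n))\<^sup>2)"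
    using assms by (intro summable_add)
  fix n
  have "norm (f n \<bullet> g n) \<le> cmod (f n) * cmod (g n)"
    using Cauchy_Schwarz_ineq2 by simp
  also have "\<dots> \<le> (cmod (f n))\<^sup>2 + (cmod (g n))\<^sup>2"
    using sum_squares_bound [of "cmod (f n)" "cmod (g n)"]
      mult_nonneg_nonneg [OF norm_ge_zero [of "f n"] norm_ge_zero [of "g n"]] by linarith
  finally show "norm (norm (f n \<bullet> g n)) \<le> (cmod (f n))\<^sup>2 + (cmod (g n))\<^sup>2"
    by simp
qed

lift_definition ell2_scale :: "complex \<Rightarrow> ell2 \<Rightarrow> ell2" is "\<lambda>c f n. c * f n"
  by (rule summable_square_mult)

text \<open>The inner product is the real part of the usual one, since bounded linear maps are taken
  over the reals. Complex scalars live in \<open>ell2_scale\<close>, and complex linearity is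
  imposed on the operators separately.\<close>

instantiation ell2 :: real_inner
begin

lift_definition zero_ell2 :: ell2 is "\<lambda>_. 0" by simp
lift_definition plus_ell2 :: "ell2 \<Rightarrow> ell2 \<Rightarrow> ell2" is "\<lambda>f g n. f n + g n"
  by (rule summable_square_add)
lift_definition uminus_ell2 :: "ell2 \<Rightarrow> ell2" is "\<lambda>f n. - f n" by simp
lift_definition minus_ell2 :: "ell2 \<Rightarrow> ell2 \<Rightarrow> ell2" is "\<lambda>f g n. f n - g n"
  subgoal for f g using summable_square_add [of f "\<lambda>n. - g n"] by simp
  done
lift_definition scaleR_ell2 :: "real \<Rightarrow> ell2 \<Rightarrow> ell2" is "\<lambda>r f n. r *\<^sub>R f n"
  by (simp add: power_mult_distrib summable_mult)
definition inner_ell2 :: "ell2 \<Rightarrow> ell2 \<Rightarrow> real" where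
  "inner_ell2 x y = (\<Sum>n. ell2_nth x n \<bullet> ell2_nth y n)"
definition norm_ell2 :: "ell2 \<Rightarrow> real" where
  "norm_ell2 x = sqrt (x \<bullet> x)"
definition dist_ell2 :: "ell2 \<Rightarrow> ell2 \<Rightarrow> real" where
  "dist_ell2 x y = norm (x - y)"
definition sgn_ell2 :: "ell2 \<Rightarrow> ell2" where
  "sgn_ell2 x = scaleR (inverse (norm x)) x"
definition uniformity_ell2 :: "(ell2 \<times> ell2) filter" where
  "uniformity_ell2 = (INF e\<in>{0<..}. principal {(x, y). dist x y < e})"
definition open_ell2 :: "ell2 set \<Rightarrow> bool" where
  "open_ell2 U = (\<forall>x\<in>U. \<forall>\<^sub>F (x', y) in uniformity. x' = x \<longrightarrow> y \<in> U)"

lemmas ell2_nth_simps [simp] = zero_ell2.rep_eq plus_ell2.rep_eq uminus_ell2.rep_eq minus_ell2.rep_eq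
  scaleR_ell2.rep_eq ell2_scale.rep_eq

lemma summable_inner_ell2: "summable (\<lambda>n. ell2_nth x n \<bullet> ell2_nth y n)"
  by (rule summable_norm_cancel [OF summable_norm_inner]) auto

instance
proof
  fix x y z :: ell2 and r s :: real
  show "x + y + z = x + (y + z)" "x + y = y + x" "0 + x = x" "- x + x = 0" "x - y = x + - y"
    "r *\<^sub>R (x + y) = r *\<^sub>R x + r *\<^sub>R y" "(r + s) *\<^sub>R x = r *\<^sub>R x + s *\<^sub>R x"
    "r *\<^sub>R s *\<^sub>R x = (r * s) *\<^sub>R x" "1 *\<^sub>R x = x"
    by (rule ell2_eqI; simp add: algebra_simps)+
  show "x \<bullet> y = y \<bullet> x"
    by (simp add: inner_ell2_def inner_commute)
  show "(x + y) \<bullet> z = x \<bullet> z + y \<bullet> z"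
    by (simp add: inner_ell2_def inner_add_left suminf_add summable_inner_ell2)
  show "r *\<^sub>R x \<bullet> y = r * (x \<bullet> y)"
    by (simp add: inner_ell2_def suminf_mult summable_inner_ell2)
  show "0 \<le> x \<bullet> x"
    unfolding inner_ell2_def by (intro suminf_nonneg summable_inner_ell2) simp
  have "x \<bullet> x = 0 \<longleftrightarrow> (\<forall>n. ell2_nth x n \<bullet> ell2_nth x n = 0)"
    unfolding inner_ell2_def by (intro suminf_eq_zero_iff summable_inner_ell2) simp
  also have "\<dots> \<longleftrightarrow> x = 0"
    using ell2_eqI [of x 0] by auto
  finally show "x \<bullet> x = 0 \<longleftrightarrow> x = 0" .
qed (rule dist_ell2_def norm_ell2_def sgn_ell2_def uniformity_ell2_def open_ell2_def)+

end

lemma norm_ell2_square: "(norm x)\<^sup>2 = (\<Sum>n. (cmod (ell2_nth x n))\<^sup>2)" for x :: ell2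
  unfolding power2_norm_eq_inner inner_ell2_def ..

lemma norm_ell2_leI:
  fixes x :: ell2
  assumes "\<And>K. (\<Sum>n<K. (cmod (ell2_nth x n))\<^sup>2) \<le> b\<^sup>2" "0 \<le> b"
  shows "norm x \<le> b"
proof (rule power2_le_imp_le)
  show "(norm x)\<^sup>2 \<le> b\<^sup>2"
    unfolding norm_ell2_square by (rule suminf_le_const) (use assms in auto)
qed fact

lemma sum_ell2_le: "finite F \<Longrightarrow> (\<Sum>n\<in>F. (cmod (ell2_nth x n))\<^sup>2) \<le> (norm x)\<^sup>2" for x :: ell2
  unfolding norm_ell2_square by (intro sum_le_suminf) auto

lemma cmod_ell2_nth_le: "cmod (ell2_nth x n) \<le> norm x" for x :: ell2
  by (rule power2_le_imp_le) (use sum_ell2_le [of "{n}" x] in auto)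

instance ell2 :: complete_space
proof
  fix X :: "nat \<Rightarrow> ell2" assume "Cauchy X"
  then have X: "\<exists>M. \<forall>m\<ge>M. \<forall>n\<ge>M. norm (X m - X n) < e" if "e > 0" for e
    using that unfolding Cauchy_def dist_norm by blast
  have "Cauchy (\<lambda>m. ell2_nth (X m) k)" for k
  proof (rule CauchyI)
    fix e :: real assume "e > 0"
    then obtain M where M: "\<And>m n. m \<ge> M \<Longrightarrow> n \<ge> M \<Longrightarrow> norm (X m - X n) < e"
      using X by blast
    have "cmod (ell2_nth (X m) k - ell2_nth (X n) k) < e" if "m \<ge> M" "n \<ge> M" for m n
      using cmod_ell2_nth_le [of "X m - X n" k] M [OF that] by simp
    then show "\<exists>M. \<forall>m\<ge>M. \<forall>n\<ge>M. norm (ell2_nth (X m) k - ell2_nth (X n) k) < e"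
      by blast
  qed
  then have "\<exists>l. \<forall>k. (\<lambda>m. ell2_nth (X m) k) \<longlonglongrightarrow> l k"
    by (intro choice allI) (simp add: Cauchy_convergent_iff convergent_def)
  then obtain l where l: "\<And>k. (\<lambda>m. ell2_nth (X m) k) \<longlonglongrightarrow> l k"
    by blast
  \<comment> \<open>A finite partial sum is continuous in its terms, so the Cauchy estimate survives
    the limit in n; uniformity in K then gives both summability of the limit and convergence to
    it.\<close>
  have bound: "(\<Sum>k<K. (cmod (ell2_nth (X m) k - l k))\<^sup>2) \<le> e\<^sup>2"
    if e: "e > 0" and M: "\<And>m n. m \<ge> M \<Longrightarrow> n \<ge> M \<Longrightarrow> norm (X m - X n) < e" and m: "m \<ge> M" for e M m K
  proof (rule tendsto_upperbound)
    show "(\<lambda>n. \<Sum>k<K. (cmod (ell2_nth (X m) k - ell2_nth (X n) k))\<^sup>2)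
        \<longlonglongrightarrow> (\<Sum>k<K. (cmod (ell2_nth (X m) k - l k))\<^sup>2)"
      by (intro tendsto_intros l)
    have "(\<Sum>k<K. (cmod (ell2_nth (X m) k - ell2_nth (X n) k))\<^sup>2) \<le> e\<^sup>2" if "n \<ge> M" for n
    proof -
      have "(\<Sum>k<K. (cmod (ell2_nth (X m) k - ell2_nth (X n) k))\<^sup>2) \<le> (norm (X m - X n))\<^sup>2"
        using sum_ell2_le [of "{..<K}" "X m - X n"] by simp
      also have "\<dots> \<le> e\<^sup>2"
        using M [OF m that] by (intro power_mono) auto
      finally show ?thesis .
    qed
    then show "\<forall>\<^sub>F n in sequentially. (\<Sum>k<K. (cmod (ell2_nth (X m) k - ell2_nth (X n) k))\<^sup>2) \<le> e\<^sup>2"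
      unfolding eventually_sequentially by blast
  qed simp
  obtain M1 where "\<And>m n. m \<ge> M1 \<Longrightarrow> n \<ge> M1 \<Longrightarrow> norm (X m - X n) < 1"
    using X [of 1] by auto
  then have "(\<Sum>k<K. (cmod (ell2_nth (X M1) k - l k))\<^sup>2) \<le> 1\<^sup>2" for K
    by (intro bound [of _ M1]) auto
  then have "summable (\<lambda>k. (cmod (ell2_nth (X M1) k - l k))\<^sup>2)"
    by (intro bounded_imp_summable [where B = 1]) (auto simp del: sum.lessThan_Suc simp flip: lessThan_Suc_atMost)
  \<comment> \<open>The limit is X M1 minus the difference just bounded, hence square summable
    itself.\<close>
  then have "summable (\<lambda>k. (cmod (ell2_nth (X M1) k + - (ell2_nth (X M1) k - l k)))\<^sup>2)"
    by (intro summable_square_add) (simp_all only: norm_minus_cancel summable_ell2)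
  then have L: "ell2_nth (Abs_ell2 l) = l"
    by (simp add: Abs_ell2_inverse)
  have "X \<longlonglongrightarrow> Abs_ell2 l"
  proof (rule LIMSEQ_I)
    fix r :: real assume r: "r > 0"
    then obtain M where M: "\<And>m n. m \<ge> M \<Longrightarrow> n \<ge> M \<Longrightarrow> norm (X m - X n) < r / 2"
      using X [of "r/2"] by auto
    have "norm (X m - Abs_ell2 l) \<le> r / 2" if "m \<ge> M" for m
      by (rule norm_ell2_leI) (use bound [OF _ M that] r in \<open>simp_all add: L\<close>)
    then have "norm (X m - Abs_ell2 l) < r" if "m \<ge> M" for m
      using that r order.strict_trans1 [of "norm (X m - Abs_ell2 l)" "r / 2" r] by simp
    then show "\<exists>M. \<forall>m\<ge>M. norm (X m - Abs_ell2 l) < r"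
      by blast
  qed
  then show "convergent X"
    by (auto simp: convergent_def)
qed

instance ell2 :: banach ..

lemma ell2_scale_simps [simp]:
  "ell2_scale 1 x = x"
  "ell2_scale (of_real r) x = r *\<^sub>R x"
  "ell2_scale c (ell2_scale d x) = ell2_scale (c * d) x"
  "ell2_scale c (x + y) = ell2_scale c x + ell2_scale c y"
  "ell2_scale (c + d) x = ell2_scale c x + ell2_scale d x"
  "ell2_scale c 0 = 0"
  "ell2_scale c (r *\<^sub>R x) = r *\<^sub>R ell2_scale c x"
  by (rule ell2_eqI; simp add: algebra_simps scaleR_conv_of_real)+

lemma inner_ell2_scale: "ell2_scale c x \<bullet> y = x \<bullet> ell2_scale (cnj c) y"
  by (simp add: inner_ell2_def inner_complex_def algebra_simps)

lemma norm_ell2_scale: "norm (ell2_scale c x) = cmod c * norm x"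
proof -
  have "(norm (ell2_scale c x))\<^sup>2 = (cmod c * norm x)\<^sup>2"
    by (simp add: norm_ell2_square norm_mult power_mult_distrib suminf_mult)
  then show ?thesis
    by (rule power2_eq_imp_eq) simp_all
qed

lemma bounded_linear_ell2_scale: "bounded_linear (ell2_scale c)"
  by (rule bounded_linear_intro [where K = "cmod c"]) (simp_all add: norm_ell2_scale mult.commute)

section \<open>The C*-algebra of adjointable operators\<close>

definition ell2_scale_op :: "complex \<Rightarrow> ell2 \<Rightarrow>\<^sub>L ell2" where
  "ell2_scale_op c = Blinfun (ell2_scale c)"

lemma ell2_scale_op_apply [simp]: "blinfun_apply (ell2_scale_op c) = ell2_scale c"
  by (simp add: ell2_scale_op_def bounded_linear_Blinfun_apply bounded_linear_ell2_scale)

text \<open>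
  Requiring an adjoint, as for Hilbert modules, makes the Riesz representation theorem unnecessary.
\<close>
definition has_adjoint :: "(ell2 \<Rightarrow>\<^sub>L ell2) \<Rightarrow> (ell2 \<Rightarrow>\<^sub>L ell2) \<Rightarrow> bool" where
  "has_adjoint S T \<longleftrightarrow> (\<forall>x y. blinfun_apply S x \<bullet> y = x \<bullet> blinfun_apply T y)"

definition complex_linear :: "(ell2 \<Rightarrow>\<^sub>L ell2) \<Rightarrow> bool" where
  "complex_linear T \<longleftrightarrow> (\<forall>c x. blinfun_apply T (ell2_scale c x) = ell2_scale c (blinfun_apply T x))"

definition ell2_operators :: "(ell2 \<Rightarrow>\<^sub>L ell2) cstar_data" where
  "ell2_operators = \<lparr>
     carrier = {T. complex_linear T \<and> (\<exists>S. has_adjoint T S)},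
     czero = 0,
     cadd = (+),
     cmul = (o\<^sub>L),
     cscale = (\<lambda>c T. ell2_scale_op c o\<^sub>L T),
     cadj = (\<lambda>T. SOME S. has_adjoint T S),
     cnorm = norm\<rparr>"

lemma has_adjoint_unique: "has_adjoint T S \<Longrightarrow> has_adjoint T S' \<Longrightarrow> S = S'"
  unfolding has_adjoint_def by (intro blinfun_eqI) (metis vector_eq_ldot)

lemma has_adjoint_sym: "has_adjoint T S \<Longrightarrow> has_adjoint S T"
  unfolding has_adjoint_def by (metis inner_commute)

lemma cadj_eqI: "has_adjoint T S \<Longrightarrow> T\<^sup>\<dagger>\<^bsub>ell2_operators\<^esub> = S"
  unfolding ell2_operators_def by (simp add: some_equality has_adjoint_unique)

lemma mem_ell2_operators: "T \<in> carrier ell2_operators \<longleftrightarrow> complex_linear T \<and> (\<exists>S. has_adjoint T S)"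
  by (simp add: ell2_operators_def)

lemma has_adjoint_cadj: "T \<in> carrier ell2_operators \<Longrightarrow> has_adjoint T (T\<^sup>\<dagger>\<^bsub>ell2_operators\<^esub>)"
  using cadj_eqI mem_ell2_operators by auto

text \<open>Multiplication by c has the adjoint cnj c for the real inner product too, so the real
  adjoint of a complex linear map is again complex linear.\<close>

lemma complex_linear_adjoint:
  assumes "complex_linear T" "has_adjoint T S"
  shows "complex_linear S"
  unfolding complex_linear_def
proof (intro allI)
  fix c y
  have "x \<bullet> S (ell2_scale c y) = x \<bullet> ell2_scale c (S y)" for x
  proof -
    have "x \<bullet> S (ell2_scale c y) = T x \<bullet> ell2_scale c y"
      using assms(2) by (simp add: has_adjoint_def)
    also have "\<dots> = T (ell2_scale (cnj c) x) \<bullet> y"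
      using assms(1) by (simp add: complex_linear_def inner_ell2_scale)
    also have "\<dots> = ell2_scale (cnj c) x \<bullet> S y"
      using assms(2) by (simp add: has_adjoint_def)
    finally show ?thesis
      by (simp add: inner_ell2_scale)
  qed
  then show "S (ell2_scale c y) = ell2_scale c (S y)"
    using vector_eq_ldot [of "S (ell2_scale c y)" "ell2_scale c (S y)"] by blast
qed

lemma ell2_operators_simps [simp]:
  "\<^bold>0\<^bsub>ell2_operators\<^esub> = 0" "S \<^bold>+\<^bsub>ell2_operators\<^esub> T = S + T" "S \<^bold>*\<^bsub>ell2_operators\<^esub> T = S o\<^sub>L T"
  "c \<^bold>\<cdot>\<^bsub>ell2_operators\<^esub> T = ell2_scale_op c o\<^sub>L T" "cnorm ell2_operators T = norm T"
  by (simp_all add: ell2_operators_def)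

lemma ell2_operators_sub: "S \<^bold>-\<^bsub>ell2_operators\<^esub> T = S - T"
proof -
  have "ell2_scale (- 1) x = - x" for x
    by (rule ell2_eqI) simp
  then show ?thesis
    by (simp add: csub_def) (rule blinfun_eqI; simp add: blinfun.bilinear_simps)
qed

lemma norm_ell2_scale_op_le: "norm (ell2_scale_op c o\<^sub>L T) \<le> cmod c * norm T"
  using norm_blinfun [of T]
  by (intro norm_blinfun_bound) (auto simp: norm_ell2_scale mult.assoc mult_left_mono)

lemma norm_adjoint_le:
  assumes "has_adjoint T S"
  shows "norm S \<le> norm T"
proof (rule norm_blinfun_bound)
  fix y
  have "(norm (S y))\<^sup>2 = T (S y) \<bullet> y"
    using assms by (simp add: power2_norm_eq_inner has_adjoint_def)
  also have "\<dots> \<le> norm (T (S y)) * norm y"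
    by (rule norm_cauchy_schwarz)
  also have "\<dots> \<le> norm T * norm (S y) * norm y"
    by (intro mult_right_mono norm_blinfun) simp
  finally have "norm (S y) * norm (S y) \<le> norm (S y) * (norm T * norm y)"
    by (simp add: power2_eq_square ac_simps)
  then show "norm (S y) \<le> norm T * norm y"
    by (cases "norm (S y) = 0") (auto simp: mult_le_cancel_left)
qed simp

lemma norm_adjoint: "has_adjoint T S \<Longrightarrow> norm S = norm T"
  using norm_adjoint_le [of T S] norm_adjoint_le [of S T] has_adjoint_sym by auto

lemma pre_cstar_algebra_ell2_operators: "pre_cstar_algebra ell2_operators"
proof
  let ?O = "ell2_operators"
  have zero: "has_adjoint 0 0"
    by (simp add: has_adjoint_def)
  then show "\<^bold>0\<^bsub>?O\<^esub> \<in> carrier ?O"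
    by (auto simp: mem_ell2_operators complex_linear_def)
  fix T c d assume T: "T \<in> carrier ?O"
  then have Tl: "T (ell2_scale c x) = ell2_scale c (T x)" for c x
    by (simp add: mem_ell2_operators complex_linear_def)
  obtain T' where T': "has_adjoint T T'"
    using T by (auto simp: mem_ell2_operators)
  have T'_eq: "T\<^sup>\<dagger>\<^bsub>?O\<^esub> = T'"
    using T' by (rule cadj_eqI)
  have T'c: "T' \<in> carrier ?O"
    unfolding mem_ell2_operators
    using T has_adjoint_sym [OF T'] complex_linear_adjoint [OF _ T'] by (auto simp: mem_ell2_operators)
  have scale': "has_adjoint (ell2_scale_op c o\<^sub>L T) (ell2_scale_op (cnj c) o\<^sub>L T')" for c
    using T' complex_linear_adjoint [of T T'] T
    by (simp add: has_adjoint_def inner_ell2_scale complex_linear_def mem_ell2_operators)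
  show "\<^bold>0\<^bsub>?O\<^esub> \<^bold>+\<^bsub>?O\<^esub> T = T" "1 \<^bold>\<cdot>\<^bsub>?O\<^esub> T = T" "c \<^bold>\<cdot>\<^bsub>?O\<^esub> (d \<^bold>\<cdot>\<^bsub>?O\<^esub> T) = (c * d) \<^bold>\<cdot>\<^bsub>?O\<^esub> T"
      "(c + d) \<^bold>\<cdot>\<^bsub>?O\<^esub> T = c \<^bold>\<cdot>\<^bsub>?O\<^esub> T \<^bold>+\<^bsub>?O\<^esub> d \<^bold>\<cdot>\<^bsub>?O\<^esub> T"
    by (auto intro!: blinfun_eqI simp: blinfun.bilinear_simps)
  show "T \<^bold>+\<^bsub>?O\<^esub> (-1) \<^bold>\<cdot>\<^bsub>?O\<^esub> T = \<^bold>0\<^bsub>?O\<^esub>"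
    using ell2_operators_sub [of T T] by (simp add: csub_def)
  show "c \<^bold>\<cdot>\<^bsub>?O\<^esub> T \<in> carrier ?O"
    using scale' Tl by (auto simp: mem_ell2_operators complex_linear_def mult.commute)
  show "T\<^sup>\<dagger>\<^bsub>?O\<^esub> \<in> carrier ?O"
    using T'_eq T'c by simp
  show "(T\<^sup>\<dagger>\<^bsub>?O\<^esub>)\<^sup>\<dagger>\<^bsub>?O\<^esub> = T"
    unfolding T'_eq by (rule cadj_eqI [OF has_adjoint_sym [OF T']])
  show "(c \<^bold>\<cdot>\<^bsub>?O\<^esub> T)\<^sup>\<dagger>\<^bsub>?O\<^esub> = cnj c \<^bold>\<cdot>\<^bsub>?O\<^esub> (T\<^sup>\<dagger>\<^bsub>?O\<^esub>)"
    unfolding T'_eq ell2_operators_simps by (rule cadj_eqI [OF scale'])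
  show "cnorm ?O T = 0 \<longleftrightarrow> T = \<^bold>0\<^bsub>?O\<^esub>"
    by simp
  show "cnorm ?O (c \<^bold>\<cdot>\<^bsub>?O\<^esub> T) = cmod c * cnorm ?O T"
  proof (cases "c = 0")
    case True
    then show ?thesis
      using norm_ell2_scale_op_le [of 0 T] by simp
  next
    case False
    have "ell2_scale_op (1 / c) o\<^sub>L (ell2_scale_op c o\<^sub>L T) = T"
      using False by (intro blinfun_eqI) simp
    then have "norm T \<le> cmod (1 / c) * norm (ell2_scale_op c o\<^sub>L T)"
      using norm_ell2_scale_op_le [of "1 / c" "ell2_scale_op c o\<^sub>L T"] by simp
    then have "cmod c * norm T \<le> norm (ell2_scale_op c o\<^sub>L T)"
      using False by (simp add: norm_divide pos_le_divide_eq mult.commute)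
    with norm_ell2_scale_op_le [of c T] show ?thesis by simp
  qed
  show "cnorm ?O (T\<^sup>\<dagger>\<^bsub>?O\<^esub> \<^bold>*\<^bsub>?O\<^esub> T) = (cnorm ?O T)\<^sup>2"
  proof (rule antisym)
    show "cnorm ?O (T\<^sup>\<dagger>\<^bsub>?O\<^esub> \<^bold>*\<^bsub>?O\<^esub> T) \<le> (cnorm ?O T)\<^sup>2"
      using norm_blinfun_compose [of T' T] norm_adjoint [OF T'] by (simp add: T'_eq power2_eq_square)
    have "norm T \<le> sqrt (norm (T' o\<^sub>L T))"
    proof (rule norm_blinfun_bound)
      fix x
      have "(norm (T x))\<^sup>2 = x \<bullet> (T' o\<^sub>L T) x"
        using T' by (simp add: power2_norm_eq_inner has_adjoint_def)
      also have "\<dots> \<le> norm x * norm ((T' o\<^sub>L T) x)"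
        by (rule norm_cauchy_schwarz)
      also have "\<dots> \<le> norm x * (norm (T' o\<^sub>L T) * norm x)"
        by (intro mult_left_mono norm_blinfun) simp
      also have "\<dots> = (sqrt (norm (T' o\<^sub>L T)) * norm x)\<^sup>2"
        by (simp add: power_mult_distrib) (simp add: power2_eq_square)
      finally show "norm (T x) \<le> sqrt (norm (T' o\<^sub>L T)) * norm x"
        by (rule power2_le_imp_le) simp
    qed simp
    then have "(norm T)\<^sup>2 \<le> (sqrt (norm (T' o\<^sub>L T)))\<^sup>2"
      by (rule power_mono) simp
    then show "(cnorm ?O T)\<^sup>2 \<le> cnorm ?O (T\<^sup>\<dagger>\<^bsub>?O\<^esub> \<^bold>*\<^bsub>?O\<^esub> T)"
      by (simp add: T'_eq)
  qed
  fix S assume S: "S \<in> carrier ?O"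
  then have Sl: "S (ell2_scale c x) = ell2_scale c (S x)" for c x
    by (simp add: mem_ell2_operators complex_linear_def)
  obtain S' where S': "has_adjoint S S'"
    using S by (auto simp: mem_ell2_operators)
  have S'_eq: "S\<^sup>\<dagger>\<^bsub>?O\<^esub> = S'"
    using S' by (rule cadj_eqI)
  have add': "has_adjoint (T + S) (T' + S')"
    using S' T' by (simp add: has_adjoint_def blinfun.bilinear_simps inner_add_left inner_add_right)
  have mul': "has_adjoint (T o\<^sub>L S) (S' o\<^sub>L T')"
    using S' T' by (simp add: has_adjoint_def)
  show "T \<^bold>+\<^bsub>?O\<^esub> S \<in> carrier ?O"
    using add' Tl Sl by (auto simp: mem_ell2_operators complex_linear_def blinfun.bilinear_simps)
  show "T \<^bold>*\<^bsub>?O\<^esub> S \<in> carrier ?O"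
    using mul' Tl Sl by (auto simp: mem_ell2_operators complex_linear_def)
  show "T \<^bold>+\<^bsub>?O\<^esub> S = S \<^bold>+\<^bsub>?O\<^esub> T"
    by simp
  show "c \<^bold>\<cdot>\<^bsub>?O\<^esub> (T \<^bold>+\<^bsub>?O\<^esub> S) = c \<^bold>\<cdot>\<^bsub>?O\<^esub> T \<^bold>+\<^bsub>?O\<^esub> c \<^bold>\<cdot>\<^bsub>?O\<^esub> S"
      "(c \<^bold>\<cdot>\<^bsub>?O\<^esub> T) \<^bold>*\<^bsub>?O\<^esub> S = c \<^bold>\<cdot>\<^bsub>?O\<^esub> (T \<^bold>*\<^bsub>?O\<^esub> S)"
      "T \<^bold>*\<^bsub>?O\<^esub> (c \<^bold>\<cdot>\<^bsub>?O\<^esub> S) = c \<^bold>\<cdot>\<^bsub>?O\<^esub> (T \<^bold>*\<^bsub>?O\<^esub> S)"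
    by (auto intro!: blinfun_eqI simp: blinfun.bilinear_simps Tl)
  show "(T \<^bold>+\<^bsub>?O\<^esub> S)\<^sup>\<dagger>\<^bsub>?O\<^esub> = T\<^sup>\<dagger>\<^bsub>?O\<^esub> \<^bold>+\<^bsub>?O\<^esub> S\<^sup>\<dagger>\<^bsub>?O\<^esub>"
    unfolding T'_eq S'_eq ell2_operators_simps by (rule cadj_eqI [OF add'])
  show "(T \<^bold>*\<^bsub>?O\<^esub> S)\<^sup>\<dagger>\<^bsub>?O\<^esub> = S\<^sup>\<dagger>\<^bsub>?O\<^esub> \<^bold>*\<^bsub>?O\<^esub> T\<^sup>\<dagger>\<^bsub>?O\<^esub>"
    unfolding T'_eq S'_eq ell2_operators_simps by (rule cadj_eqI [OF mul'])
  show "cnorm ?O (T \<^bold>+\<^bsub>?O\<^esub> S) \<le> cnorm ?O T + cnorm ?O S"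
    by (simp add: norm_triangle_ineq)
  show "cnorm ?O (T \<^bold>*\<^bsub>?O\<^esub> S) \<le> cnorm ?O T * cnorm ?O S"
    by (simp add: norm_blinfun_compose)
  fix U assume "U \<in> carrier ?O"
  show "T \<^bold>+\<^bsub>?O\<^esub> S \<^bold>+\<^bsub>?O\<^esub> U = T \<^bold>+\<^bsub>?O\<^esub> (S \<^bold>+\<^bsub>?O\<^esub> U)"
      "T \<^bold>*\<^bsub>?O\<^esub> S \<^bold>*\<^bsub>?O\<^esub> U = T \<^bold>*\<^bsub>?O\<^esub> (S \<^bold>*\<^bsub>?O\<^esub> U)"
      "T \<^bold>*\<^bsub>?O\<^esub> (S \<^bold>+\<^bsub>?O\<^esub> U) = T \<^bold>*\<^bsub>?O\<^esub> S \<^bold>+\<^bsub>?O\<^esub> T \<^bold>*\<^bsub>?O\<^esub> U"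
      "(T \<^bold>+\<^bsub>?O\<^esub> S) \<^bold>*\<^bsub>?O\<^esub> U = T \<^bold>*\<^bsub>?O\<^esub> U \<^bold>+\<^bsub>?O\<^esub> S \<^bold>*\<^bsub>?O\<^esub> U"
    by (auto intro!: blinfun_eqI simp: blinfun.bilinear_simps)
qed

text \<open>Beyond completeness of the bounded operators, a limit must again have an adjoint: taking
  adjoints is isometric, so the adjoints converge as well, and their limit is the adjoint of the
  limit.\<close>

theorem cstar_algebra_ell2_operators: "cstar_algebra ell2_operators"
proof -
  let ?O = "ell2_operators"
  interpret pre_cstar_algebra ?O
    by (rule pre_cstar_algebra_ell2_operators)
  show ?thesis
  proof (rule cstar_algebraI)
    fix X :: "nat \<Rightarrow> ell2 \<Rightarrow>\<^sub>L ell2"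
    assume X: "\<And>n. X n \<in> carrier ?O"
      and "\<And>e. e > 0 \<Longrightarrow> \<exists>N. \<forall>m\<ge>N. \<forall>n\<ge>N. cnorm ?O (X m \<^bold>-\<^bsub>?O\<^esub> X n) < e"
    then have "Cauchy X"
      by (intro CauchyI) (simp add: ell2_operators_sub)
    define Y where "Y n = (X n)\<^sup>\<dagger>\<^bsub>?O\<^esub>" for n
    have Y: "has_adjoint (X n) (Y n)" for n
      unfolding Y_def by (rule has_adjoint_cadj [OF X])
    have "norm (Y m - Y n) = norm (X m - X n)" for m n
      using Y by (intro norm_adjoint)
        (simp add: has_adjoint_def blinfun.bilinear_simps inner_diff_left inner_diff_right)
    with \<open>Cauchy X\<close> have "Cauchy Y"
      by (simp add: Cauchy_def dist_norm)
    obtain L where L: "X \<longlonglongrightarrow> L"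
      using \<open>Cauchy X\<close> by (auto simp: Cauchy_convergent_iff convergent_def)
    obtain M where M: "Y \<longlonglongrightarrow> M"
      using \<open>Cauchy Y\<close> by (auto simp: Cauchy_convergent_iff convergent_def)
    have X_lim: "(\<lambda>n. X n x) \<longlonglongrightarrow> L x" for x
      by (intro tendsto_intros L)
    have Y_lim: "(\<lambda>n. Y n x) \<longlonglongrightarrow> M x" for x
      by (intro tendsto_intros M)
    have "has_adjoint L M"
      unfolding has_adjoint_def
    proof (intro allI)
      fix x y
      have "(\<lambda>n. X n x \<bullet> y) \<longlonglongrightarrow> L x \<bullet> y"
        by (intro tendsto_intros X_lim)
      moreover have "(\<lambda>n. x \<bullet> Y n y) \<longlonglongrightarrow> x \<bullet> M y"
        by (intro tendsto_intros Y_lim)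
      moreover have "X n x \<bullet> y = x \<bullet> Y n y" for n
        using Y by (simp add: has_adjoint_def)
      ultimately show "L x \<bullet> y = x \<bullet> M y"
        using LIMSEQ_unique by simp
    qed
    moreover have "complex_linear L"
      unfolding complex_linear_def
    proof (intro allI)
      fix c x
      have "(\<lambda>n. ell2_scale_op c (X n x)) \<longlonglongrightarrow> ell2_scale_op c (L x)"
        by (intro tendsto_intros X_lim)
      moreover have "ell2_scale_op c (X n x) = X n (ell2_scale c x)" for n
        using X [of n] by (simp add: mem_ell2_operators complex_linear_def)
      ultimately show "L (ell2_scale c x) = ell2_scale c (L x)"
        using LIMSEQ_unique [OF X_lim [of "ell2_scale c x"]] by simp
    qed
    ultimately have "L \<in> carrier ?O"
      by (auto simp: mem_ell2_operators)
    with L show "\<exists>l\<in>carrier ?O. \<forall>e>0. \<exists>N. \<forall>n\<ge>N. cnorm ?O (X n \<^bold>-\<^bsub>?O\<^esub> l) < e"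
      by (intro bexI [of _ L]) (simp_all add: ell2_operators_sub LIMSEQ_iff)
  qed
qed

text \<open>An operator is determined by its matrix, a point of a space of continuum size. The rows
  are read off the adjoint, coordinate i of T x being the pairing of x with T\<dagger>(e_i); this
  replaces density of the finite sequences.\<close>

lemma ell2_operators_lepoll_reals: "carrier ell2_operators \<lesssim> (UNIV :: real set)"
proof -
  define e where "e i = Abs_ell2 (\<lambda>n. if n = i then 1 else 0)" for i
  have e: "ell2_nth (e i) = (\<lambda>n. if n = i then 1 else 0)" for i
  proof -
    have "summable (\<lambda>n. (cmod (if n = i then 1 else 0))\<^sup>2)"
      by (rule summable_finite [of "{i}"]) auto
    then show ?thesis
      by (simp add: e_def Abs_ell2_inverse)
  qed
  \<comment> \<open>The inner product is real, so pairing with c e_i for all complex c is what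
    recovers a complex coordinate.\<close>
  have inner_e: "x \<bullet> ell2_scale c (e i) = ell2_nth x i \<bullet> c" for x c i
  proof -
    have "(\<Sum>n. ell2_nth x n \<bullet> (c * (if n = i then 1 else 0))) = (\<Sum>n\<in>{i}. ell2_nth x n \<bullet> (c * (if n = i then 1 else 0)))"
      by (rule suminf_finite) auto
    then show ?thesis
      by (simp add: inner_ell2_def e)
  qed
  define M where "M T i = ell2_nth ((T\<^sup>\<dagger>\<^bsub>ell2_operators\<^esub>) (e i))" for T i
  have "inj_on M (carrier ell2_operators)"
  proof (rule inj_onI)
    fix S T assume S: "S \<in> carrier ell2_operators" and T: "T \<in> carrier ell2_operators" and "M S = M T"
    then have *: "(S\<^sup>\<dagger>\<^bsub>ell2_operators\<^esub>) (e i) = (T\<^sup>\<dagger>\<^bsub>ell2_operators\<^esub>) (e i)" for i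
      using ell2_eqI by (simp add: M_def fun_eq_iff)
    have "ell2_nth (S x) i \<bullet> c = ell2_nth (T x) i \<bullet> c" for x i c
    proof -
      have "ell2_nth (U x) i \<bullet> c = x \<bullet> ell2_scale c ((U\<^sup>\<dagger>\<^bsub>ell2_operators\<^esub>) (e i))"
        if U: "U \<in> carrier ell2_operators" for U
      proof -
        have adj: "has_adjoint U (U\<^sup>\<dagger>\<^bsub>ell2_operators\<^esub>)"
          using U by (rule has_adjoint_cadj)
        then have "complex_linear (U\<^sup>\<dagger>\<^bsub>ell2_operators\<^esub>)"
          using U complex_linear_adjoint by (auto simp: mem_ell2_operators)
        with adj show ?thesis
          unfolding inner_e [symmetric] by (simp add: has_adjoint_def complex_linear_def)
      qed
      with S T * show ?thesis by simp
    qed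
    then have "ell2_nth (S x) i = ell2_nth (T x) i" for x i
      using vector_eq_rdot [of "ell2_nth (S x) i" "ell2_nth (T x) i"] by blast
    then show "S = T"
      by (intro blinfun_eqI ell2_eqI)
  qed
  then have "carrier ell2_operators \<lesssim> (UNIV :: (nat \<Rightarrow> nat \<Rightarrow> complex) set)"
    unfolding lepoll_def by blast
  also have "\<dots> \<lesssim> (UNIV :: nat set set)"
  proof -
    obtain h :: "real \<Rightarrow> nat set" where h: "inj h"
      using nat_sets_eqpoll_reals eqpoll_imp_lepoll eqpoll_sym unfolding lepoll_def by blast
    \<comment> \<open>Reals are coded by sets of naturals through h; the Boolean b selects the real
      or the imaginary part, so that a single set of quadruples codes the whole matrix.\<close>
    define A where "A F = {(b, i, j, k). k \<in> h (if b then Re (F i j) else Im (F i j))}"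
      for F :: "nat \<Rightarrow> nat \<Rightarrow> complex"
    have "inj (\<lambda>F. to_nat ` A F)"
    proof (rule injI)
      fix F G assume "to_nat ` A F = to_nat ` A G"
      then have AFG: "A F = A G"
        by (simp add: inj_image_eq_iff)
      have "k \<in> h (if b then Re (F i j) else Im (F i j)) \<longleftrightarrow> (b, i, j, k) \<in> A F"
        "k \<in> h (if b then Re (G i j) else Im (G i j)) \<longleftrightarrow> (b, i, j, k) \<in> A G" for b i j k
        by (simp_all add: A_def)
      then have "h (if b then Re (F i j) else Im (F i j)) = h (if b then Re (G i j) else Im (G i j))" for b i j
        unfolding AFG by blast
      from this [of True] this [of False]
      have "h (Re (F i j)) = h (Re (G i j))" "h (Im (F i j)) = h (Im (G i j))" for i j
        by simp_all
      then have "Re (F i j) = Re (G i j)" "Im (F i j) = Im (G i j)" for i j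
        using h by (simp_all add: inj_eq)
      then show "F = G"
        by (intro ext complex_eqI)
    qed
    then show ?thesis
      unfolding lepoll_def by blast
  qed
  also have "\<dots> \<lesssim> (UNIV :: real set)"
    using nat_sets_eqpoll_reals by (rule eqpoll_imp_lepoll)
  finally show ?thesis .
qed

section \<open>Operators given by partial injections of the index set\<close>

definition partial_inj :: "(nat \<Rightarrow> nat option) \<Rightarrow> bool" where
  "partial_inj g \<longleftrightarrow> inj_on g (dom g)"

definition partial_inv :: "(nat \<Rightarrow> nat option) \<Rightarrow> nat \<Rightarrow> nat option" where
  "partial_inv g n = (if Some n \<in> range g then Some (SOME m. g m = Some n) else None)"

lemma partial_injD: "partial_inj g \<Longrightarrow> g m = Some n \<Longrightarrow> g m' = Some n \<Longrightarrow> m = m'"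
  unfolding partial_inj_def by (rule inj_onD [of g "dom g"]) auto

lemma partial_inv_eq_Some_iff:
  assumes "partial_inj g"
  shows "partial_inv g n = Some m \<longleftrightarrow> g m = Some n"
proof
  assume "partial_inv g n = Some m"
  then have "Some n \<in> range g" "m = (SOME m. g m = Some n)"
    by (auto simp: partial_inv_def split: if_splits)
  then show "g m = Some n"
    using someI_ex [of "\<lambda>m. g m = Some n"] by (auto simp: image_iff eq_commute)
next
  assume m: "g m = Some n"
  then have "(SOME m. g m = Some n) = m"
    using partial_injD [OF assms] by (intro some_equality)
  with m show "partial_inv g n = Some m"
    by (auto simp: partial_inv_def image_iff eq_commute)
qed

lemma partial_inj_inv: "partial_inj g \<Longrightarrow> partial_inj (partial_inv g)"
  unfolding partial_inj_def [of "partial_inv g"]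
  by (auto intro!: inj_onI simp: partial_inv_eq_Some_iff)

lemma partial_inj_comp: "partial_inj g \<Longrightarrow> partial_inj h \<Longrightarrow> partial_inj (h \<circ>\<^sub>m g)"
  unfolding partial_inj_def [of "h \<circ>\<^sub>m g"]
  by (rule inj_onI) (auto simp: map_comp_def partial_injD split: option.splits dest: partial_injD)

lemma partial_inj_restrict [simp]: "partial_inj (Some |` X)"
  by (auto simp: partial_inj_def inj_on_def restrict_map_def)

text \<open>Pull-back along a partial map, whence the reversed order in
  \<open>shuffle_op_comp\<close>. Restrictions of the identity yield coordinate projections, partial
  injections yield partial isometries.\<close>

definition shuffle :: "(nat \<Rightarrow> nat option) \<Rightarrow> (nat \<Rightarrow> complex) \<Rightarrow> nat \<Rightarrow> complex" where
  "shuffle g f m = (case g m of None \<Rightarrow> 0 | Some n \<Rightarrow> f n)"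

text \<open>By injectivity the nonzero terms are squares of distinct coordinates of x.\<close>

lemma sum_shuffle_le:
  assumes "partial_inj g"
  shows "(\<Sum>m<K. (cmod (shuffle g (ell2_nth x) m))\<^sup>2) \<le> (norm x)\<^sup>2"
proof -
  let ?F = "{..<K} \<inter> dom g"
  have "(\<Sum>m<K. (cmod (shuffle g (ell2_nth x) m))\<^sup>2) = (\<Sum>m\<in>?F. (cmod (ell2_nth x (the (g m))))\<^sup>2)"
    by (intro sum.mono_neutral_cong_right) (auto simp: shuffle_def split: option.splits)
  also have "\<dots> = (\<Sum>n\<in>(\<lambda>m. the (g m)) ` ?F. (cmod (ell2_nth x n))\<^sup>2)"
    by (subst sum.reindex) (auto simp: inj_on_def dest: partial_injD [OF assms])
  also have "\<dots> \<le> (norm x)\<^sup>2"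
    by (intro sum_ell2_le) auto
  finally show ?thesis .
qed

lemma summable_shuffle: "partial_inj g \<Longrightarrow> summable (\<lambda>m. (cmod (shuffle g (ell2_nth x) m))\<^sup>2)"
  using sum_shuffle_le [of g x]
  by (intro bounded_imp_summable [where B = "(norm x)\<^sup>2"])
    (auto simp del: sum.lessThan_Suc simp flip: lessThan_Suc_atMost)

definition shuffle_op :: "(nat \<Rightarrow> nat option) \<Rightarrow> ell2 \<Rightarrow>\<^sub>L ell2" where
  "shuffle_op g = Blinfun (\<lambda>x. Abs_ell2 (shuffle g (ell2_nth x)))"

lemma shuffle_op_nth:
  assumes "partial_inj g"
  shows "ell2_nth (shuffle_op g x) m = shuffle g (ell2_nth x) m"
proof -
  have nth: "ell2_nth (Abs_ell2 (shuffle g (ell2_nth x))) = shuffle g (ell2_nth x)" for x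
    using summable_shuffle [OF assms] by (intro Abs_ell2_inverse) simp
  have "bounded_linear (\<lambda>x. Abs_ell2 (shuffle g (ell2_nth x)))"
  proof (rule bounded_linear_intro [where K = 1])
    show "norm (Abs_ell2 (shuffle g (ell2_nth x))) \<le> norm x * 1" for x
      using sum_shuffle_le [OF assms] by (intro norm_ell2_leI) (simp_all add: nth)
  qed (rule ell2_eqI, unfold nth, simp add: nth shuffle_def split: option.split)+
  then show ?thesis
    by (simp add: shuffle_op_def bounded_linear_Blinfun_apply nth)
qed

lemma shuffle_op_comp:
  assumes "partial_inj g" "partial_inj h"
  shows "shuffle_op g o\<^sub>L shuffle_op h = shuffle_op (h \<circ>\<^sub>m g)"
proof (intro blinfun_eqI ell2_eqI)
  fix x m
  show "ell2_nth ((shuffle_op g o\<^sub>L shuffle_op h) x) m = ell2_nth (shuffle_op (h \<circ>\<^sub>m g) x) m"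
    using assms partial_inj_comp [OF assms]
    by (simp add: shuffle_op_nth shuffle_def map_comp_def split: option.split)
qed

text \<open>Both pairings are the same sum over the graph of g, indexed once by the domain and once
  by the range. Absolute summability permits the reindexing, which is why the series are turned into
  unordered sums \<open>has_sum\<close>.\<close>

lemma has_adjoint_shuffle_op:
  assumes g: "partial_inj g"
  shows "has_adjoint (shuffle_op g) (shuffle_op (partial_inv g))"
  unfolding has_adjoint_def
proof (intro allI)
  fix x y
  have inner: "((\<lambda>n. ell2_nth u n \<bullet> ell2_nth v n) has_sum (u \<bullet> v)) UNIV" for u v
    unfolding inner_ell2_def
    by (rule norm_summable_imp_has_sum [OF summable_norm_inner summable_sums [OF summable_inner_ell2]]) auto
  let ?f = "\<lambda>m. ell2_nth x (the (g m)) \<bullet> ell2_nth y m"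
  let ?f' = "\<lambda>n. ell2_nth x n \<bullet> ell2_nth y (the (partial_inv g n))"
  have *: "(?f has_sum (shuffle_op g x \<bullet> y)) (dom g)"
    by (rule iffD1 [OF has_sum_cong_neutral inner])
      (auto simp: shuffle_op_nth [OF g] shuffle_def split: option.splits)
  have **: "(?f' has_sum (x \<bullet> shuffle_op (partial_inv g) y)) (dom (partial_inv g))"
    by (rule iffD1 [OF has_sum_cong_neutral inner])
      (auto simp: shuffle_op_nth [OF partial_inj_inv [OF g]] shuffle_def split: option.splits)
  have dom: "dom (partial_inv g) = (\<lambda>m. the (g m)) ` dom g"
    by (force simp: dom_def partial_inv_eq_Some_iff [OF g] image_iff)
  have "inj_on (\<lambda>m. the (g m)) (dom g)"
    by (auto simp: inj_on_def dest: partial_injD [OF g])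
  then have "((?f' \<circ> (\<lambda>m. the (g m))) has_sum (x \<bullet> shuffle_op (partial_inv g) y)) (dom g)"
    using ** unfolding dom by (simp add: has_sum_reindex)
  moreover have "(?f' \<circ> (\<lambda>m. the (g m))) m = ?f m" if m: "m \<in> dom g" for m
  proof -
    obtain n where "g m = Some n"
      using m by blast
    moreover from this have "partial_inv g n = Some m"
      using partial_inv_eq_Some_iff [OF g] by blast
    ultimately show ?thesis by simp
  qed
  ultimately have "(?f has_sum (x \<bullet> shuffle_op (partial_inv g) y)) (dom g)"
    using has_sum_cong [of "dom g" "?f' \<circ> (\<lambda>m. the (g m))" ?f] by blast
  then show "shuffle_op g x \<bullet> y = x \<bullet> shuffle_op (partial_inv g) y"
    using * has_sum_unique by blast
qed

lemma shuffle_op_closed: "partial_inj g \<Longrightarrow> shuffle_op g \<in> carrier ell2_operators"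
  using has_adjoint_shuffle_op
  by (auto simp: mem_ell2_operators complex_linear_def shuffle_op_nth shuffle_def intro!: ell2_eqI
      split: option.split)

lemma shuffle_op_adj: "partial_inj g \<Longrightarrow> (shuffle_op g)\<^sup>\<dagger>\<^bsub>ell2_operators\<^esub> = shuffle_op (partial_inv g)"
  by (rule cadj_eqI [OF has_adjoint_shuffle_op])

lemma shuffle_op_empty [simp]: "shuffle_op Map.empty = 0"
proof (intro blinfun_eqI ell2_eqI)
  have "partial_inj Map.empty"
    by (simp add: partial_inj_def)
  then show "ell2_nth (shuffle_op Map.empty x) n = ell2_nth (blinfun_apply 0 x) n" for x n
    by (simp add: shuffle_op_nth shuffle_def)
qed

lemma shuffle_op_restrict_eq_0_iff: "shuffle_op (Some |` X) = 0 \<longleftrightarrow> X = {}"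
proof
  assume *: "shuffle_op (Some |` X) = 0"
  have False if n: "n \<in> X" for n
  proof -
    have "summable (\<lambda>m. (cmod (if m = n then 1 else 0))\<^sup>2)"
      by (rule summable_finite [of "{n}"]) auto
    then have "ell2_nth (shuffle_op (Some |` X) (Abs_ell2 (\<lambda>m. if m = n then 1 else 0))) n = 1"
      using n by (simp add: shuffle_op_nth shuffle_def Abs_ell2_inverse)
    with * show False by simp
  qed
  then show "X = {}" by blast
qed simp

section \<open>Quotient labelled spaces\<close>

context labelled_graph
begin

abbreviation "G \<equiv> digraph_of E"

lemma mem_rel_range_single:
  "v \<in> rel_range E A [a] \<longleftrightarrow> (\<exists>e\<in>arcs G. label E e = a \<and> tail G e \<in> A \<and> head G e = v)"
proof
  assume "v \<in> rel_range E A [a]"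
  then obtain u \<pi> where "u \<in> A" "awalk u \<pi> v" "map (label E) \<pi> = [a]"
    by (auto simp: rel_range_def)
  then show "\<exists>e\<in>arcs G. label E e = a \<and> tail G e \<in> A \<and> head G e = v"
    by (auto simp: awalk_def map_eq_Cons_conv)
next
  assume "\<exists>e\<in>arcs G. label E e = a \<and> tail G e \<in> A \<and> head G e = v"
  then obtain e where "e \<in> arcs G" "label E e = a" "tail G e \<in> A" "head G e = v"
    by blast
  then show "v \<in> rel_range E A [a]"
    unfolding rel_range_def
    by (auto intro!: bexI [of _ "tail G e"] exI [of _ "[e]"] simp: awalk_def)
qed

lemma path_range_eq_rel_range: "path_range E \<alpha> = rel_range E UNIV \<alpha>"
  by (auto simp: path_range_def rel_range_def)

lemma rel_range_mono: "A \<subseteq> B \<Longrightarrow> rel_range E A \<alpha> \<subseteq> rel_range E B \<alpha>"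
  by (auto simp: rel_range_def)

lemma rel_range_subset: "rel_range E A \<alpha> \<subseteq> path_range E \<alpha>"
  unfolding path_range_eq_rel_range by (rule rel_range_mono) simp

lemma rel_range_empty [simp]: "rel_range E {} \<alpha> = {}"
  by (auto simp: rel_range_def)

lemma rel_range_Un: "rel_range E (A \<union> B) \<alpha> = rel_range E A \<alpha> \<union> rel_range E B \<alpha>"
  by (auto simp: rel_range_def)

lemma rel_range_Nil [simp]: "rel_range E A [] = {}"
  by (auto simp: rel_range_def)

text \<open>\<open>[]\<close> is excluded because its relative range is {} rather than A: only
  nonempty walks count.\<close>

lemma rel_range_Cons:
  assumes "\<beta> \<noteq> []"
  shows "rel_range E A (a # \<beta>) = rel_range E (rel_range E A [a]) \<beta>"
proof (intro Set.set_eqI iffI)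
  fix v assume "v \<in> rel_range E A (a # \<beta>)"
  then obtain u \<pi> where \<pi>: "u \<in> A" "awalk u \<pi> v" "map (label E) \<pi> = a # \<beta>"
    by (auto simp: rel_range_def)
  then obtain e \<pi>' where [simp]: "\<pi> = e # \<pi>'" and e: "label E e = a" "map (label E) \<pi>' = \<beta>"
    by (auto simp: map_eq_Cons_conv)
  have "awalk (head G e) \<pi>' v" "e \<in> arcs G" "tail G e = u"
    using \<pi>(2) by (auto simp: awalk_Cons_iff)
  moreover have "head G e \<in> rel_range E A [a]"
    using calculation \<pi>(1) e by (auto simp: mem_rel_range_single)
  moreover have "\<pi>' \<noteq> []"
    using e assms by auto
  ultimately show "v \<in> rel_range E (rel_range E A [a]) \<beta>"
    using e unfolding rel_range_def [of E "rel_range E A [a]"] by blast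
next
  fix v assume "v \<in> rel_range E (rel_range E A [a]) \<beta>"
  then obtain w \<pi> where \<pi>: "w \<in> rel_range E A [a]" "awalk w \<pi> v" "map (label E) \<pi> = \<beta>"
    unfolding rel_range_def [of E "rel_range E A [a]"] by blast
  then obtain e where e: "e \<in> arcs G" "label E e = a" "tail G e \<in> A" "head G e = w"
    by (auto simp: mem_rel_range_single)
  then have "awalk (tail G e) (e # \<pi>) v"
    using \<pi> by (simp add: awalk_Cons_iff)
  with e \<pi> show "v \<in> rel_range E A (a # \<beta>)"
    unfolding rel_range_def [of E A] by (auto intro!: bexI [of _ "tail G e"] exI [of _ "e # \<pi>"])
qed

lemma emitted_iff: "a \<in> emitted_labels E A \<longleftrightarrow> rel_range E A [a] \<noteq> {}"
proof -
  have "rel_range E A [a] \<noteq> {} \<longleftrightarrow> (\<exists>v. \<exists>e\<in>arcs G. label E e = a \<and> tail G e \<in> A \<and> head G e = v)"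
    unfolding mem_rel_range_single [symmetric] by blast
  then show ?thesis
    by (auto simp: emitted_labels_def)
qed

lemma emitted_subset: "emitted_labels E A \<subseteq> alphabet E"
  using label_surj by (auto simp: emitted_labels_def)

lemma single_path: "a \<in> alphabet E \<Longrightarrow> [a] \<in> labelled_paths E"
proof -
  assume "a \<in> alphabet E"
  then obtain e where e: "e \<in> arcs G" "a = label E e"
    using label_surj by blast
  then have "awalk (tail G e) [e] (head G e)"
    by (simp add: awalk_def)
  with e show ?thesis
    unfolding labelled_paths_def
    by (intro CollectI exI [of _ "[e]"] exI [of _ "tail G e"] exI [of _ "head G e"]) simp
qed

lemma labelled_paths_Cons: "a # \<beta> \<in> labelled_paths E \<Longrightarrow> \<beta> \<noteq> [] \<Longrightarrow> \<beta> \<in> labelled_paths E"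
proof -
  assume "a # \<beta> \<in> labelled_paths E" "\<beta> \<noteq> []"
  from this(1) have "\<exists>\<pi> u v. a # \<beta> = map (label E) \<pi> \<and> awalk u \<pi> v \<and> \<pi> \<noteq> []"
    by (simp only: labelled_paths_def mem_Collect_eq)
  then obtain \<pi> u v where \<pi>: "awalk u \<pi> v" "a # \<beta> = map (label E) \<pi>"
    by (elim exE conjE)
  then obtain e \<pi>' where "\<pi> = e # \<pi>'" "\<beta> = map (label E) \<pi>'"
    by (auto simp: Cons_eq_map_conv)
  moreover have "awalk (head G e) \<pi>' v"
    using \<pi>(1) calculation by (simp add: awalk_Cons_iff)
  ultimately show ?thesis
    using \<open>\<beta> \<noteq> []\<close> unfolding labelled_paths_def by blast
qed

end

locale quotient_setting = quotient_labelled_space E \<B> R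
  for E :: "('v, 'e, 'a) lgraph" and \<B> :: "'v set set" and R :: "'v set rel" +
  assumes set_finite: "set_finite E \<B>"
    and left_resolving: "weakly_left_resolving E \<B>"
    and no_sinks: "no_sinks E"
    and complements: "closed_under_relative_complements \<B>"
begin

abbreviation null :: "'v set \<Rightarrow> bool" where
  "null A \<equiv> R `` {A} = R `` {{}}"

abbreviation "\<A>\<^sub>R \<equiv> quotient_alphabet E R"

lemma diff_in: "A \<in> \<B> \<Longrightarrow> B \<in> \<B> \<Longrightarrow> A - B \<in> \<B>"
  using complements by (simp add: closed_under_relative_complements_def)

lemma class_eq_iff: "A \<in> \<B> \<Longrightarrow> B \<in> \<B> \<Longrightarrow> R `` {A} = R `` {B} \<longleftrightarrow> (A, B) \<in> R"
  using equiv by (simp add: eq_equiv_class_iff)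

lemma class_Un: "R `` {A \<union> B} = R `` {A' \<union> B'}"
  and class_Int: "R `` {A \<inter> B} = R `` {A' \<inter> B'}"
  and class_Diff: "R `` {A - B} = R `` {A' - B'}"
  if "A \<in> \<B>" "A' \<in> \<B>" "B \<in> \<B>" "B' \<in> \<B>" "R `` {A} = R `` {A'}" "R `` {B} = R `` {B'}"
  using that congruent2D [OF union_respects, of A A' B B'] congruent2D [OF inter_respects, of A A' B B']
    congruent2D [OF diff_respects, of A A' B B'] by (simp_all add: class_eq_iff)

lemma null_subset: "null A \<Longrightarrow> B \<subseteq> A \<Longrightarrow> A \<in> \<B> \<Longrightarrow> B \<in> \<B> \<Longrightarrow> null B"
  using class_Int [of B B A "{}"] empty_in by (simp add: Int_absorb2)

lemma null_Un: "null A \<Longrightarrow> null B \<Longrightarrow> A \<in> \<B> \<Longrightarrow> B \<in> \<B> \<Longrightarrow> null (A \<union> B)"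
  using class_Un [of A "{}" B "{}"] empty_in by simp

text \<open>So R is determined by its null sets, as a congruence of a Boolean algebra is by its
  ideal. Both sets are A \<inter> B up to a null part.\<close>

lemma class_eq_iff_null_diff:
  assumes "A \<in> \<B>" "B \<in> \<B>"
  shows "R `` {A} = R `` {B} \<longleftrightarrow> null (A - B) \<and> null (B - A)"
proof
  assume "R `` {A} = R `` {B}"
  then show "null (A - B) \<and> null (B - A)"
    using class_Diff [of A B B B] class_Diff [of B A A A] assms by simp
next
  assume *: "null (A - B) \<and> null (B - A)"
  have "R `` {(A \<inter> B) \<union> (A - B)} = R `` {(A \<inter> B) \<union> (B - A)}"
    using * assms by (intro class_Un) (simp_all add: inter_in diff_in)
  moreover have "(A \<inter> B) \<union> (A - B) = A" "(A \<inter> B) \<union> (B - A) = B"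
    by auto
  ultimately show "R `` {A} = R `` {B}" by simp
qed

lemma rel_range_single_in: "A \<in> \<B> \<Longrightarrow> a \<in> alphabet E \<Longrightarrow> rel_range E A [a] \<in> \<B>"
  by (simp add: rel_range_in single_path)

lemma range_single_in: "a \<in> alphabet E \<Longrightarrow> path_range E [a] \<in> \<B>"
  by (simp add: range_in single_path)

lemma quotient_alphabet_iff: "a \<in> \<A>\<^sub>R \<longleftrightarrow> a \<in> alphabet E \<and> \<not> null (path_range E [a])"
  by (simp add: quotient_alphabet_def)

lemma quotient_alphabetD: "a \<in> \<A>\<^sub>R \<Longrightarrow> a \<in> alphabet E"
  by (simp add: quotient_alphabet_def)

lemma single_quotient_path: "a \<in> \<A>\<^sub>R \<Longrightarrow> [a] \<in> quotient_paths E R"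
  by (simp add: single_path quotient_alphabetD)

lemma null_rel_range_outside:
  "A \<in> \<B> \<Longrightarrow> a \<in> alphabet E \<Longrightarrow> a \<notin> \<A>\<^sub>R \<Longrightarrow> null (rel_range E A [a])"
  by (rule null_subset [OF _ rel_range_subset])
    (auto simp: quotient_alphabet_iff rel_range_single_in range_single_in)

text \<open>Well-definedness is given for letters of \<open>\<A>\<^sub>R\<close>; for any other
  letter both relative ranges lie in the null set r(a).\<close>

lemma class_rel_range:
  assumes "A \<in> \<B>" "B \<in> \<B>" "R `` {A} = R `` {B}" "a \<in> alphabet E"
  shows "R `` {rel_range E A [a]} = R `` {rel_range E B [a]}"
proof (cases "a \<in> \<A>\<^sub>R")
  case True
  then show ?thesis
    using congruentD [OF rel_range_respects [OF single_quotient_path]] assms by (simp add: class_eq_iff)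
next
  case False
  then show ?thesis
    using assms by (simp add: null_rel_range_outside)
qed

lemma null_rel_range: "A \<in> \<B> \<Longrightarrow> null A \<Longrightarrow> a \<in> alphabet E \<Longrightarrow> null (rel_range E A [a])"
  using class_rel_range [of A "{}" a] empty_in by simp

lemma rel_range_Int:
  "A \<in> \<B> \<Longrightarrow> B \<in> \<B> \<Longrightarrow> a \<in> alphabet E \<Longrightarrow>
    rel_range E (A \<inter> B) [a] = rel_range E A [a] \<inter> rel_range E B [a]"
  using left_resolving single_path by (simp add: weakly_left_resolving_def)

text \<open>Brings the nondegeneracy axiom from words down to letters: a word a # \<beta> applies
  \<beta> to the null set r(A,a), and \<beta> respects R.\<close>

lemma null_of_letters:
  assumes A: "A \<in> \<B>" and null: "\<And>a. a \<in> \<A>\<^sub>R \<Longrightarrow> null (rel_range E A [a])"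
  shows "null A"
proof (rule class_empty [OF A])
  fix \<alpha> assume \<alpha>: "\<alpha> \<in> quotient_paths E R"
  show "null (rel_range E A \<alpha>)"
  proof (cases \<alpha>)
    case (Cons a \<beta>)
    then have a: "a \<in> \<A>\<^sub>R" "a \<in> alphabet E"
      using \<alpha> quotient_alphabetD by auto
    show ?thesis
    proof (cases "\<beta> = []")
      case True
      then show ?thesis
        using Cons null a by simp
    next
      case False
      then have "\<beta> \<in> quotient_paths E R"
        using \<alpha> Cons labelled_paths_Cons by auto
      then have "R `` {rel_range E (rel_range E A [a]) \<beta>} = R `` {rel_range E {} \<beta>}"
        using congruentD [OF rel_range_respects, of \<beta> "rel_range E A [a]" "{}"] null [OF a(1)]
        by (simp add: class_eq_iff rel_range_single_in A a empty_in)
      then show ?thesis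
        unfolding Cons rel_range_Cons [OF False] by simp
    qed
  qed simp
qed

lemma emitted_nonempty: "A \<in> \<B> \<Longrightarrow> A \<noteq> {} \<Longrightarrow> emitted_labels E A \<noteq> {}"
  using no_sinks subsets unfolding no_sinks_def emitted_labels_def by fast

lemma finite_emitted: "A \<in> \<B> \<Longrightarrow> finite (emitted_labels E A)"
  using set_finite by (simp add: set_finite_def)

text \<open>A letter with r(A,a) not null is emitted by A itself and belongs to
  \<open>\<A>\<^sub>R\<close>, so the sum over the whole class reduces to labels of A, of which
  there are finitely many.\<close>

lemma quotient_index_set:
  assumes A: "A \<in> \<B>"
  shows "{a \<in> class_emitted_labels E R A \<inter> \<A>\<^sub>R. \<not> null (rel_range E A [a])} =
    {a \<in> emitted_labels E A. \<not> null (rel_range E A [a])}"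
proof (intro Set.set_eqI iffI)
  fix a assume "a \<in> {a \<in> emitted_labels E A. \<not> null (rel_range E A [a])}"
  moreover from this have "a \<in> alphabet E"
    using emitted_subset by auto
  moreover have "A \<in> R `` {A}"
    using equiv A by (auto simp: equiv_def refl_on_def)
  ultimately show "a \<in> {a \<in> class_emitted_labels E R A \<inter> \<A>\<^sub>R. \<not> null (rel_range E A [a])}"
    using null_rel_range_outside [OF A] by (auto simp: class_emitted_labels_def)
qed (auto simp: emitted_iff)

lemma finite_quotient_index_set:
  "A \<in> \<B> \<Longrightarrow> finite {a \<in> class_emitted_labels E R A \<inter> \<A>\<^sub>R. \<not> null (rel_range E A [a])}"
  unfolding quotient_index_set using finite_emitted by simp

text \<open>Covers the classes on which the summation relation is silent.\<close>

lemma null_of_no_labels: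
  assumes A: "A \<in> \<B>" and "class_emitted_labels E R A \<inter> \<A>\<^sub>R = {}"
  shows "null A"
proof (rule null_of_letters [OF A])
  fix a assume a: "a \<in> \<A>\<^sub>R"
  then have "a \<notin> emitted_labels E A"
    using assms(2) equiv A by (auto simp: class_emitted_labels_def equiv_def refl_on_def)
  then show "null (rel_range E A [a])"
    by (simp add: emitted_iff)
qed

end

section \<open>The ideal generated by the null sets\<close>

context pre_cstar_algebra
begin

lemma mul_finprod:
  assumes "finite F" "x \<in> carrier C" "\<And>a. a \<in> F \<Longrightarrow> f a \<in> carrier C"
  shows "x \<^bold>* finprod (additive C) f F = finprod (additive C) (\<lambda>a. x \<^bold>* f a) F"
  using assms
proof (induction F)
  case (insert a F)
  then have "f \<in> F \<rightarrow> carrier C" "(\<lambda>a. x \<^bold>* f a) \<in> F \<rightarrow> carrier C"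
    by auto
  with insert show ?case
    by (simp add: add.finprod_insert mul_distrib_left add.finprod_closed)
qed simp

lemma finprod_mul:
  assumes "finite F" "x \<in> carrier C" "\<And>a. a \<in> F \<Longrightarrow> f a \<in> carrier C"
  shows "finprod (additive C) f F \<^bold>* x = finprod (additive C) (\<lambda>a. f a \<^bold>* x) F"
  using assms
proof (induction F)
  case (insert a F)
  then have "f \<in> F \<rightarrow> carrier C" "(\<lambda>a. f a \<^bold>* x) \<in> F \<rightarrow> carrier C"
    by auto
  with insert show ?case
    by (simp add: add.finprod_insert mul_distrib_right add.finprod_closed)
qed simp

lemma adj_finprod:
  assumes "finite F" "\<And>a. a \<in> F \<Longrightarrow> f a \<in> carrier C"
  shows "(finprod (additive C) f F)\<^sup>\<dagger> = finprod (additive C) (\<lambda>a. (f a)\<^sup>\<dagger>) F"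
  using assms
proof (induction F)
  case (insert a F)
  then have "f \<in> F \<rightarrow> carrier C" "(\<lambda>a. (f a)\<^sup>\<dagger>) \<in> F \<rightarrow> carrier C"
    by auto
  with insert show ?case
    by (simp add: add.finprod_insert adj_add add.finprod_closed)
qed simp

lemma finprod_single:
  assumes "finite F" "b \<in> F" "f b \<in> carrier C" "\<And>a. a \<in> F \<Longrightarrow> a \<noteq> b \<Longrightarrow> f a = \<^bold>0"
  shows "finprod (additive C) f F = f b"
proof -
  have "finprod (additive C) f F = finprod (additive C) f {b}"
  proof (rule add.finprod_mono_neutral_cong_left [symmetric])
    have "f a \<in> carrier C" if "a \<in> F" for a
      using assms(3) assms(4) [OF that] by (cases "a = b") auto
    then show "f \<in> F \<rightarrow> carrier C" by blast
  qed (use assms in auto)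
  also have "\<dots> = f b"
    using add.finprod_insert [of "{}" b f] assms by simp
  finally show ?thesis .
qed

lemma finprod_zero: "(\<And>a. a \<in> F \<Longrightarrow> f a = \<^bold>0) \<Longrightarrow> finprod (additive C) f F = \<^bold>0"
  using add.finprod_one_eqI [of F f] by simp

end

section \<open>Calculus with the generators and the levels of projections\<close>

locale labelled_cstar = quotient_setting E \<B> R + cstar_algebra C
  for E :: "('v, 'e, 'a) lgraph" and \<B> :: "'v set set" and R :: "'v set rel"
    and C :: "'x cstar_data" (structure) +
  fixes s :: "'a \<Rightarrow> 'x" and p :: "'v set \<Rightarrow> 'x"
  assumes rep: "labelled_space_rep E \<B> C s p"
    and generated: "generated_cstar_subalgebra C (s ` alphabet E \<union> p ` \<B>) = carrier C"
begin

lemma p_closed [simp, intro]: "A \<in> \<B> \<Longrightarrow> p A \<in> carrier C"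
  and p_adj: "A \<in> \<B> \<Longrightarrow> (p A)\<^sup>\<dagger> = p A"
  and s_closed [simp, intro]: "a \<in> alphabet E \<Longrightarrow> s a \<in> carrier C"
  and s_iso: "a \<in> alphabet E \<Longrightarrow> s a \<^bold>* (s a)\<^sup>\<dagger> \<^bold>* s a = s a"
  and p_empty: "p {} = \<^bold>0"
  and p_mul: "A \<in> \<B> \<Longrightarrow> B \<in> \<B> \<Longrightarrow> p A \<^bold>* p B = p (A \<inter> B)"
  and p_Un: "A \<in> \<B> \<Longrightarrow> B \<in> \<B> \<Longrightarrow> p (A \<union> B) = p A \<^bold>+ p B \<^bold>- p (A \<inter> B)"
  and p_s: "A \<in> \<B> \<Longrightarrow> a \<in> alphabet E \<Longrightarrow> p A \<^bold>* s a = s a \<^bold>* p (rel_range E A [a])"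
  and s_adj_s: "a \<in> alphabet E \<Longrightarrow> (s a)\<^sup>\<dagger> \<^bold>* s a = p (path_range E [a])"
  and s_adj_s_neq: "a \<in> alphabet E \<Longrightarrow> b \<in> alphabet E \<Longrightarrow> a \<noteq> b \<Longrightarrow> (s a)\<^sup>\<dagger> \<^bold>* s b = \<^bold>0"
  using rep by (auto simp: labelled_space_rep_def is_projection_def is_partial_isometry_def)

text \<open>Set-finiteness and the absence of sinks make the relation available for every nonempty
  A; for A = {} both sides are 0.\<close>

lemma p_sum:
  assumes "A \<in> \<B>"
  shows "p A = finprod (additive C) (\<lambda>a. s a \<^bold>* p (rel_range E A [a]) \<^bold>* (s a)\<^sup>\<dagger>) (emitted_labels E A)"
proof (cases "A = {}")
  case True
  have "emitted_labels E {} = {}"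
    by (simp add: emitted_labels_def)
  with True show ?thesis
    by (simp add: p_empty)
next
  case False
  have "\<forall>A\<in>\<B>. finite (emitted_labels E A) \<and> emitted_labels E A \<noteq> {} \<longrightarrow>
      p A = finprod (additive C) (\<lambda>a. s a \<^bold>* p (rel_range E A [a]) \<^bold>* (s a)\<^sup>\<dagger>) (emitted_labels E A)"
    using rep unfolding labelled_space_rep_def by (elim conjE)
  with assms False show ?thesis
    by (simp add: finite_emitted emitted_nonempty)
qed

lemma s_range [simp]: "a \<in> alphabet E \<Longrightarrow> s a \<^bold>* p (path_range E [a]) = s a"
  using s_iso [of a] by (simp add: mul_assoc flip: s_adj_s)

lemma range_s_adj [simp]:
  assumes "a \<in> alphabet E"
  shows "p (path_range E [a]) \<^bold>* (s a)\<^sup>\<dagger> = (s a)\<^sup>\<dagger>"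
proof -
  have "(s a \<^bold>* p (path_range E [a]))\<^sup>\<dagger> = p (path_range E [a]) \<^bold>* (s a)\<^sup>\<dagger>"
    using assms by (subst adj_mul) (auto simp: range_single_in p_adj simp del: s_range)
  with assms show ?thesis by simp
qed

lemma s_adj_p:
  assumes "A \<in> \<B>" "a \<in> alphabet E"
  shows "(s a)\<^sup>\<dagger> \<^bold>* p A = p (rel_range E A [a]) \<^bold>* (s a)\<^sup>\<dagger>"
proof -
  have "(p A \<^bold>* s a)\<^sup>\<dagger> = (s a \<^bold>* p (rel_range E A [a]))\<^sup>\<dagger>"
    using assms p_s by simp
  with assms show ?thesis
    by (simp add: adj_mul p_adj rel_range_single_in)
qed

definition conj_sum :: "'a set \<Rightarrow> ('a \<Rightarrow> 'x) \<Rightarrow> 'x" where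
  "conj_sum F f = finprod (additive C) (\<lambda>a. s a \<^bold>* f a \<^bold>* (s a)\<^sup>\<dagger>) F"

text \<open>Only commutation with the \<open>p B\<close> is meant, not with the \<open>s a\<close>.
  It is what lets e pass s_a\<dagger>s_a = p_{r(a)}.\<close>

definition central :: "'x \<Rightarrow> bool" where
  "central e \<longleftrightarrow> e \<in> carrier C \<and> (\<forall>B\<in>\<B>. p B \<^bold>* e = e \<^bold>* p B)"

lemma central_closed: "central e \<Longrightarrow> e \<in> carrier C"
  by (simp add: central_def)

lemma conj_closed: "a \<in> alphabet E \<Longrightarrow> e \<in> carrier C \<Longrightarrow> s a \<^bold>* e \<^bold>* (s a)\<^sup>\<dagger> \<in> carrier C"
  by auto

lemma conj_sum_closed:
  "F \<subseteq> alphabet E \<Longrightarrow> (\<And>a. a \<in> F \<Longrightarrow> f a \<in> carrier C) \<Longrightarrow> conj_sum F f \<in> carrier C"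
  unfolding conj_sum_def by (intro add.finprod_closed) auto

lemma conj_sum_cong: "(\<And>a. a \<in> F \<Longrightarrow> f a = g a) \<Longrightarrow> F \<subseteq> alphabet E \<Longrightarrow>
    (\<And>a. a \<in> F \<Longrightarrow> g a \<in> carrier C) \<Longrightarrow> conj_sum F f = conj_sum F g"
  unfolding conj_sum_def by (intro add.finprod_cong) (auto simp: simp_implies_def)

text \<open>For equal letters the inner s_a\<dagger>s_a = p_{r(a)} commutes with e and is absorbed
  by s_a; for different letters s_a\<dagger>s_b = 0.\<close>

lemma conj_mul_conj:
  assumes "a \<in> alphabet E" "b \<in> alphabet E" "central e" "g \<in> carrier C"
  shows "(s a \<^bold>* e \<^bold>* (s a)\<^sup>\<dagger>) \<^bold>* (s b \<^bold>* g \<^bold>* (s b)\<^sup>\<dagger>) =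
    (if a = b then s a \<^bold>* (e \<^bold>* g) \<^bold>* (s a)\<^sup>\<dagger> else \<^bold>0)"
proof -
  have e: "e \<in> carrier C"
    using assms central_closed by simp
  have "(s a \<^bold>* e \<^bold>* (s a)\<^sup>\<dagger>) \<^bold>* (s b \<^bold>* g \<^bold>* (s b)\<^sup>\<dagger>) =
      s a \<^bold>* (e \<^bold>* (((s a)\<^sup>\<dagger> \<^bold>* s b) \<^bold>* (g \<^bold>* (s b)\<^sup>\<dagger>)))"
    using assms e by (simp add: mul_assoc)
  also have "\<dots> = (if a = b then s a \<^bold>* (e \<^bold>* g) \<^bold>* (s a)\<^sup>\<dagger> else \<^bold>0)"
  proof (cases "a = b")
    case True
    let ?P = "p (path_range E [a])"
    have P: "?P \<in> carrier C"
      using assms range_single_in by auto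
    have "e \<^bold>* (?P \<^bold>* (g \<^bold>* (s a)\<^sup>\<dagger>)) = (?P \<^bold>* e) \<^bold>* (g \<^bold>* (s a)\<^sup>\<dagger>)"
      using assms e P by (simp add: central_def range_single_in flip: mul_assoc)
    then have "s a \<^bold>* (e \<^bold>* (?P \<^bold>* (g \<^bold>* (s a)\<^sup>\<dagger>))) = (s a \<^bold>* ?P) \<^bold>* (e \<^bold>* (g \<^bold>* (s a)\<^sup>\<dagger>))"
      using assms e P by (simp add: mul_assoc del: s_range)
    then show ?thesis
      using assms e True s_adj_s [of a] by (simp add: mul_assoc)
  next
    case False
    then show ?thesis
      using assms e by (simp add: s_adj_s_neq)
  qed
  finally show ?thesis .
qed

text \<open>The index sets may differ because in \<open>level_directed\<close> one sum over a union
  has to absorb two sums over its parts.\<close>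

lemma conj_sum_mul:
  assumes "finite F'" "F \<subseteq> F'" "F' \<subseteq> alphabet E"
    and f: "\<And>a. a \<in> F \<Longrightarrow> central (f a)" and g: "\<And>a. a \<in> F' \<Longrightarrow> g a \<in> carrier C"
  shows "conj_sum F f \<^bold>* conj_sum F' g = conj_sum F (\<lambda>a. f a \<^bold>* g a)"
proof -
  have fc: "f a \<in> carrier C" if "a \<in> F" for a
    using f [OF that] by (rule central_closed)
  have F: "finite F" "F \<subseteq> alphabet E"
    using assms finite_subset by auto
  have "conj_sum F f \<^bold>* conj_sum F' g =
      finprod (additive C) (\<lambda>a. (s a \<^bold>* f a \<^bold>* (s a)\<^sup>\<dagger>) \<^bold>* conj_sum F' g) F"
    unfolding conj_sum_def [of F]
    using F fc assms by (intro finprod_mul conj_sum_closed) auto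
  also have "\<dots> = finprod (additive C) (\<lambda>a. s a \<^bold>* (f a \<^bold>* g a) \<^bold>* (s a)\<^sup>\<dagger>) F"
  proof (rule add.finprod_cong')
    have "(s a \<^bold>* f a \<^bold>* (s a)\<^sup>\<dagger>) \<^bold>* conj_sum F' g = s a \<^bold>* (f a \<^bold>* g a) \<^bold>* (s a)\<^sup>\<dagger>" if a: "a \<in> F" for a
    proof -
      have aF': "a \<in> F'" "a \<in> alphabet E"
        using a assms by auto
      have "(s a \<^bold>* f a \<^bold>* (s a)\<^sup>\<dagger>) \<^bold>* conj_sum F' g =
          finprod (additive C) (\<lambda>b. (s a \<^bold>* f a \<^bold>* (s a)\<^sup>\<dagger>) \<^bold>* (s b \<^bold>* g b \<^bold>* (s b)\<^sup>\<dagger>)) F'"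
        unfolding conj_sum_def
        using fc [OF a] aF' assms g by (intro mul_finprod conj_closed) auto
      also have "\<dots> = (s a \<^bold>* f a \<^bold>* (s a)\<^sup>\<dagger>) \<^bold>* (s a \<^bold>* g a \<^bold>* (s a)\<^sup>\<dagger>)"
      proof (rule finprod_single [OF assms(1) aF'(1)])
        show "(s a \<^bold>* f a \<^bold>* (s a)\<^sup>\<dagger>) \<^bold>* (s a \<^bold>* g a \<^bold>* (s a)\<^sup>\<dagger>) \<in> carrier C"
          using fc [OF a] aF' g by (intro mul_closed conj_closed) auto
        fix b assume b: "b \<in> F'" "b \<noteq> a"
        then show "(s a \<^bold>* f a \<^bold>* (s a)\<^sup>\<dagger>) \<^bold>* (s b \<^bold>* g b \<^bold>* (s b)\<^sup>\<dagger>) = \<^bold>0"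
          using conj_mul_conj [OF aF'(2) _ f [OF a] g [OF b(1)], of b] assms(3) by auto
      qed
      also have "\<dots> = s a \<^bold>* (f a \<^bold>* g a) \<^bold>* (s a)\<^sup>\<dagger>"
        using conj_mul_conj [OF aF'(2) aF'(2) f [OF a] g [OF aF'(1)]] by simp
      finally show ?thesis .
    qed
    note eq = this
    show "\<And>i. i \<in> F \<Longrightarrow> (s i \<^bold>* f i \<^bold>* (s i)\<^sup>\<dagger>) \<^bold>* conj_sum F' g = s i \<^bold>* (f i \<^bold>* g i) \<^bold>* (s i)\<^sup>\<dagger>"
      by (rule eq)
    show "(\<lambda>a. s a \<^bold>* (f a \<^bold>* g a) \<^bold>* (s a)\<^sup>\<dagger>) \<in> F \<rightarrow> carrier C"
      using fc F assms by (auto intro!: conj_closed mul_closed g)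
  qed simp
  finally show ?thesis
    by (simp add: conj_sum_def)
qed

lemma conj_sum_adj:
  assumes "finite F" "F \<subseteq> alphabet E" and f: "\<And>a. a \<in> F \<Longrightarrow> f a \<in> carrier C \<and> (f a)\<^sup>\<dagger> = f a"
  shows "(conj_sum F f)\<^sup>\<dagger> = conj_sum F f"
proof -
  have "(conj_sum F f)\<^sup>\<dagger> = finprod (additive C) (\<lambda>a. (s a \<^bold>* f a \<^bold>* (s a)\<^sup>\<dagger>)\<^sup>\<dagger>) F"
    unfolding conj_sum_def using assms by (intro adj_finprod) auto
  also have "\<dots> = finprod (additive C) (\<lambda>a. s a \<^bold>* f a \<^bold>* (s a)\<^sup>\<dagger>) F"
  proof (rule add.finprod_cong')
    have "(s a \<^bold>* f a \<^bold>* (s a)\<^sup>\<dagger>)\<^sup>\<dagger> = s a \<^bold>* f a \<^bold>* (s a)\<^sup>\<dagger>" if "a \<in> F" for a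
      using f [OF that] subsetD [OF assms(2) that] by (simp add: adj_mul mul_assoc)
    note eq = this
    show "\<And>i. i \<in> F \<Longrightarrow> (s i \<^bold>* f i \<^bold>* (s i)\<^sup>\<dagger>)\<^sup>\<dagger> = s i \<^bold>* f i \<^bold>* (s i)\<^sup>\<dagger>"
      by (rule eq)
    show "(\<lambda>a. s a \<^bold>* f a \<^bold>* (s a)\<^sup>\<dagger>) \<in> F \<rightarrow> carrier C"
      using assms by (auto intro!: conj_closed)
  qed simp
  finally show ?thesis
    by (simp add: conj_sum_def)
qed

text \<open>p_B enters through s_a as p_{r(B,a)}, passes f_a, and leaves through s_a\<dagger> as p_B
  again.\<close>

lemma central_conj_sum:
  assumes "finite F" "F \<subseteq> alphabet E" and f: "\<And>a. a \<in> F \<Longrightarrow> central (f a)"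
  shows "central (conj_sum F f)"
  unfolding central_def
proof (intro conjI ballI)
  have fc: "f a \<in> carrier C" if "a \<in> F" for a
    using f [OF that] by (rule central_closed)
  show "conj_sum F f \<in> carrier C"
    using assms fc by (intro conj_sum_closed)
  fix B assume B: "B \<in> \<B>"
  have "p B \<^bold>* conj_sum F f = finprod (additive C) (\<lambda>a. p B \<^bold>* (s a \<^bold>* f a \<^bold>* (s a)\<^sup>\<dagger>)) F"
    unfolding conj_sum_def using assms B fc by (intro mul_finprod conj_closed) auto
  also have "\<dots> = finprod (additive C) (\<lambda>a. (s a \<^bold>* f a \<^bold>* (s a)\<^sup>\<dagger>) \<^bold>* p B) F"
  proof (rule add.finprod_cong')
    have "p B \<^bold>* (s a \<^bold>* f a \<^bold>* (s a)\<^sup>\<dagger>) = (s a \<^bold>* f a \<^bold>* (s a)\<^sup>\<dagger>) \<^bold>* p B" if a: "a \<in> F" for a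
    proof -
      let ?r = "rel_range E B [a]"
      have c: "a \<in> alphabet E" "f a \<in> carrier C" "?r \<in> \<B>"
        using a assms(2) fc rel_range_single_in [OF B] by auto
      have "p B \<^bold>* (s a \<^bold>* f a \<^bold>* (s a)\<^sup>\<dagger>) = (p B \<^bold>* s a) \<^bold>* (f a \<^bold>* (s a)\<^sup>\<dagger>)"
        using B c by (simp add: mul_assoc)
      also have "\<dots> = s a \<^bold>* ((p ?r \<^bold>* f a) \<^bold>* (s a)\<^sup>\<dagger>)"
        using B c by (simp add: p_s mul_assoc)
      also have "p ?r \<^bold>* f a = f a \<^bold>* p ?r"
        using f [OF a] c by (simp add: central_def)
      also have "s a \<^bold>* ((f a \<^bold>* p ?r) \<^bold>* (s a)\<^sup>\<dagger>) = s a \<^bold>* (f a \<^bold>* ((s a)\<^sup>\<dagger> \<^bold>* p B))"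
        using B c by (simp add: s_adj_p mul_assoc)
      also have "\<dots> = (s a \<^bold>* f a \<^bold>* (s a)\<^sup>\<dagger>) \<^bold>* p B"
        using B c by (simp add: mul_assoc)
      finally show ?thesis .
    qed
    note eq = this
    show "\<And>i. i \<in> F \<Longrightarrow> p B \<^bold>* (s i \<^bold>* f i \<^bold>* (s i)\<^sup>\<dagger>) = (s i \<^bold>* f i \<^bold>* (s i)\<^sup>\<dagger>) \<^bold>* p B"
      by (rule eq)
    show "(\<lambda>a. (s a \<^bold>* f a \<^bold>* (s a)\<^sup>\<dagger>) \<^bold>* p B) \<in> F \<rightarrow> carrier C"
      using assms B fc by (auto intro!: conj_closed mul_closed)
  qed simp
  also have "\<dots> = conj_sum F f \<^bold>* p B"
    unfolding conj_sum_def using assms B fc by (intro finprod_mul [symmetric] conj_closed) auto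
  finally show "p B \<^bold>* conj_sum F f = conj_sum F f \<^bold>* p B" .
qed

text \<open>
  The sums of \<open>s\<^sub>\<alpha> p\<^sub>A s\<^sub>\<alpha>\<^sup>\<dagger>\<close> over finitely many words \<open>\<alpha>\<close> of length \<open>n\<close>, with \<open>A \<sim> {}\<close>
  depending on \<open>\<alpha>\<close>. Their union over \<open>n\<close> is an approximate unit of projections of the ideal.
\<close>
primrec level :: "nat \<Rightarrow> 'x set" where
  "level 0 = {p A | A. A \<in> \<B> \<and> null A}"
| "level (Suc n) = {conj_sum F f | F f. finite F \<and> F \<subseteq> alphabet E \<and> (\<forall>a\<in>F. f a \<in> level n)}"

lemma level_0I: "A \<in> \<B> \<Longrightarrow> null A \<Longrightarrow> p A \<in> level 0"
  by auto

lemma level_central: "e \<in> level n \<Longrightarrow> central e"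
proof (induction n arbitrary: e)
  case 0
  then show ?case
    by (auto simp: central_def p_mul Int_commute)
next
  case (Suc n)
  then obtain F f where "e = conj_sum F f" "finite F" "F \<subseteq> alphabet E" "\<forall>a\<in>F. f a \<in> level n"
    by auto
  with Suc.IH show ?case
    by (simp add: central_conj_sum)
qed

lemma level_closed: "e \<in> level n \<Longrightarrow> e \<in> carrier C"
  using level_central central_closed by blast

lemma level_projection: "e \<in> level n \<Longrightarrow> is_projection C e"
proof (induction n arbitrary: e)
  case 0
  then show ?case
    by (auto simp: is_projection_def p_mul p_adj)
next
  case (Suc n)
  then obtain F f where e: "e = conj_sum F f" "finite F" "F \<subseteq> alphabet E" "\<And>a. a \<in> F \<Longrightarrow> f a \<in> level n"
    by auto
  have f: "f a \<in> carrier C" "f a \<^bold>* f a = f a" "(f a)\<^sup>\<dagger> = f a" if "a \<in> F" for a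
    using Suc.IH [OF e(4) [OF that]] by (auto simp: is_projection_def)
  have "e \<^bold>* e = conj_sum F (\<lambda>a. f a \<^bold>* f a)"
    unfolding e(1) by (rule conj_sum_mul) (use e f level_central [OF e(4)] in auto)
  also have "\<dots> = e"
    unfolding e(1) by (rule conj_sum_cong) (use e f in auto)
  finally have "e \<^bold>* e = e" .
  moreover have "e\<^sup>\<dagger> = e"
    unfolding e(1) by (rule conj_sum_adj) (use e f in auto)
  ultimately show ?case
    using level_closed [OF Suc.prems] by (simp add: is_projection_def)
qed

lemma level_zero: "\<^bold>0 \<in> level n"
proof (cases n)
  case 0
  then show ?thesis
    using level_0I [OF empty_in] by (simp add: p_empty)
next
  case (Suc m)
  have "\<^bold>0 = conj_sum {} (\<lambda>_. \<^bold>0)"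
    by (simp add: conj_sum_def)
  then show ?thesis
    unfolding Suc level.simps by blast
qed

text \<open>At level 0 the summation relation writes p_A as a sum of conjugates of the p_{r(A,a)},
  and r(A,a) is null along with A.\<close>

lemma level_Suc: "e \<in> level n \<Longrightarrow> e \<in> level (Suc n)"
proof (induction n arbitrary: e)
  case 0
  then obtain A where A: "e = p A" "A \<in> \<B>" "null A"
    by auto
  have "e = conj_sum (emitted_labels E A) (\<lambda>a. p (rel_range E A [a]))"
    unfolding A(1) conj_sum_def by (rule p_sum [OF A(2)])
  moreover have "p (rel_range E A [a]) \<in> level 0" if "a \<in> emitted_labels E A" for a
    using that A emitted_subset [of A] by (intro level_0I rel_range_single_in null_rel_range) auto
  ultimately show ?case
    unfolding level.simps(2) using finite_emitted [OF A(2)] emitted_subset [of A] by blast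
next
  case (Suc n)
  then obtain F f where "e = conj_sum F f" "finite F" "F \<subseteq> alphabet E" "\<forall>a\<in>F. f a \<in> level (Suc n)"
    unfolding level.simps(2) [of n] by blast
  then show ?case
    unfolding level.simps(2) [of "Suc n"] by blast
qed

lemma level_mono: "m \<le> n \<Longrightarrow> e \<in> level m \<Longrightarrow> e \<in> level n"
  by (induction n rule: dec_induct) (simp_all only: level_Suc)

text \<open>Upper bounds are found letter by letter, starting from the union of two null
  sets.\<close>

lemma level_directed: "e \<in> level n \<Longrightarrow> f \<in> level n \<Longrightarrow> \<exists>g\<in>level n. e \<^bold>* g = e \<and> f \<^bold>* g = f"
proof (induction n arbitrary: e f)
  case 0
  then obtain A B where A: "e = p A" "A \<in> \<B>" "null A" and B: "f = p B" "B \<in> \<B>" "null B"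
    by auto
  have "p (A \<union> B) \<in> level 0"
    using A B by (intro level_0I union_in null_Un)
  moreover have "e \<^bold>* p (A \<union> B) = e" "f \<^bold>* p (A \<union> B) = f"
    using A B union_in by (simp_all add: p_mul Int_absorb2)
  ultimately show ?case by blast
next
  case (Suc n)
  obtain F u where e: "e = conj_sum F u" "finite F" "F \<subseteq> alphabet E" "\<And>a. a \<in> F \<Longrightarrow> u a \<in> level n"
    using Suc.prems(1) by auto
  obtain H v where f: "f = conj_sum H v" "finite H" "H \<subseteq> alphabet E" "\<And>a. a \<in> H \<Longrightarrow> v a \<in> level n"
    using Suc.prems(2) by auto
  have "\<exists>g. g \<in> level n \<and> (a \<in> F \<longrightarrow> u a \<^bold>* g = u a) \<and> (a \<in> H \<longrightarrow> v a \<^bold>* g = v a)" for a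
  proof -
    \<comment> \<open>Padding with 0, which belongs to every level, lets the induction hypothesis
      apply to letters in only one of F and H.\<close>
    have "(if a \<in> F then u a else \<^bold>0) \<in> level n" "(if a \<in> H then v a else \<^bold>0) \<in> level n"
      using e(4) f(4) level_zero by simp_all
    from Suc.IH [OF this] show ?thesis
      by (auto split: if_splits)
  qed
  then obtain g where g: "\<And>a. g a \<in> level n" "\<And>a. a \<in> F \<Longrightarrow> u a \<^bold>* g a = u a"
      "\<And>a. a \<in> H \<Longrightarrow> v a \<^bold>* g a = v a"
    by metis
  have FH: "finite (F \<union> H)" "F \<union> H \<subseteq> alphabet E"
    using e f by auto
  have gc: "g a \<in> carrier C" for a
    using level_closed [OF g(1)] .
  have "e \<^bold>* conj_sum (F \<union> H) g = conj_sum F (\<lambda>a. u a \<^bold>* g a)"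
    unfolding e(1) using FH by (rule conj_sum_mul [OF _ Un_upper1]) (use level_central [OF e(4)] gc in auto)
  also have "\<dots> = e"
    unfolding e(1) using e g level_closed [OF e(4)] by (intro conj_sum_cong) auto
  finally have eg: "e \<^bold>* conj_sum (F \<union> H) g = e" .
  have "f \<^bold>* conj_sum (F \<union> H) g = conj_sum H (\<lambda>a. v a \<^bold>* g a)"
    unfolding f(1) using FH by (rule conj_sum_mul [OF _ Un_upper2]) (use level_central [OF f(4)] gc in auto)
  also have "\<dots> = f"
    unfolding f(1) using f g level_closed [OF f(4)] by (intro conj_sum_cong) auto
  finally have fg: "f \<^bold>* conj_sum (F \<union> H) g = f" .
  have "conj_sum (F \<union> H) g \<in> level (Suc n)"
    unfolding level.simps(2) using FH g(1) by blast
  with eg fg show ?case by blast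
qed

definition "units = (\<Union>n. level n)"

lemma units_projection: "e \<in> units \<Longrightarrow> is_projection C e"
  and units_closed: "e \<in> units \<Longrightarrow> e \<in> carrier C"
  using level_projection level_closed by (auto simp: units_def)

lemma units_directed:
  assumes "e \<in> units" "f \<in> units"
  shows "\<exists>g\<in>units. e \<^bold>* g = e \<and> f \<^bold>* g = f"
proof -
  obtain m n where "e \<in> level m" "f \<in> level n"
    using assms by (auto simp: units_def)
  then have "e \<in> level (max m n)" "f \<in> level (max m n)"
    using level_mono [of m "max m n"] level_mono [of n "max m n"] by simp_all
  then show ?thesis
    using level_directed unfolding units_def by blast
qed

text \<open>Right multiplication has to be controlled for the adjoints of the \<open>s a\<close> as
  well, and \<open>approximated\<close> is not known to be closed under adjoints at that stage, so
  they count as generators of their own.\<close>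

definition generators :: "'x set" where
  "generators = s ` alphabet E \<union> (\<lambda>a. (s a)\<^sup>\<dagger>) ` alphabet E \<union> p ` \<B>"

text \<open>The algebraic core of closure under right multiplication: after a generator, some other
  unit absorbs what is left. For s_c that unit is the coefficient of c in e, for s_c\<dagger> it is
  s_c e s_c\<dagger>, for p_B it is e itself.\<close>

lemma units_generator:
  assumes "e \<in> units" "b \<in> generators"
  shows "\<exists>f\<in>units. e \<^bold>* b \<^bold>* f = e \<^bold>* b"
proof -
  obtain n where n: "e \<in> level n"
    using assms(1) by (auto simp: units_def)
  then have ec: "e \<in> carrier C" "e \<^bold>* e = e" and cen: "central e"
    using level_projection level_central by (auto simp: is_projection_def)
  consider (s) c where "c \<in> alphabet E" "b = s c" | (adj) c where "c \<in> alphabet E" "b = (s c)\<^sup>\<dagger>"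
    | (p) B where "B \<in> \<B>" "b = p B"
    using assms(2) by (auto simp: generators_def)
  then show ?thesis
  proof cases
    case s
    \<comment> \<open>One level up, e is a sum of conjugates for every n, the case n = 0
      included.\<close>
    have "e \<in> level (Suc n)"
      using n by (rule level_Suc)
    then obtain F f where F: "e = conj_sum F f" "finite F" "F \<subseteq> alphabet E" "\<And>a. a \<in> F \<Longrightarrow> f a \<in> level n"
      by auto
    \<comment> \<open>The default 0 covers c outside F, where e s_c = 0.\<close>
    define g where "g = (if c \<in> F then f c else \<^bold>0)"
    have g: "g \<in> level n"
      using F level_zero by (simp add: g_def)
    have gc: "g \<in> carrier C" "g \<^bold>* g = g" "central g"
      using g level_projection level_central by (auto simp: is_projection_def)
    let ?P = "p (path_range E [c])"
    have P: "?P \<in> carrier C" "?P \<^bold>* g = g \<^bold>* ?P"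
      using gc(3) s(1) range_single_in by (auto simp: central_def)
    have "e \<^bold>* s c = finprod (additive C) (\<lambda>a. (s a \<^bold>* f a \<^bold>* (s a)\<^sup>\<dagger>) \<^bold>* s c) F"
      unfolding F(1) conj_sum_def using F level_closed s(1) by (intro finprod_mul conj_closed) auto
    also have "\<dots> = s c \<^bold>* (g \<^bold>* ?P)"
    proof -
      have mv: "(s a \<^bold>* f a \<^bold>* (s a)\<^sup>\<dagger>) \<^bold>* s c = s a \<^bold>* (f a \<^bold>* ((s a)\<^sup>\<dagger> \<^bold>* s c))" if "a \<in> F" for a
        using that F(3) level_closed [OF F(4) [OF that]] s(1) by (auto simp: mul_assoc)
      have zero: "(s a \<^bold>* f a \<^bold>* (s a)\<^sup>\<dagger>) \<^bold>* s c = \<^bold>0" if "a \<in> F" "a \<noteq> c" for a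
      proof -
        have "a \<in> alphabet E" "f a \<in> carrier C"
          using that F level_closed by auto
        then show ?thesis
          using that s(1) s_adj_s_neq [of a c] unfolding mv [OF that(1)] by simp
      qed
      show ?thesis
      proof (cases "c \<in> F")
        case True
        have *: "(s c \<^bold>* f c \<^bold>* (s c)\<^sup>\<dagger>) \<^bold>* s c = s c \<^bold>* (g \<^bold>* ?P)"
          using True s(1) by (simp add: mv s_adj_s g_def)
        have "finprod (additive C) (\<lambda>a. (s a \<^bold>* f a \<^bold>* (s a)\<^sup>\<dagger>) \<^bold>* s c) F = (s c \<^bold>* f c \<^bold>* (s c)\<^sup>\<dagger>) \<^bold>* s c"
          by (rule finprod_single [OF F(2) True]) (use zero * gc P s(1) in auto)
        with * show ?thesis by simp
      next
        case False
        have "finprod (additive C) (\<lambda>a. (s a \<^bold>* f a \<^bold>* (s a)\<^sup>\<dagger>) \<^bold>* s c) F = \<^bold>0"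
          by (rule finprod_zero) (use zero False in auto)
        with False P s(1) show ?thesis
          by (simp add: g_def)
      qed
    qed
    finally have es: "e \<^bold>* s c = s c \<^bold>* (g \<^bold>* ?P)" .
    have "g \<^bold>* ?P \<^bold>* g = g \<^bold>* ?P"
    proof -
      have "g \<^bold>* ?P \<^bold>* g = g \<^bold>* (?P \<^bold>* g)"
        using gc P by (simp add: mul_assoc)
      also have "\<dots> = (g \<^bold>* g) \<^bold>* ?P"
        unfolding P(2) using gc(1) P(1) by (simp add: mul_assoc)
      finally show ?thesis
        by (simp only: gc(2))
    qed
    then have "e \<^bold>* b \<^bold>* g = e \<^bold>* b"
      unfolding s(2) es using s(1) gc(1) P(1) by (simp add: mul_assoc)
    with g show ?thesis
      unfolding units_def by blast
  next
    case adj
    let ?P = "p (path_range E [c])"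
    have P: "?P \<in> carrier C" "?P \<^bold>* e = e \<^bold>* ?P"
      using cen adj(1) range_single_in by (auto simp: central_def)
    have level: "conj_sum {c} (\<lambda>_. e) \<in> level (Suc n)"
      unfolding level.simps(2) using n adj(1) by blast
    have eq: "conj_sum {c} (\<lambda>_. e) = s c \<^bold>* e \<^bold>* (s c)\<^sup>\<dagger>"
      unfolding conj_sum_def by (rule finprod_single) (use adj(1) ec in auto)
    have "s c \<^bold>* e \<^bold>* (s c)\<^sup>\<dagger> \<in> units"
      using level unfolding eq units_def by blast
    moreover have "e \<^bold>* b \<^bold>* (s c \<^bold>* e \<^bold>* (s c)\<^sup>\<dagger>) = e \<^bold>* b"
    proof -
      have "e \<^bold>* b \<^bold>* (s c \<^bold>* e \<^bold>* (s c)\<^sup>\<dagger>) = e \<^bold>* (((s c)\<^sup>\<dagger> \<^bold>* s c) \<^bold>* (e \<^bold>* (s c)\<^sup>\<dagger>))"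
        unfolding adj(2) using adj(1) ec(1) by (simp add: mul_assoc)
      also have "\<dots> = e \<^bold>* ((?P \<^bold>* e) \<^bold>* (s c)\<^sup>\<dagger>)"
        using adj(1) ec(1) P(1) by (simp add: s_adj_s mul_assoc)
      also have "\<dots> = (e \<^bold>* e) \<^bold>* (?P \<^bold>* (s c)\<^sup>\<dagger>)"
        unfolding P(2) using adj(1) ec(1) P(1) by (simp add: mul_assoc del: range_s_adj)
      also have "\<dots> = e \<^bold>* b"
        using adj ec by simp
      finally show ?thesis .
    qed
    ultimately show ?thesis
      by blast
  next
    case p
    have "e \<^bold>* p B \<^bold>* e = e \<^bold>* (p B \<^bold>* e)"
      using ec(1) p(1) by (simp add: mul_assoc)
    also have "\<dots> = (e \<^bold>* e) \<^bold>* p B"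
      using cen ec(1) p(1) by (simp add: central_def mul_assoc)
    finally have "e \<^bold>* b \<^bold>* e = e \<^bold>* b"
      using ec p by simp
    with assms(1) show ?thesis by blast
  qed
qed

end

section \<open>Generated closed ideals\<close>

context pre_cstar_algebra
begin

lemma closedin_carrier: "closedin (norm_topology C) (carrier C)"
  by (simp add: closedin_norm_topology_iff)

lemma closed_ideal_generated_ideal:
  assumes "S \<subseteq> carrier C"
  shows "closed_ideal (generated_ideal C S) C"
proof -
  have "closed_ideal (carrier C) C"
    by (auto simp: closed_ideal_def linear_subspace_def closedin_carrier)
  then have ne: "{J. closed_ideal J C \<and> S \<subseteq> J} \<noteq> {}"
    using assms by blast
  have sub: "generated_ideal C S \<subseteq> carrier C"
    unfolding generated_ideal_def using assms \<open>closed_ideal (carrier C) C\<close> by (intro Inter_lower) auto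
  have "closedin (norm_topology C) (generated_ideal C S)"
    unfolding generated_ideal_def using ne by (intro closedin_Inter) (auto simp: closed_ideal_def)
  moreover have I: "x \<in> generated_ideal C S" if "\<And>J. closed_ideal J C \<Longrightarrow> S \<subseteq> J \<Longrightarrow> x \<in> J" for x
    using that by (simp add: generated_ideal_def)
  moreover have D: "x \<in> J" if "x \<in> generated_ideal C S" "closed_ideal J C" "S \<subseteq> J" for x J
    using that by (simp add: generated_ideal_def)
  have "\<^bold>0 \<in> generated_ideal C S"
    by (rule I) (simp add: closed_ideal_def linear_subspace_def)
  moreover have "x \<^bold>+ y \<in> generated_ideal C S" "c \<^bold>\<cdot> x \<in> generated_ideal C S"
    if "x \<in> generated_ideal C S" "y \<in> generated_ideal C S" for x y c
    by (rule I; use D [OF that(1)] D [OF that(2)] in \<open>simp add: closed_ideal_def linear_subspace_def\<close>)+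
  moreover have "x \<^bold>* j \<in> generated_ideal C S" "j \<^bold>* x \<in> generated_ideal C S"
    if "x \<in> carrier C" "j \<in> generated_ideal C S" for x j
    by (rule I; use D [OF that(2)] that(1) in \<open>simp add: closed_ideal_def\<close>)+
  ultimately show ?thesis
    using sub unfolding closed_ideal_def linear_subspace_def by simp
qed

lemma generated_ideal_least: "closed_ideal J C \<Longrightarrow> S \<subseteq> J \<Longrightarrow> generated_ideal C S \<subseteq> J"
  unfolding generated_ideal_def by (intro Inter_lower) auto

lemma generated_ideal_superset: "S \<subseteq> generated_ideal C S"
  unfolding generated_ideal_def by auto

end

section \<open>The ideal of elements approximated by the units\<close>

context labelled_cstar
begin

text \<open>It turns out to be a closed two-sided ideal; minimality of the null ideal then extends
  the approximation from the p_A of null sets to all its elements.\<close>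

definition "approximated = {x \<in> carrier C. \<forall>d>0. \<exists>e\<in>units. cnorm C (x \<^bold>- x \<^bold>* e) < d}"

lemma approximatedD: "x \<in> approximated \<Longrightarrow> d > 0 \<Longrightarrow> \<exists>e\<in>units. cnorm C (x \<^bold>- x \<^bold>* e) < d"
  by (simp add: approximated_def)

lemma approximated_closed: "x \<in> approximated \<Longrightarrow> x \<in> carrier C"
  by (simp add: approximated_def)

text \<open>A unit that is good for v is good for a nearby x, since y -> y(1 - e) is
  contractive.\<close>

lemma approximated_closedin: "closedin (norm_topology C) approximated"
  unfolding closedin_norm_topology_iff
proof (intro conjI ballI impI)
  show "approximated \<subseteq> carrier C"
    by (auto simp: approximated_def)
  fix x assume x: "x \<in> carrier C" and *: "\<forall>d>0. \<exists>v\<in>approximated. cnorm C (x \<^bold>- v) < d"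
  have "\<exists>e\<in>units. cnorm C (x \<^bold>- x \<^bold>* e) < d" if d: "d > 0" for d
  proof -
    have "d / 2 > 0" using d by simp
    then obtain v where v: "v \<in> approximated" "cnorm C (x \<^bold>- v) < d / 2"
      using * by blast
    obtain e where e: "e \<in> units" "cnorm C (v \<^bold>- v \<^bold>* e) < d / 2"
      using approximatedD [OF v(1) \<open>d / 2 > 0\<close>] by blast
    have c: "v \<in> carrier C" "e \<in> carrier C"
      using v e approximated_closed units_closed by auto
    have "x \<^bold>- x \<^bold>* e = ((x \<^bold>- v) \<^bold>- (x \<^bold>- v) \<^bold>* e) \<^bold>+ (v \<^bold>- v \<^bold>* e)"
      using x c by (simp add: sub_mul sub_sub_swap [of x v "x \<^bold>* e"])
    then have "cnorm C (x \<^bold>- x \<^bold>* e) \<le> cnorm C ((x \<^bold>- v) \<^bold>- (x \<^bold>- v) \<^bold>* e) + cnorm C (v \<^bold>- v \<^bold>* e)"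
      using x c nrm_triangle [of "(x \<^bold>- v) \<^bold>- (x \<^bold>- v) \<^bold>* e" "v \<^bold>- v \<^bold>* e"] by simp
    moreover have "cnorm C ((x \<^bold>- v) \<^bold>- (x \<^bold>- v) \<^bold>* e) \<le> cnorm C (x \<^bold>- v)"
      using x c by (intro nrm_sub_projection_le units_projection e) auto
    ultimately show ?thesis
      using v(2) e by (intro bexI [of _ e]) auto
  qed
  with x show "x \<in> approximated"
    by (simp add: approximated_def)
qed

text \<open>From e g = e follows x - x g = (x - x e)(1 - g): a larger unit does not worsen the
  approximation.\<close>

lemma units_mono_bound:
  assumes "x \<in> carrier C" "e \<in> units" "g \<in> units" "e \<^bold>* g = e"
  shows "cnorm C (x \<^bold>- x \<^bold>* g) \<le> cnorm C (x \<^bold>- x \<^bold>* e)"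
proof -
  have c: "e \<in> carrier C" "g \<in> carrier C"
    using assms units_closed by auto
  have "x \<^bold>- x \<^bold>* g = (x \<^bold>- x \<^bold>* e) \<^bold>- (x \<^bold>- x \<^bold>* e) \<^bold>* g"
    using assms c by (simp add: sub_mul mul_assoc sub_sub_swap [of x "x \<^bold>* e" "x \<^bold>* g"])
  then show ?thesis
    using assms c nrm_sub_projection_le [OF units_projection [OF assms(3)], of "x \<^bold>- x \<^bold>* e"] by simp
qed

lemma approximated_add:
  assumes x: "x \<in> approximated" and y: "y \<in> approximated"
  shows "x \<^bold>+ y \<in> approximated"
proof -
  have "\<exists>g\<in>units. cnorm C (x \<^bold>+ y \<^bold>- (x \<^bold>+ y) \<^bold>* g) < d" if d: "d > 0" for d
  proof -
    have "d / 2 > 0" using d by simp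
    then obtain e f where e: "e \<in> units" "cnorm C (x \<^bold>- x \<^bold>* e) < d / 2"
      and f: "f \<in> units" "cnorm C (y \<^bold>- y \<^bold>* f) < d / 2"
      using approximatedD [OF x, of "d / 2"] approximatedD [OF y, of "d / 2"] by auto
    obtain g where g: "g \<in> units" "e \<^bold>* g = e" "f \<^bold>* g = f"
      using units_directed [OF e(1) f(1)] by blast
    have c: "x \<in> carrier C" "y \<in> carrier C" "g \<in> carrier C"
      using x y g approximated_closed units_closed by auto
    have "x \<^bold>+ y \<^bold>- (x \<^bold>+ y) \<^bold>* g = (x \<^bold>- x \<^bold>* g) \<^bold>+ (y \<^bold>- y \<^bold>* g)"
      using c by (simp add: mul_distrib_right csub_def scale_add_right add_ac)
    then have "cnorm C (x \<^bold>+ y \<^bold>- (x \<^bold>+ y) \<^bold>* g) \<le> cnorm C (x \<^bold>- x \<^bold>* g) + cnorm C (y \<^bold>- y \<^bold>* g)"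
      using c nrm_triangle [of "x \<^bold>- x \<^bold>* g" "y \<^bold>- y \<^bold>* g"] by simp
    moreover have "cnorm C (x \<^bold>- x \<^bold>* g) < d / 2" "cnorm C (y \<^bold>- y \<^bold>* g) < d / 2"
      using units_mono_bound [OF c(1) e(1) g(1,2)] units_mono_bound [OF c(2) f(1) g(1,3)] e f by auto
    ultimately show ?thesis
      using g(1) by (intro bexI [of _ g]) auto
  qed
  then show ?thesis
    using x y by (simp add: approximated_def)
qed

lemma approximated_mul_left:
  assumes x: "x \<in> approximated" and z: "z \<in> carrier C"
  shows "z \<^bold>* x \<in> approximated"
proof -
  have "\<exists>e\<in>units. cnorm C (z \<^bold>* x \<^bold>- z \<^bold>* x \<^bold>* e) < d" if d: "d > 0" for d
  proof -
    \<comment> \<open>The summand 1 keeps the divisor positive when z = 0.\<close>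
    have pos: "cnorm C z + 1 > 0"
      using nrm_nonneg [OF z] by linarith
    then have "d / (cnorm C z + 1) > 0"
      using d by simp
    then have "\<exists>e\<in>units. cnorm C (x \<^bold>- x \<^bold>* e) < d / (cnorm C z + 1)"
      by (rule approximatedD [OF x])
    then obtain e where e: "e \<in> units" "cnorm C (x \<^bold>- x \<^bold>* e) < d / (cnorm C z + 1)"
      by blast
    have c: "x \<in> carrier C" "e \<in> carrier C"
      using x e approximated_closed units_closed by auto
    have "z \<^bold>* x \<^bold>- z \<^bold>* x \<^bold>* e = z \<^bold>* (x \<^bold>- x \<^bold>* e)"
      using z c by (simp add: mul_sub mul_assoc)
    then have "cnorm C (z \<^bold>* x \<^bold>- z \<^bold>* x \<^bold>* e) \<le> cnorm C z * cnorm C (x \<^bold>- x \<^bold>* e)"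
      using nrm_mul [of z "x \<^bold>- x \<^bold>* e"] z c by simp
    also have "\<dots> \<le> (cnorm C z + 1) * cnorm C (x \<^bold>- x \<^bold>* e)"
      using z c by (intro mult_right_mono) auto
    also have "\<dots> < d"
      using e(2) pos by (simp add: pos_less_divide_eq mult.commute)
    finally show ?thesis
      using e(1) by blast
  qed
  then show ?thesis
    using x z approximated_closed [OF x] by (simp add: approximated_def)
qed

lemma approximated_zero: "\<^bold>0 \<in> approximated"
proof -
  have "\<^bold>0 \<in> units"
    using level_zero unfolding units_def by blast
  then show ?thesis
    by (auto simp: approximated_def intro!: bexI [of _ "\<^bold>0"])
qed

lemma approximated_scale:
  assumes x: "x \<in> approximated"
  shows "c \<^bold>\<cdot> x \<in> approximated"
proof -
  have xc: "x \<in> carrier C"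
    using x by (rule approximated_closed)
  have "\<exists>e\<in>units. cnorm C (c \<^bold>\<cdot> x \<^bold>- c \<^bold>\<cdot> x \<^bold>* e) < d" if d: "d > 0" for d
  proof -
    have pos: "cmod c + 1 > 0"
      using norm_ge_zero [of c] by linarith
    then have "d / (cmod c + 1) > 0"
      using d by simp
    then have "\<exists>e\<in>units. cnorm C (x \<^bold>- x \<^bold>* e) < d / (cmod c + 1)"
      by (rule approximatedD [OF x])
    then obtain e where e: "e \<in> units" "cnorm C (x \<^bold>- x \<^bold>* e) < d / (cmod c + 1)"
      by blast
    have ec: "e \<in> carrier C"
      using e units_closed by auto
    have "c \<^bold>\<cdot> x \<^bold>- c \<^bold>\<cdot> x \<^bold>* e = c \<^bold>\<cdot> (x \<^bold>- x \<^bold>* e)"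
      using xc ec by (simp add: scale_sub scale_mul_left)
    then have "cnorm C (c \<^bold>\<cdot> x \<^bold>- c \<^bold>\<cdot> x \<^bold>* e) = cmod c * cnorm C (x \<^bold>- x \<^bold>* e)"
      using xc ec by (simp add: nrm_scale)
    also have "\<dots> \<le> (cmod c + 1) * cnorm C (x \<^bold>- x \<^bold>* e)"
      using xc ec by (intro mult_right_mono) auto
    also have "\<dots> < d"
      using e(2) pos by (simp add: pos_less_divide_eq mult.commute)
    finally show ?thesis
      using e(1) by blast
  qed
  then show ?thesis
    using xc by (simp add: approximated_def)
qed

lemma generators_closed: "b \<in> generators \<Longrightarrow> b \<in> carrier C"
  by (auto simp: generators_def)

text \<open>If f absorbs e b, then x b - x b f = w(1 - f) for w = (x - x e) b, and w is
  small.\<close>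

lemma approximated_mul_generator:
  assumes x: "x \<in> approximated" and b: "b \<in> generators"
  shows "x \<^bold>* b \<in> approximated"
proof -
  have xb: "x \<in> carrier C" "b \<in> carrier C"
    using x b approximated_closed generators_closed by auto
  have "\<exists>f\<in>units. cnorm C (x \<^bold>* b \<^bold>- x \<^bold>* b \<^bold>* f) < d" if d: "d > 0" for d
  proof -
    have pos: "cnorm C b + 1 > 0"
      using nrm_nonneg [OF xb(2)] by linarith
    then have "d / (cnorm C b + 1) > 0"
      using d by simp
    then have "\<exists>e\<in>units. cnorm C (x \<^bold>- x \<^bold>* e) < d / (cnorm C b + 1)"
      by (rule approximatedD [OF x])
    then obtain e where e: "e \<in> units" "cnorm C (x \<^bold>- x \<^bold>* e) < d / (cnorm C b + 1)"
      by blast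
    obtain f where f: "f \<in> units" "e \<^bold>* b \<^bold>* f = e \<^bold>* b"
      using units_generator [OF e(1) b] by blast
    have c: "e \<in> carrier C" "f \<in> carrier C"
      using e f units_closed by auto
    define w where "w = (x \<^bold>- x \<^bold>* e) \<^bold>* b"
    have w: "w \<in> carrier C"
      using xb c by (auto simp: w_def)
    have "w \<^bold>* f = x \<^bold>* b \<^bold>* f \<^bold>- x \<^bold>* (e \<^bold>* b \<^bold>* f)"
      using xb c by (simp add: w_def sub_mul mul_assoc)
    then have "w \<^bold>- w \<^bold>* f = (x \<^bold>* b \<^bold>- x \<^bold>* (e \<^bold>* b)) \<^bold>- (x \<^bold>* b \<^bold>* f \<^bold>- x \<^bold>* (e \<^bold>* b))"
      using xb c f(2) by (simp add: w_def sub_mul mul_assoc)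
    also have "\<dots> = x \<^bold>* b \<^bold>- x \<^bold>* b \<^bold>* f"
      using xb c by (simp add: sub_sub_swap [of "x \<^bold>* b" "x \<^bold>* (e \<^bold>* b)"])
    finally have "cnorm C (x \<^bold>* b \<^bold>- x \<^bold>* b \<^bold>* f) \<le> cnorm C w"
      using nrm_sub_projection_le [OF units_projection [OF f(1)] w] by simp
    also have "\<dots> \<le> cnorm C (x \<^bold>- x \<^bold>* e) * cnorm C b"
      unfolding w_def using xb c by (intro nrm_mul) auto
    also have "\<dots> \<le> cnorm C (x \<^bold>- x \<^bold>* e) * (cnorm C b + 1)"
      using xb c by (intro mult_left_mono) auto
    also have "\<dots> < d"
      using e(2) pos by (simp add: pos_less_divide_eq)
    finally show ?thesis
      using f(1) by blast
  qed
  then show ?thesis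
    using xb by (simp add: approximated_def)
qed

text \<open>The elements by which one may multiply from the right form a C*-subalgebra containing
  the generators. The condition on the adjoint is built into \<open>?V\<close> to make this set
  self-adjoint by construction.\<close>

lemma approximated_mul_right:
  assumes x: "x \<in> approximated" and y: "y \<in> carrier C"
  shows "x \<^bold>* y \<in> approximated"
proof -
  let ?V = "{y \<in> carrier C. \<forall>x\<in>approximated. x \<^bold>* y \<in> approximated \<and> x \<^bold>* y\<^sup>\<dagger> \<in> approximated}"
  have closed: "x \<^bold>* y \<in> approximated"
    if x: "x \<in> approximated" and y: "y \<in> carrier C"
      and *: "\<And>d. d > 0 \<Longrightarrow> \<exists>v\<in>carrier C. x \<^bold>* v \<in> approximated \<and> cnorm C (y \<^bold>- v) < d" for x y
  proof (rule closedinD [OF approximated_closedin])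
    have xc: "x \<in> carrier C"
      using x by (rule approximated_closed)
    then show "x \<^bold>* y \<in> carrier C"
      using y by simp
    fix d :: real assume d: "d > 0"
    have pos: "cnorm C x + 1 > 0"
      using nrm_nonneg [OF xc] by linarith
    then have "d / (cnorm C x + 1) > 0"
      using d by simp
    then obtain v where v: "v \<in> carrier C" "x \<^bold>* v \<in> approximated" "cnorm C (y \<^bold>- v) < d / (cnorm C x + 1)"
      using * by blast
    have "cnorm C (x \<^bold>* y \<^bold>- x \<^bold>* v) \<le> cnorm C x * cnorm C (y \<^bold>- v)"
      using nrm_mul [of x "y \<^bold>- v"] xc y v(1) by (simp add: mul_sub)
    also have "\<dots> \<le> (cnorm C x + 1) * cnorm C (y \<^bold>- v)"
      using xc y v(1) by (intro mult_right_mono) auto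
    also have "\<dots> < d"
      using v(3) pos by (simp add: pos_less_divide_eq mult.commute)
    finally show "\<exists>w\<in>approximated. cnorm C (x \<^bold>* y \<^bold>- w) < d"
      using v(2) by blast
  qed
  have V_closed: "closedin (norm_topology C) ?V"
    unfolding closedin_norm_topology_iff
  proof (intro conjI ballI impI)
    show "?V \<subseteq> carrier C" by blast
    fix y assume y: "y \<in> carrier C" and *: "\<forall>d>0. \<exists>v\<in>?V. cnorm C (y \<^bold>- v) < d"
    have "x \<^bold>* y \<in> approximated" if x: "x \<in> approximated" for x
    proof (rule closed [OF x y])
      fix d :: real assume "d > 0"
      then obtain v where "v \<in> ?V" "cnorm C (y \<^bold>- v) < d"
        using * by blast
      with x show "\<exists>v\<in>carrier C. x \<^bold>* v \<in> approximated \<and> cnorm C (y \<^bold>- v) < d"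
        by (intro bexI [of _ v]) simp_all
    qed
    moreover have "x \<^bold>* y\<^sup>\<dagger> \<in> approximated" if x: "x \<in> approximated" for x
    proof (rule closed [OF x adj_closed [OF y]])
      fix d :: real assume "d > 0"
      then obtain v where v: "v \<in> ?V" "cnorm C (y \<^bold>- v) < d"
        using * by blast
      then have "cnorm C ((y \<^bold>- v)\<^sup>\<dagger>) < d"
        using y by (subst nrm_adj) auto
      with v x y show "\<exists>v\<in>carrier C. x \<^bold>* v \<in> approximated \<and> cnorm C (y\<^sup>\<dagger> \<^bold>- v) < d"
        by (intro bexI [of _ "v\<^sup>\<dagger>"]) (auto simp: adj_sub)
    qed
    ultimately show "y \<in> ?V"
      using y by blast
  qed
  have "cstar_subalgebra ?V C"
    unfolding cstar_subalgebra_def linear_subspace_def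
  proof (intro conjI ballI allI)
    show "?V \<subseteq> carrier C" by blast
    show "\<^bold>0 \<in> ?V"
      using approximated_closed by (auto simp: approximated_zero)
    show "y \<^bold>+ z \<in> ?V" if "y \<in> ?V" "z \<in> ?V" for y z
      using that approximated_closed by (auto simp: adj_add mul_distrib_left approximated_add)
    show "c \<^bold>\<cdot> y \<in> ?V" if "y \<in> ?V" for c y
      using that approximated_closed by (auto simp: adj_scale scale_mul_right approximated_scale)
    show "y \<^bold>* z \<in> ?V" if "y \<in> ?V" "z \<in> ?V" for y z
    proof -
      have "x \<^bold>* (y \<^bold>* z) \<in> approximated \<and> x \<^bold>* (y \<^bold>* z)\<^sup>\<dagger> \<in> approximated" if "x \<in> approximated" for x
      proof -
        have "x \<^bold>* y \<^bold>* z \<in> approximated" "x \<^bold>* z\<^sup>\<dagger> \<^bold>* y\<^sup>\<dagger> \<in> approximated"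
          using \<open>y \<in> ?V\<close> \<open>z \<in> ?V\<close> that by simp_all
        then show ?thesis
          using \<open>y \<in> ?V\<close> \<open>z \<in> ?V\<close> approximated_closed [OF that] by (simp add: adj_mul mul_assoc)
      qed
      then show ?thesis
        using that by blast
    qed
    show "y\<^sup>\<dagger> \<in> ?V" if "y \<in> ?V" for y
      using that by auto
    show "closedin (norm_topology C) ?V"
      by (rule V_closed)
  qed
  moreover have "s ` alphabet E \<union> p ` \<B> \<subseteq> ?V"
  proof -
    have "b \<in> ?V" if "b \<in> generators" "b\<^sup>\<dagger> \<in> generators" for b
      using approximated_mul_generator [OF _ that(1)] approximated_mul_generator [OF _ that(2)]
        generators_closed [OF that(1)] by simp
    moreover have "b \<in> generators \<and> b\<^sup>\<dagger> \<in> generators" if "b \<in> s ` alphabet E \<union> p ` \<B>" for b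
      using that p_adj by (auto simp: generators_def)
    ultimately show ?thesis by blast
  qed
  ultimately have "carrier C \<subseteq> ?V"
    unfolding generated [symmetric] generated_cstar_subalgebra_def by (intro Inter_lower) blast
  with x y show ?thesis by blast
qed

lemma closed_ideal_approximated: "closed_ideal approximated C"
  unfolding closed_ideal_def linear_subspace_def
  by (intro conjI ballI allI subsetI)
    (simp_all add: approximated_closed approximated_closedin approximated_zero approximated_add
      approximated_scale approximated_mul_left approximated_mul_right)

definition "null_ideal = generated_ideal C {p A | A. A \<in> \<B> \<and> null A}"

lemma closed_ideal_null_ideal: "closed_ideal null_ideal C"
  unfolding null_ideal_def by (rule closed_ideal_generated_ideal) auto

sublocale I: cstar_ideal C null_ideal
  by unfold_locales (rule closed_ideal_null_ideal)

lemma p_in_null_ideal: "A \<in> \<B> \<Longrightarrow> null A \<Longrightarrow> p A \<in> null_ideal"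
  unfolding null_ideal_def by (rule subsetD [OF generated_ideal_superset]) blast

lemma null_ideal_approximated: "null_ideal \<subseteq> approximated"
  unfolding null_ideal_def
proof (rule generated_ideal_least [OF closed_ideal_approximated])
  have "p A \<in> approximated" if "A \<in> \<B>" "null A" for A
  proof -
    have "p A \<in> units"
      using level_0I [OF that] unfolding units_def by blast
    then show ?thesis
      using that by (auto simp: approximated_def p_mul intro!: bexI [of _ "p A"])
  qed
  then show "{p A |A. A \<in> \<B> \<and> null A} \<subseteq> approximated"
    by blast
qed

text \<open>Conjugation by s_a stays inside an ideal. The units thus lie in the null ideal, as
  \<open>cstar_ideal_projections\<close> demands.\<close>

lemma level_in_null_ideal: "e \<in> level n \<Longrightarrow> e \<in> null_ideal"
proof (induction n arbitrary: e)
  case 0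
  then show ?case
    using p_in_null_ideal by auto
next
  case (Suc n)
  then obtain F f where F: "e = conj_sum F f" "finite F" "F \<subseteq> alphabet E" "\<And>a. a \<in> F \<Longrightarrow> f a \<in> level n"
    by auto
  have "conj_sum F f \<in> null_ideal"
    using F(2,3,4)
  proof (induction F)
    case empty
    then show ?case
      by (simp add: conj_sum_def)
  next
    case (insert a F)
    have c: "(\<lambda>a. s a \<^bold>* f a \<^bold>* (s a)\<^sup>\<dagger>) \<in> F \<rightarrow> carrier C" "a \<in> alphabet E" "f a \<in> carrier C"
      using insert.prems level_closed by (auto intro!: conj_closed)
    have "f a \<in> null_ideal"
      using insert.prems(2) Suc.IH by auto
    then have "s a \<^bold>* f a \<^bold>* (s a)\<^sup>\<dagger> \<in> null_ideal"
      using c by (intro I.ideal_mul_left I.ideal_mul_right) auto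
    moreover have "conj_sum F f \<in> null_ideal"
      using insert by auto
    ultimately show ?case
      unfolding conj_sum_def using insert.hyps c conj_closed by (simp add: add.finprod_insert I.ideal_add)
  qed
  with F(1) show ?case by simp
qed

lemma units_in_null_ideal: "e \<in> units \<Longrightarrow> e \<in> null_ideal"
  unfolding units_def by (elim UN_E) (rule level_in_null_ideal)

sublocale I: cstar_ideal_projections C null_ideal
proof
  fix j and d :: real assume j: "j \<in> null_ideal" and d: "d > 0"
  obtain e where e: "e \<in> units" "cnorm C (j \<^bold>- j \<^bold>* e) < d"
    using approximatedD [OF subsetD [OF null_ideal_approximated j] d] by (rule bexE)
  then show "\<exists>p\<in>null_ideal. is_projection C p \<and> cnorm C (j \<^bold>- j \<^bold>* p) < d"
    using units_projection [OF e(1)] units_in_null_ideal [OF e(1)] by (intro bexI conjI)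
qed

section \<open>The quotient algebra represents the quotient labelled space\<close>

lemma p_diff_split: "A \<in> \<B> \<Longrightarrow> B \<in> \<B> \<Longrightarrow> p A = p (A \<inter> B) \<^bold>+ p (A - B)"
proof -
  assume AB: "A \<in> \<B>" "B \<in> \<B>"
  have "p ((A \<inter> B) \<union> (A - B)) = p (A \<inter> B) \<^bold>+ p (A - B) \<^bold>- p ((A \<inter> B) \<inter> (A - B))"
    using AB by (intro p_Un inter_in diff_in)
  moreover have "(A \<inter> B) \<union> (A - B) = A" "(A \<inter> B) \<inter> (A - B) = {}"
    by auto
  ultimately show ?thesis
    using AB by (simp add: p_empty inter_in diff_in)
qed

abbreviation "\<pi> \<equiv> coset C null_ideal"

text \<open>Modulo the ideal both projections equal the one of A \<inter> B, because p_A - p_{A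
  \<inter> B} = p_{A - B} and the set differences are null.\<close>

lemma coset_p_eq:
  assumes "A \<in> \<B>" "B \<in> \<B>" "R `` {A} = R `` {B}"
  shows "\<pi> (p A) = \<pi> (p B)"
proof -
  have *: "\<pi> (p A) = \<pi> (p (A \<inter> B))" if "A \<in> \<B>" "B \<in> \<B>" "null (A - B)" for A B
  proof -
    have "p A \<^bold>- p (A \<inter> B) = p (A - B)"
      unfolding p_diff_split [OF that(1,2)] add_comm [OF p_closed [OF inter_in [OF that(1,2)]] p_closed [OF diff_in [OF that(1,2)]]]
      using that by (simp add: inter_in diff_in)
    then show ?thesis
      using that by (simp add: I.coset_eq_iff inter_in p_in_null_ideal diff_in)
  qed
  show ?thesis
    using * [of A B] * [of B A] assms class_eq_iff_null_diff [OF assms(1,2)] by (simp add: Int_commute)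
qed

text \<open>The representative is arbitrary; \<open>coset_p_eq\<close> makes the value independent
  of it.\<close>

definition class_projection :: "'v set set \<Rightarrow> 'x set" where
  "class_projection X = \<pi> (p (SOME A. A \<in> X))"

lemma class_projection: 
  assumes "A \<in> \<B>"
  shows "class_projection (R `` {A}) = \<pi> (p A)"
proof -
  have "A \<in> R `` {A}"
    using equiv assms by (auto simp: equiv_def refl_on_def)
  define B where "B = (SOME B. B \<in> R `` {A})"
  have "B \<in> R `` {A}"
    unfolding B_def by (rule someI) fact
  then have AB: "(A, B) \<in> R"
    by simp
  then have "B \<in> \<B>"
    using equiv_type [OF equiv] by blast
  then have "\<pi> (p A) = \<pi> (p B)"
    using equiv_class_eq [OF equiv AB] by (rule coset_p_eq [OF assms])
  then show ?thesis
    by (simp only: class_projection_def B_def)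
qed

text \<open>s_a = s_a p_{r(a)}, and r(a) is null.\<close>

lemma s_in_null_ideal:
  assumes "a \<in> alphabet E" "a \<notin> \<A>\<^sub>R"
  shows "s a \<in> null_ideal"
proof -
  have "s a \<^bold>* p (path_range E [a]) \<in> null_ideal"
    using assms by (intro I.ideal_mul_left p_in_null_ideal range_single_in)
      (auto simp: quotient_alphabet_iff)
  with assms(1) show ?thesis by simp
qed

lemma quotient_rep_ideal: "quotient_rep E \<B> R I.Q (\<lambda>a. \<pi> (s a)) class_projection"
proof -
  interpret \<pi>: cstar_hom C I.Q \<pi>
    by (intro cstar_hom.intro cstar_hom_axioms.intro cstar_algebra_axioms I.cstar_algebra_quotient
        I.star_hom_coset)
  note [simp del] = \<pi>.hom_zero
  have alph: "a \<in> alphabet E" if "a \<in> \<A>\<^sub>R" for a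
    using that by (rule quotient_alphabetD)
  show ?thesis
    unfolding quotient_rep_def
  proof (intro conjI ballI impI)
    show "is_projection I.Q (class_projection X)" if X: "X \<in> \<B> // R" for X
    proof -
      obtain A where A: "A \<in> \<B>" "X = R `` {A}"
        using X by (auto elim: quotientE)
      have "is_projection C (p A)"
        using rep A by (simp add: labelled_space_rep_def)
      then show ?thesis
        unfolding A(2) class_projection [OF A(1)] by (rule \<pi>.hom_projection)
    qed
    show "is_partial_isometry I.Q (\<pi> (s a))" if "a \<in> \<A>\<^sub>R" for a
      using rep alph [OF that] by (intro \<pi>.hom_partial_isometry) (simp add: labelled_space_rep_def)
    show "class_projection (R `` {{}}) = \<^bold>0\<^bsub>I.Q\<^esub>"
      by (simp add: class_projection empty_in p_empty)
    show "class_projection (R `` {A}) \<^bold>*\<^bsub>I.Q\<^esub> class_projection (R `` {B}) = class_projection (R `` {A \<inter> B})"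
      if "A \<in> \<B>" "B \<in> \<B>" for A B
      using that by (simp add: class_projection inter_in p_mul flip: \<pi>.hom_mul)
    show "class_projection (R `` {A \<union> B}) = class_projection (R `` {A}) \<^bold>+\<^bsub>I.Q\<^esub>
        class_projection (R `` {B}) \<^bold>-\<^bsub>I.Q\<^esub> class_projection (R `` {A \<inter> B})"
      if "A \<in> \<B>" "B \<in> \<B>" for A B
      using that by (simp add: class_projection inter_in union_in p_Un flip: \<pi>.hom_add \<pi>.hom_sub)
    show "class_projection (R `` {A}) \<^bold>*\<^bsub>I.Q\<^esub> \<pi> (s a) =
        \<pi> (s a) \<^bold>*\<^bsub>I.Q\<^esub> class_projection (R `` {rel_range E A [a]})"
      if "A \<in> \<B>" "a \<in> \<A>\<^sub>R" for A a
      using that alph by (simp add: class_projection rel_range_single_in p_s flip: \<pi>.hom_mul)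
    show "(\<pi> (s a))\<^sup>\<dagger>\<^bsub>I.Q\<^esub> \<^bold>*\<^bsub>I.Q\<^esub> \<pi> (s a) = class_projection (R `` {path_range E [a]})"
      if "a \<in> \<A>\<^sub>R" for a
      using alph [OF that] by (simp add: class_projection range_single_in s_adj_s flip: \<pi>.hom_mul \<pi>.hom_adj)
    show "(\<pi> (s a))\<^sup>\<dagger>\<^bsub>I.Q\<^esub> \<^bold>*\<^bsub>I.Q\<^esub> \<pi> (s b) = \<^bold>0\<^bsub>I.Q\<^esub>"
      if "a \<in> \<A>\<^sub>R" "b \<in> \<A>\<^sub>R" "a \<noteq> b" for a b
      using alph that by (simp add: s_adj_s_neq flip: \<pi>.hom_mul \<pi>.hom_adj)
    fix A assume A: "A \<in> \<B>"
    let ?f = "\<lambda>a. s a \<^bold>* p (rel_range E A [a]) \<^bold>* (s a)\<^sup>\<dagger>"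
    let ?g = "\<lambda>a. \<pi> (s a) \<^bold>*\<^bsub>I.Q\<^esub> class_projection (R `` {rel_range E A [a]}) \<^bold>*\<^bsub>I.Q\<^esub> (\<pi> (s a))\<^sup>\<dagger>\<^bsub>I.Q\<^esub>"
    have em: "a \<in> alphabet E" "rel_range E A [a] \<in> \<B>" if "a \<in> emitted_labels E A" for a
      using that emitted_subset [of A] rel_range_single_in [OF A] by auto
    have fg: "\<pi> (?f a) = ?g a" if "a \<in> emitted_labels E A" for a
      using em [OF that] by (simp add: class_projection \<pi>.hom_mul \<pi>.hom_adj)
    \<comment> \<open>Terms with null r(A,a) die in the quotient, which leaves exactly the letters
      over which the quotient labelled space sums.\<close>
    have g0: "?g a = \<^bold>0\<^bsub>I.Q\<^esub>" if "a \<in> emitted_labels E A" "null (rel_range E A [a])" for a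
    proof -
      have "?f a \<in> null_ideal"
        using em [OF that(1)] that(2) by (intro I.ideal_mul_left I.ideal_mul_right p_in_null_ideal) auto
      then show ?thesis
        unfolding fg [OF that(1), symmetric] I.zero_quotient by (rule I.coset_zero)
    qed
    have "class_projection (R `` {A}) = \<pi> (finprod (additive C) ?f (emitted_labels E A))"
      using class_projection [OF A] p_sum [OF A] by simp
    also have "\<dots> = finprod (additive I.Q) (\<lambda>a. \<pi> (?f a)) (emitted_labels E A)"
      using em finite_emitted [OF A] by (intro \<pi>.hom_finprod) auto
    also have "\<dots> = finprod (additive I.Q) ?g {a \<in> emitted_labels E A. \<not> null (rel_range E A [a])}"
    proof (rule \<pi>.D.add.finprod_mono_neutral_cong_left [symmetric])
      show "\<pi> (?f i) = \<^bold>0\<^bsub>I.Q\<^esub>"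
        if "i \<in> emitted_labels E A - {a \<in> emitted_labels E A. \<not> null (rel_range E A [a])}" for i
        using that g0 [of i] fg [of i] by simp
      show "?g x = \<pi> (?f x)" if "x \<in> {a \<in> emitted_labels E A. \<not> null (rel_range E A [a])}" for x
        using that fg [of x] by simp
      show "(\<lambda>a. \<pi> (?f a)) \<in> emitted_labels E A \<rightarrow> carrier I.Q"
        using em by (intro funcsetI \<pi>.hom_closed) auto
    qed (use finite_emitted [OF A] in auto)
    finally show "class_projection (R `` {A}) = finprod (additive I.Q) ?g
        {a \<in> class_emitted_labels E R A \<inter> \<A>\<^sub>R. \<not> null (rel_range E A [a])}"
      unfolding quotient_index_set [OF A] .
  qed
qed

end

text \<open>Setting t_a = 0 outside \<open>\<A>\<^sub>R\<close> is forced: there r(a) is null, so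
  t_a\<dagger>t_a must be q_{[{}]} = 0.\<close>

lemma (in quotient_setting) labelled_space_rep_quotient:
  assumes "cstar_algebra D" and rep: "quotient_rep E \<B> R D t q"
  shows "labelled_space_rep E \<B> D (\<lambda>a. if a \<in> \<A>\<^sub>R then t a else \<^bold>0\<^bsub>D\<^esub>) (\<lambda>A. q (R `` {A}))"
proof -
  interpret D: cstar_algebra D by fact
  have q: "q (R `` {A}) \<in> carrier D" if "A \<in> \<B>" for A
    using rep quotientI [OF that, of R] by (auto simp: quotient_rep_def is_projection_def)
  have t: "t a \<in> carrier D" if "a \<in> \<A>\<^sub>R" for a
    using rep that by (auto simp: quotient_rep_def is_partial_isometry_def)
  have q0: "q (R `` {{}}) = \<^bold>0\<^bsub>D\<^esub>"
    using rep by (simp add: quotient_rep_def)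
  show ?thesis
    unfolding labelled_space_rep_def
  proof (intro conjI ballI impI)
    show "is_projection D (q (R `` {A}))" if "A \<in> \<B>" for A
      using rep quotientI [OF that, of R] by (simp add: quotient_rep_def)
    show "is_partial_isometry D (if a \<in> \<A>\<^sub>R then t a else \<^bold>0\<^bsub>D\<^esub>)" for a
      using rep by (simp add: quotient_rep_def is_partial_isometry_def)
    show "q (R `` {{}}) = \<^bold>0\<^bsub>D\<^esub>"
      by (rule q0)
    show "q (R `` {A}) \<^bold>*\<^bsub>D\<^esub> q (R `` {B}) = q (R `` {A \<inter> B})"
      "q (R `` {A \<union> B}) = q (R `` {A}) \<^bold>+\<^bsub>D\<^esub> q (R `` {B}) \<^bold>-\<^bsub>D\<^esub> q (R `` {A \<inter> B})"
      if "A \<in> \<B>" "B \<in> \<B>" for A B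
      using rep that by (simp_all add: quotient_rep_def)
    show "q (R `` {A}) \<^bold>*\<^bsub>D\<^esub> (if a \<in> \<A>\<^sub>R then t a else \<^bold>0\<^bsub>D\<^esub>) =
        (if a \<in> \<A>\<^sub>R then t a else \<^bold>0\<^bsub>D\<^esub>) \<^bold>*\<^bsub>D\<^esub> q (R `` {rel_range E A [a]})"
      if "A \<in> \<B>" "a \<in> alphabet E" for A a
    proof (cases "a \<in> \<A>\<^sub>R")
      case True
      then show ?thesis
        using rep that by (simp add: quotient_rep_def)
    next
      case False
      then show ?thesis
        using q [OF that(1)] q [OF rel_range_single_in [OF that]] by simp
    qed
    show "(if a \<in> \<A>\<^sub>R then t a else \<^bold>0\<^bsub>D\<^esub>)\<^sup>\<dagger>\<^bsub>D\<^esub> \<^bold>*\<^bsub>D\<^esub> (if a \<in> \<A>\<^sub>R then t a else \<^bold>0\<^bsub>D\<^esub>) =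
        q (R `` {path_range E [a]})" if "a \<in> alphabet E" for a
    proof (cases "a \<in> \<A>\<^sub>R")
      case True
      then show ?thesis
        using rep by (simp add: quotient_rep_def)
    next
      case False
      then have "null (path_range E [a])"
        using that by (simp add: quotient_alphabet_iff)
      with False show ?thesis
        by (simp add: q0)
    qed
    show "(if a \<in> \<A>\<^sub>R then t a else \<^bold>0\<^bsub>D\<^esub>)\<^sup>\<dagger>\<^bsub>D\<^esub> \<^bold>*\<^bsub>D\<^esub> (if b \<in> \<A>\<^sub>R then t b else \<^bold>0\<^bsub>D\<^esub>) = \<^bold>0\<^bsub>D\<^esub>"
      if "a \<noteq> b" for a b
      using rep that t by (auto simp: quotient_rep_def)
    fix A assume A: "A \<in> \<B>"
    let ?f = "\<lambda>a. (if a \<in> \<A>\<^sub>R then t a else \<^bold>0\<^bsub>D\<^esub>) \<^bold>*\<^bsub>D\<^esub> q (R `` {rel_range E A [a]}) \<^bold>*\<^bsub>D\<^esub>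
        (if a \<in> \<A>\<^sub>R then t a else \<^bold>0\<^bsub>D\<^esub>)\<^sup>\<dagger>\<^bsub>D\<^esub>"
    let ?g = "\<lambda>a. t a \<^bold>*\<^bsub>D\<^esub> q (R `` {rel_range E A [a]}) \<^bold>*\<^bsub>D\<^esub> (t a)\<^sup>\<dagger>\<^bsub>D\<^esub>"
    let ?F = "{a \<in> emitted_labels E A. \<not> null (rel_range E A [a])}"
    have em: "a \<in> alphabet E" "q (R `` {rel_range E A [a]}) \<in> carrier D" if "a \<in> emitted_labels E A" for a
      using that emitted_subset [of A] rel_range_single_in [OF A] q by auto
    have F: "?F \<subseteq> \<A>\<^sub>R"
      using em null_rel_range_outside [OF A] by auto
    have f_closed: "?f a \<in> carrier D" if "a \<in> emitted_labels E A" for a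
      using em [OF that] t [of a] by simp
    have f0: "?f a = \<^bold>0\<^bsub>D\<^esub>" if a: "a \<in> emitted_labels E A - ?F" for a
    proof -
      have "null (rel_range E A [a])"
        using a by simp
      then have "q (R `` {rel_range E A [a]}) = \<^bold>0\<^bsub>D\<^esub>"
        using q0 by simp
      then show ?thesis
        using t [of a] by simp
    qed
    have sum: "finprod (additive D) ?g ?F = finprod (additive D) ?f (emitted_labels E A)"
    proof (rule D.add.finprod_mono_neutral_cong_left)
      show "?g a = ?f a" if "a \<in> ?F" for a
        using subsetD [OF F that] by simp
      show "?f \<in> emitted_labels E A \<rightarrow> carrier D"
        using f_closed by (rule funcsetI)
    qed (use finite_emitted [OF A] f0 in auto)
    show "q (R `` {A}) = finprod (additive D) ?f (emitted_labels E A)"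
    \<comment> \<open>If the class emits no letter of \<open>\<A>\<^sub>R\<close>, then A is null
      and both sides vanish; otherwise the relation of the quotient applies, up to terms that are
      0.\<close>
    proof (cases "class_emitted_labels E R A \<inter> \<A>\<^sub>R = {}")
      case False
      have "\<forall>A\<in>\<B>. class_emitted_labels E R A \<inter> \<A>\<^sub>R \<noteq> {} \<longrightarrow>
          q (R `` {A}) = finprod (additive D)
            (\<lambda>a. t a \<^bold>*\<^bsub>D\<^esub> q (R `` {rel_range E A [a]}) \<^bold>*\<^bsub>D\<^esub> (t a)\<^sup>\<dagger>\<^bsub>D\<^esub>)
            {a \<in> class_emitted_labels E R A \<inter> \<A>\<^sub>R. \<not> null (rel_range E A [a])}"
        using rep unfolding quotient_rep_def by (elim conjE)
      then have "q (R `` {A}) = finprod (additive D) ?g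
          {a \<in> class_emitted_labels E R A \<inter> \<A>\<^sub>R. \<not> null (rel_range E A [a])}"
        using A False by (simp only: not_False_eq_True simp_thms)
      then show ?thesis
        unfolding quotient_index_set [OF A] sum .
    next
      case True
      then have "null A"
        by (rule null_of_no_labels [OF A])
      moreover have "?F = {}"
        using True quotient_index_set [OF A] by auto
      then have "finprod (additive D) ?g ?F = \<^bold>0\<^bsub>D\<^esub>"
        by (simp only: D.add.finprod_empty)
      ultimately show ?thesis
        using sum q0 by simp
    qed
  qed
qed

section \<open>The isomorphism with the quotient by the null ideal\<close>

context labelled_cstar
begin

lemma quotient_isomorphism:
  fixes D :: "'x cstar_data"
  assumes C: "is_labelled_space_cstar E \<B> C s p" and D: "is_quotient_cstar E \<B> R D t q"
    and nonzero: "\<And>A. A \<in> \<B> \<Longrightarrow> \<not> null A \<Longrightarrow> q (R `` {A}) \<noteq> \<^bold>0\<^bsub>D\<^esub>"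
  shows "\<A>\<^sub>R = {a \<in> alphabet E. p (path_range E [a]) \<notin> null_ideal}"
    and "\<exists>\<phi>. star_iso D I.Q \<phi> \<and> (\<forall>b\<in>\<A>\<^sub>R. \<phi> (t b) = \<pi> (s b)) \<and>
      (\<forall>A\<in>\<B>. \<phi> (q (R `` {A})) = \<pi> (p A))"
proof -
  have Dc: "cstar_algebra D" and D_rep: "quotient_rep E \<B> R D t q"
    and D_gen: "generated_cstar_subalgebra D (t ` \<A>\<^sub>R \<union> q ` (\<B> // R)) = carrier D"
    using D unfolding is_quotient_cstar_def by blast+
  interpret D: cstar_algebra D by (rule Dc)
  have Qc: "cstar_algebra I.Q"
    by (rule I.cstar_algebra_quotient)
  have t: "t a \<in> carrier D" if "a \<in> \<A>\<^sub>R" for a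
    using D_rep that by (auto simp: quotient_rep_def is_partial_isometry_def)
  have q: "q X \<in> carrier D" if "X \<in> \<B> // R" for X
    using D_rep that by (auto simp: quotient_rep_def is_projection_def)
  have q0: "q (R `` {{}}) = \<^bold>0\<^bsub>D\<^esub>"
    using D_rep by (simp add: quotient_rep_def)
  have "labelled_space_rep E \<B> D (\<lambda>a. if a \<in> \<A>\<^sub>R then t a else \<^bold>0\<^bsub>D\<^esub>) (\<lambda>A. q (R `` {A}))"
    by (rule labelled_space_rep_quotient [OF Dc D_rep])
  then have "\<exists>\<psi>. star_hom C D \<psi> \<and> (\<forall>a\<in>alphabet E. \<psi> (s a) = (if a \<in> \<A>\<^sub>R then t a else \<^bold>0\<^bsub>D\<^esub>)) \<and>
      (\<forall>A\<in>\<B>. \<psi> (p A) = q (R `` {A}))"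
    using C Dc unfolding is_labelled_space_cstar_def by blast
  then obtain \<psi> where \<psi>: "star_hom C D \<psi>"
      and \<psi>_s: "\<And>a. a \<in> alphabet E \<Longrightarrow> \<psi> (s a) = (if a \<in> \<A>\<^sub>R then t a else \<^bold>0\<^bsub>D\<^esub>)"
      and \<psi>_p: "\<And>A. A \<in> \<B> \<Longrightarrow> \<psi> (p A) = q (R `` {A})"
    by blast
  interpret \<psi>: cstar_hom C D \<psi>
    by (intro cstar_hom.intro cstar_hom_axioms.intro cstar_algebra_axioms Dc \<psi>)
  have kernel: "\<psi> x = \<^bold>0\<^bsub>D\<^esub>" if x: "x \<in> null_ideal" for x
  proof -
    have "{p A |A. A \<in> \<B> \<and> null A} \<subseteq> {x \<in> carrier C. \<psi> x = \<^bold>0\<^bsub>D\<^esub>}"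
      by (auto simp: \<psi>_p q0)
    then have "null_ideal \<subseteq> {x \<in> carrier C. \<psi> x = \<^bold>0\<^bsub>D\<^esub>}"
      unfolding null_ideal_def by (rule generated_ideal_least [OF \<psi>.closed_ideal_kernel])
    with x show ?thesis by auto
  qed
  show "\<A>\<^sub>R = {a \<in> alphabet E. p (path_range E [a]) \<notin> null_ideal}"
  proof (intro Set.set_eqI iffI)
    fix a assume a: "a \<in> \<A>\<^sub>R"
    then have "a \<in> alphabet E" "\<not> null (path_range E [a])"
      by (simp_all add: quotient_alphabet_iff)
    \<comment> \<open>\<psi> annihilates the ideal, so p_{r(a)} lies outside it as soon as
      q_{[r(a)]} is nonzero; this is where \<open>nonzero\<close> enters.\<close>
    moreover from this have "\<psi> (p (path_range E [a])) \<noteq> \<^bold>0\<^bsub>D\<^esub>"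
      by (simp add: \<psi>_p range_single_in nonzero)
    ultimately show "a \<in> {a \<in> alphabet E. p (path_range E [a]) \<notin> null_ideal}"
      using kernel by auto
  next
    fix a assume "a \<in> {a \<in> alphabet E. p (path_range E [a]) \<notin> null_ideal}"
    then show "a \<in> \<A>\<^sub>R"
      using p_in_null_ideal range_single_in by (auto simp: quotient_alphabet_iff)
  qed
  \<comment> \<open>Cosets are sets of elements of C and so live in another type; there are no more
    of them than elements of C.\<close>
  have small: "carrier I.Q \<lesssim> (UNIV :: 'x set)"
  proof -
    have "carrier I.Q \<lesssim> carrier C"
      unfolding I.carrier_quotient by (rule image_lepoll)
    also have "\<dots> \<lesssim> (UNIV :: 'x set)"
      by (rule subset_imp_lepoll) simp
    finally show ?thesis .
  qed
  have "\<exists>\<phi>. star_hom D I.Q \<phi> \<and> (\<forall>a\<in>\<A>\<^sub>R. \<phi> (t a) = \<pi> (s a)) \<and>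
      (\<forall>A\<in>\<B>. \<phi> (q (R `` {A})) = class_projection (R `` {A}))"
  proof (rule quotient_cstar_universal [OF D Qc quotient_rep_ideal small finite_quotient_index_set])
    show "rel_range E A [a] \<in> \<B>" if "A \<in> \<B>" "a \<in> \<A>\<^sub>R" for A a
      using that by (intro rel_range_single_in quotient_alphabetD)
    show "A \<union> B \<in> \<B> \<and> A \<inter> B \<in> \<B>" if "A \<in> \<B>" "B \<in> \<B>" for A B
      using that by (intro conjI union_in inter_in)
  qed (assumption, intro exI conjI ballI, assumption, simp_all)
  then obtain \<phi> where \<phi>: "star_hom D I.Q \<phi>" and \<phi>_t: "\<And>a. a \<in> \<A>\<^sub>R \<Longrightarrow> \<phi> (t a) = \<pi> (s a)"
    and \<phi>_q: "\<And>A. A \<in> \<B> \<Longrightarrow> \<phi> (q (R `` {A})) = class_projection (R `` {A})"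
    by blast
  interpret \<phi>: cstar_hom D I.Q \<phi>
    by (intro cstar_hom.intro cstar_hom_axioms.intro Dc Qc \<phi>)
  have \<phi>\<psi>: "\<phi> (\<psi> x) = \<pi> x" if x: "x \<in> carrier C" for x
  proof (rule star_hom_eq_on_generated [OF _ _ generated])
    show "cstar_hom C I.Q (\<lambda>x. \<phi> (\<psi> x))"
      by (intro cstar_hom.intro cstar_hom_axioms.intro cstar_algebra_axioms Qc star_hom_comp [OF \<psi> \<phi>])
    show "cstar_hom C I.Q \<pi>"
      by (intro cstar_hom.intro cstar_hom_axioms.intro cstar_algebra_axioms Qc I.star_hom_coset)
    show "s ` alphabet E \<union> p ` \<B> \<subseteq> carrier C"
      by auto
    fix y assume "y \<in> s ` alphabet E \<union> p ` \<B>"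
    then consider a where "a \<in> alphabet E" "y = s a" | A where "A \<in> \<B>" "y = p A"
      by blast
    then show "\<phi> (\<psi> y) = \<pi> y"
    proof cases
      case 1
      show ?thesis
      proof (cases "a \<in> \<A>\<^sub>R")
        case True
        then show ?thesis
          using 1 by (simp only: \<psi>_s \<phi>_t if_True)
      next
        case False
        have "\<pi> (s a) = \<^bold>0\<^bsub>I.Q\<^esub>"
          unfolding I.zero_quotient using s_in_null_ideal [OF 1(1) False] by (rule I.coset_zero)
        then show ?thesis
          using 1 False by (simp only: \<psi>_s if_False \<phi>.hom_zero)
      qed
    next
      case 2
      then show ?thesis
        by (simp only: \<psi>_p \<phi>_q class_projection)
    qed
  qed (rule x)
  \<comment> \<open>The map induced by \<psi> on cosets; the chosen representative does not matter
    because \<psi> kills the null ideal.\<close>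
  define \<psi>' where "\<psi>' X = \<psi> (SOME x. x \<in> X)" for X
  have \<psi>': "\<psi>' (\<pi> x) = \<psi> x" if x: "x \<in> carrier C" for x
  proof -
    define y where "y = (SOME y. y \<in> \<pi> x)"
    have "y \<in> \<pi> x"
      unfolding y_def by (rule someI [of _ x]) (rule I.self_in_coset [OF x])
    then have y: "y \<in> carrier C" "y \<^bold>- x \<in> null_ideal"
      by (simp_all only: I.mem_coset_iff [OF x])
    then have "\<psi> y \<^bold>-\<^bsub>D\<^esub> \<psi> x = \<^bold>0\<^bsub>D\<^esub>"
      using x kernel by (simp flip: \<psi>.hom_sub)
    then have "\<psi> y = \<psi> x"
      using x y(1) D.sub_eq_zero_iff [of "\<psi> y" "\<psi> x"] \<psi>.hom_closed by blast
    then show ?thesis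
      by (simp only: \<psi>'_def y_def)
  qed
  have \<psi>'_hom: "star_hom I.Q D \<psi>'"
    unfolding star_hom_def I.carrier_quotient
    by (auto simp: \<psi>' I.coset_add I.coset_mul I.coset_scale I.coset_adj \<psi>.hom_add \<psi>.hom_mul
        \<psi>.hom_scale \<psi>.hom_adj)
  have \<psi>'\<phi>: "\<psi>' (\<phi> x) = x" if x: "x \<in> carrier D" for x
  proof (rule star_hom_eq_on_generated [OF _ _ D_gen, of D _ "\<lambda>x. x"])
    show "cstar_hom D D (\<lambda>x. \<psi>' (\<phi> x))"
      by (intro cstar_hom.intro cstar_hom_axioms.intro Dc star_hom_comp [OF \<phi> \<psi>'_hom])
    show "cstar_hom D D (\<lambda>x. x)"
      by (intro cstar_hom.intro cstar_hom_axioms.intro Dc) (simp add: star_hom_def)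
    show "t ` \<A>\<^sub>R \<union> q ` (\<B> // R) \<subseteq> carrier D"
      using t q by auto
    fix y assume "y \<in> t ` \<A>\<^sub>R \<union> q ` (\<B> // R)"
    then consider a where "a \<in> \<A>\<^sub>R" "y = t a" | A where "A \<in> \<B>" "y = q (R `` {A})"
      by (auto elim!: quotientE)
    then show "\<psi>' (\<phi> y) = y"
    proof cases
      case 1
      then show ?thesis
        using quotient_alphabetD [of a] by (simp add: \<phi>_t \<psi>' \<psi>_s)
    next
      case 2
      then show ?thesis
        by (simp add: \<phi>_q class_projection \<psi>' \<psi>_p)
    qed
  qed (rule x)
  have "bij_betw \<phi> (carrier D) (carrier I.Q)"
  proof (rule bij_betw_imageI)
    show "inj_on \<phi> (carrier D)"
      using \<psi>'\<phi> by (rule inj_on_inverseI)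
    show "\<phi> ` carrier D = carrier I.Q"
    proof
      show "\<phi> ` carrier D \<subseteq> carrier I.Q"
        using \<phi>.hom_closed by blast
      show "carrier I.Q \<subseteq> \<phi> ` carrier D"
      proof
        fix X assume "X \<in> carrier I.Q"
        then obtain x where x: "x \<in> carrier C" "X = \<pi> x"
          unfolding I.carrier_quotient by blast
        then show "X \<in> \<phi> ` carrier D"
          unfolding x(2) \<phi>\<psi> [OF x(1), symmetric] using \<psi>.hom_closed by blast
      qed
    qed
  qed
  with \<phi> have "star_iso D I.Q \<phi>"
    by (simp add: star_iso_def)
  moreover have "\<phi> (q (R `` {A})) = \<pi> (p A)" if "A \<in> \<B>" for A
    using that by (simp add: \<phi>_q class_projection)
  ultimately show "\<exists>\<phi>. star_iso D I.Q \<phi> \<and> (\<forall>b\<in>\<A>\<^sub>R. \<phi> (t b) = \<pi> (s b)) \<and>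
      (\<forall>A\<in>\<B>. \<phi> (q (R `` {A})) = \<pi> (p A))"
    using \<phi>_t by blast
qed

end

section \<open>A representation with nonzero projections\<close>

lemma shuffle_op_restrict_comp:
  "shuffle_op (Some |` X) o\<^sub>L shuffle_op (Some |` Y) = shuffle_op (Some |` (X \<inter> Y))"
proof -
  have "(Some |` Y) \<circ>\<^sub>m (Some |` X) = Some |` (X \<inter> Y)"
    by (auto simp: map_comp_def restrict_map_def fun_eq_iff)
  then show ?thesis
    by (simp add: shuffle_op_comp)
qed

lemma partial_inv_restrict: "partial_inv (Some |` X) = Some |` X"
proof
  fix n
  have "partial_inv (Some |` X) n = Some m \<longleftrightarrow> (Some |` X) n = Some m" for m
    unfolding partial_inv_eq_Some_iff [OF partial_inj_restrict] by (auto simp: restrict_map_def)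
  then show "partial_inv (Some |` X) n = (Some |` X) n"
    by (cases "(Some |` X) n") auto
qed

lemma shuffle_op_adj_comp:
  assumes "partial_inj g" "partial_inj h"
  shows "shuffle_op (partial_inv g) o\<^sub>L shuffle_op h = shuffle_op (h \<circ>\<^sub>m partial_inv g)"
  using assms by (simp add: shuffle_op_comp partial_inj_inv)

text \<open>As \<open>shuffle_op_comp\<close> reverses the order, this computes T\<dagger>T, the
  projection onto the coordinates in the range of g; \<open>partial_inv_comp\<close> computes T
  T\<dagger>, the one for its domain.\<close>

lemma comp_partial_inv:
  assumes "partial_inj g"
  shows "g \<circ>\<^sub>m partial_inv g = Some |` ran g"
proof
  fix n
  show "(g \<circ>\<^sub>m partial_inv g) n = (Some |` ran g) n"
  proof (cases "partial_inv g n")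
    case None
    then have "n \<notin> ran g"
      using partial_inv_eq_Some_iff [OF assms, of n] by (auto simp: ran_def)
    with None show ?thesis
      by (simp add: map_comp_def restrict_map_def)
  next
    case (Some m)
    then have m: "g m = Some n"
      by (simp only: partial_inv_eq_Some_iff [OF assms])
    then have "n \<in> ran g"
      by (rule ranI)
    with Some m show ?thesis
      by (simp add: map_comp_def restrict_map_def)
  qed
qed

lemma partial_inv_comp:
  assumes "partial_inj g"
  shows "partial_inv g \<circ>\<^sub>m g = Some |` dom g"
proof
  fix m
  show "(partial_inv g \<circ>\<^sub>m g) m = (Some |` dom g) m"
  proof (cases "g m")
    case None
    then show ?thesis
      by (simp add: map_comp_def restrict_map_def dom_def)
  next
    case (Some n)
    then have "partial_inv g n = Some m"
      by (simp only: partial_inv_eq_Some_iff [OF assms])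
    with Some show ?thesis
      by (simp add: map_comp_def restrict_map_def dom_def)
  qed
qed

lemma projection_restrict: "is_projection ell2_operators (shuffle_op (Some |` X))"
  by (simp add: is_projection_def shuffle_op_closed shuffle_op_adj partial_inv_restrict
      shuffle_op_restrict_comp)

lemma partial_isometry_shuffle:
  assumes g: "partial_inj g"
  shows "is_partial_isometry ell2_operators (shuffle_op g)"
proof -
  have "shuffle_op g o\<^sub>L shuffle_op (partial_inv g) o\<^sub>L shuffle_op g = shuffle_op (Some |` dom g) o\<^sub>L shuffle_op g"
    using g by (simp add: shuffle_op_comp partial_inj_inv partial_inv_comp)
  also have "\<dots> = shuffle_op (g \<circ>\<^sub>m (Some |` dom g))"
    using g by (simp add: shuffle_op_comp)
  also have "g \<circ>\<^sub>m (Some |` dom g) = g"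
  proof
    show "(g \<circ>\<^sub>m (Some |` dom g)) m = g m" for m
      by (cases "g m") (simp_all add: map_comp_def restrict_map_def dom_def)
  qed
  finally show ?thesis
    using g by (simp add: is_partial_isometry_def shuffle_op_closed shuffle_op_adj)
qed

lemma shuffle_op_restrict_Un:
  "shuffle_op (Some |` (X \<union> Y)) =
    shuffle_op (Some |` X) + shuffle_op (Some |` Y) - shuffle_op (Some |` (X \<inter> Y))"
  by (intro blinfun_eqI ell2_eqI)
    (simp add: blinfun.bilinear_simps shuffle_op_nth, simp add: shuffle_def restrict_map_def)

lemma finprod_shuffle_op_restrict:
  assumes "finite F" "\<And>a b. a \<in> F \<Longrightarrow> b \<in> F \<Longrightarrow> a \<noteq> b \<Longrightarrow> X a \<inter> X b = {}"
  shows "finprod (additive ell2_operators) (\<lambda>a. shuffle_op (Some |` X a)) F = shuffle_op (Some |` (\<Union>a\<in>F. X a))"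
  using assms
proof (induction F)
  case empty
  interpret pre_cstar_algebra ell2_operators
    by (rule pre_cstar_algebra_ell2_operators)
  show ?case by simp
next
  case (insert a F)
  interpret pre_cstar_algebra ell2_operators
    by (rule pre_cstar_algebra_ell2_operators)
  have "X a \<inter> (\<Union>a\<in>F. X a) = {}"
    using insert.prems insert.hyps by blast
  moreover have "finprod (additive ell2_operators) (\<lambda>a. shuffle_op (Some |` X a)) F = shuffle_op (Some |` (\<Union>a\<in>F. X a))"
    using insert.prems by (intro insert.IH) auto
  moreover have "finprod (additive ell2_operators) (\<lambda>a. shuffle_op (Some |` X a)) (insert a F) =
      shuffle_op (Some |` X a) \<^bold>+\<^bsub>ell2_operators\<^esub> finprod (additive ell2_operators) (\<lambda>a. shuffle_op (Some |` X a)) F"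
    using insert.hyps by (intro add.finprod_insert funcsetI) (simp_all add: shuffle_op_closed)
  ultimately show ?case
    by (simp add: shuffle_op_restrict_Un)
qed

section \<open>Prime filters of the algebra of classes\<close>

context quotient_setting
begin

text \<open>These are filters of sets, not of classes; invariance under R is derived in
  \<open>prime_filter_class\<close>. Nonemptiness is not demanded, so that pullbacks stay prime
  filters even when no member of U has the form r(A,a).\<close>

definition prime_filter :: "'v set set \<Rightarrow> bool" where
  "prime_filter U \<longleftrightarrow> U \<subseteq> \<B> \<and> (\<forall>A\<in>U. \<not> null A) \<and> (\<forall>A\<in>U. \<forall>B\<in>U. A \<inter> B \<in> U) \<and>
    (\<forall>A\<in>U. \<forall>B\<in>\<B>. A \<subseteq> B \<longrightarrow> B \<in> U) \<and> (\<forall>A\<in>\<B>. \<forall>B\<in>\<B>. A \<union> B \<in> U \<longrightarrow> A \<in> U \<or> B \<in> U)"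

lemma prime_filter_in: "prime_filter U \<Longrightarrow> A \<in> U \<Longrightarrow> A \<in> \<B>"
  and prime_filter_not_null: "prime_filter U \<Longrightarrow> A \<in> U \<Longrightarrow> \<not> null A"
  and prime_filter_Int: "prime_filter U \<Longrightarrow> A \<in> U \<Longrightarrow> B \<in> U \<Longrightarrow> A \<inter> B \<in> U"
  and prime_filter_mono: "prime_filter U \<Longrightarrow> A \<in> U \<Longrightarrow> B \<in> \<B> \<Longrightarrow> A \<subseteq> B \<Longrightarrow> B \<in> U"
  and prime_filter_Un: "prime_filter U \<Longrightarrow> A \<in> \<B> \<Longrightarrow> B \<in> \<B> \<Longrightarrow> A \<union> B \<in> U \<Longrightarrow> A \<in> U \<or> B \<in> U"
  unfolding prime_filter_def by blast+

lemma prime_filter_diff: "prime_filter U \<Longrightarrow> A \<in> U \<Longrightarrow> B \<in> \<B> \<Longrightarrow> A \<inter> B \<in> U \<or> A - B \<in> U"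
proof -
  assume U: "prime_filter U" and A: "A \<in> U" and B: "B \<in> \<B>"
  have "A \<in> \<B>"
    using U A by (rule prime_filter_in)
  moreover have "(A \<inter> B) \<union> (A - B) \<in> U"
    using A by (simp add: Un_Diff_Int Un_commute)
  ultimately show ?thesis
    using B by (intro prime_filter_Un [OF U] inter_in diff_in)
qed

text \<open>If A is in U, one of A \<inter> B and A - B is in U, and the latter is null.\<close>

lemma prime_filter_class:
  assumes U: "prime_filter U" and A: "A \<in> \<B>" and B: "B \<in> \<B>" and AB: "R `` {A} = R `` {B}"
  shows "A \<in> U \<longleftrightarrow> B \<in> U"
proof -
  have *: "B \<in> U" if "A \<in> U" "B \<in> \<B>" "null (A - B)" for A B
  proof -
    have "A \<inter> B \<in> U"
      using prime_filter_diff [OF U that(1,2)] prime_filter_not_null [OF U] that(3) by blast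
    then show ?thesis
      by (rule prime_filter_mono [OF U _ that(2)]) simp
  qed
  have "null (A - B)" "null (B - A)"
    using AB class_eq_iff_null_diff [OF A B] by simp_all
  then show ?thesis
    using * [of A B] * [of B A] A B by blast
qed

definition proper_filter :: "'v set set \<Rightarrow> bool" where
  "proper_filter U \<longleftrightarrow> U \<subseteq> \<B> \<and> (\<forall>A\<in>U. \<not> null A) \<and> (\<forall>A\<in>U. \<forall>B\<in>U. A \<inter> B \<in> U) \<and>
    (\<forall>A\<in>U. \<forall>B\<in>\<B>. A \<subseteq> B \<longrightarrow> B \<in> U)"

lemma proper_filter_generated:
  assumes "F \<subseteq> \<B>" and "\<And>A. A \<in> F \<Longrightarrow> \<not> null A"
    and "\<And>A B. A \<in> F \<Longrightarrow> B \<in> F \<Longrightarrow> \<exists>D\<in>F. D \<subseteq> A \<inter> B"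
  shows "proper_filter {B \<in> \<B>. \<exists>A\<in>F. A \<subseteq> B}"
  unfolding proper_filter_def
proof (intro conjI ballI impI)
  show "{B \<in> \<B>. \<exists>A\<in>F. A \<subseteq> B} \<subseteq> \<B>" by blast
  fix B assume "B \<in> {B \<in> \<B>. \<exists>A\<in>F. A \<subseteq> B}"
  then obtain A where A: "A \<in> F" "A \<subseteq> B" and B: "B \<in> \<B>" by blast
  have AB: "A \<in> \<B>" using A(1) assms(1) by blast
  show "\<not> null B"
    using assms(2) [OF A(1)] null_subset [OF _ A(2) B AB] by blast
  show "D \<in> {B \<in> \<B>. \<exists>A\<in>F. A \<subseteq> B}" if "D \<in> \<B>" "B \<subseteq> D" for D
    using that A by blast
  fix B' assume "B' \<in> {B \<in> \<B>. \<exists>A\<in>F. A \<subseteq> B}"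
  then obtain A' where A': "A' \<in> F" "A' \<subseteq> B'" and B': "B' \<in> \<B>" by blast
  obtain D where "D \<in> F" "D \<subseteq> A \<inter> A'"
    using assms(3) [OF A(1) A'(1)] by blast
  then have "D \<in> F" "D \<subseteq> B \<inter> B'"
    using A(2) A'(2) by auto
  then show "B \<inter> B' \<in> {B \<in> \<B>. \<exists>A\<in>F. A \<subseteq> B}"
    using inter_in [OF B B'] by blast
qed

lemma proper_filter_extend:
  assumes M: "proper_filter M" and A: "A \<in> \<B>" and nn: "\<And>D. D \<in> M \<Longrightarrow> \<not> null (D \<inter> A)"
  shows "proper_filter {B \<in> \<B>. \<exists>D\<in>(\<lambda>D. D \<inter> A) ` M. D \<subseteq> B}"
proof (rule proper_filter_generated)
  show "(\<lambda>D. D \<inter> A) ` M \<subseteq> \<B>"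
    using M A inter_in by (auto simp: proper_filter_def)
  show "\<not> null D" if "D \<in> (\<lambda>D. D \<inter> A) ` M" for D
    using that nn by blast
  fix D D' assume "D \<in> (\<lambda>D. D \<inter> A) ` M" "D' \<in> (\<lambda>D. D \<inter> A) ` M"
  then obtain G G' where G: "G \<in> M" "D = G \<inter> A" "G' \<in> M" "D' = G' \<inter> A" by blast
  then have "G \<inter> G' \<in> M"
    using M by (simp add: proper_filter_def)
  then show "\<exists>X\<in>(\<lambda>D. D \<inter> A) ` M. X \<subseteq> D \<inter> D'"
    unfolding G by (intro bexI [of _ "G \<inter> G' \<inter> A"]) auto
qed

text \<open>Zorn's lemma gives a maximal proper filter, and maximality implies primality: if neither
  A nor B can be added, members D and D' meet them in null sets, and D \<inter> D' \<inter> (A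
  \<union> B) would be a null member.\<close>

lemma ex_prime_filter:
  assumes F: "F \<subseteq> \<B>" and nn: "\<And>A. A \<in> F \<Longrightarrow> \<not> null A"
    and dir: "\<And>A B. A \<in> F \<Longrightarrow> B \<in> F \<Longrightarrow> \<exists>D\<in>F. D \<subseteq> A \<inter> B"
  obtains U where "prime_filter U" "F \<subseteq> U"
proof -
  let ?\<F> = "{U. proper_filter U \<and> F \<subseteq> U}"
  have "{B \<in> \<B>. \<exists>A\<in>F. A \<subseteq> B} \<in> ?\<F>"
    using proper_filter_generated [OF assms] F by auto
  then have ne: "?\<F> \<noteq> {}" by blast
  have "\<Union>\<C> \<in> ?\<F>" if "\<C> \<noteq> {}" "subset.chain ?\<F> \<C>" for \<C>
  proof -
    have \<C>: "proper_filter U" "F \<subseteq> U" if "U \<in> \<C>" for U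
      using that \<open>subset.chain ?\<F> \<C>\<close> by (auto simp: subset.chain_def)
    have "proper_filter (\<Union>\<C>)"
      unfolding proper_filter_def
    proof (intro conjI ballI impI)
      show "\<Union>\<C> \<subseteq> \<B>"
        using \<C>(1) [unfolded proper_filter_def] by blast
      fix A assume "A \<in> \<Union>\<C>"
      then obtain U where U: "U \<in> \<C>" "A \<in> U" by blast
      show "\<not> null A"
        using \<C>(1) [OF U(1)] U(2) by (simp add: proper_filter_def)
      show "B \<in> \<Union>\<C>" if "B \<in> \<B>" "A \<subseteq> B" for B
        using \<C>(1) [OF U(1)] U that unfolding proper_filter_def by blast
      fix B assume "B \<in> \<Union>\<C>"
      then obtain V where V: "V \<in> \<C>" "B \<in> V" by blast
      have "U \<subset> V \<or> U = V \<or> V \<subset> U \<or> V = U"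
        using that(2) U(1) V(1) by (simp add: subset.chain_def)
      then have "U \<subseteq> V \<or> V \<subseteq> U"
        by blast
      then obtain W where "W \<in> \<C>" "A \<in> W" "B \<in> W"
        using U V by blast
      then show "A \<inter> B \<in> \<Union>\<C>"
        using \<C>(1) [of W] unfolding proper_filter_def by blast
    qed
    moreover have "F \<subseteq> \<Union>\<C>"
      using that(1) \<C>(2) by blast
    ultimately show ?thesis by blast
  qed
  then obtain M where M: "proper_filter M" "F \<subseteq> M"
    and max: "\<And>X. proper_filter X \<Longrightarrow> F \<subseteq> X \<Longrightarrow> M \<subseteq> X \<Longrightarrow> X = M"
    using subset_Zorn_nonempty [OF ne] by auto
  \<comment> \<open>The member D puts A itself into the extension; an empty M would generate
    nothing.\<close>
  have ex: "\<exists>D\<in>M. null (D \<inter> A)" if A: "A \<in> \<B>" "A \<notin> M" and D: "D \<in> M" for A D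
  proof (rule ccontr)
    let ?X = "{B \<in> \<B>. \<exists>D\<in>(\<lambda>D. D \<inter> A) ` M. D \<subseteq> B}"
    assume "\<not> ?thesis"
    then have "proper_filter ?X"
      by (intro proper_filter_extend [OF M(1) A(1)]) blast
    moreover have "M \<subseteq> ?X"
      using M(1) by (auto simp: proper_filter_def)
    ultimately have "?X = M"
      using M(2) by (intro max) auto
    moreover have "A \<in> ?X"
      using A(1) D by auto
    ultimately show False
      using A(2) by blast
  qed
  have "A \<in> M \<or> B \<in> M" if A: "A \<in> \<B>" and B: "B \<in> \<B>" and AB: "A \<union> B \<in> M" for A B
  proof (rule ccontr)
    assume "\<not> (A \<in> M \<or> B \<in> M)"
    then obtain D D' where D: "D \<in> M" "null (D \<inter> A)" and D': "D' \<in> M" "null (D' \<inter> B)"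
      using ex [OF A _ AB] ex [OF B _ AB] by blast
    have in_B: "D \<in> \<B>" "D' \<in> \<B>"
      using M(1) D(1) D'(1) by (auto simp: proper_filter_def)
    have "D \<inter> D' \<inter> (A \<union> B) \<in> M"
      using M(1) D(1) D'(1) AB by (simp add: proper_filter_def)
    moreover have "null ((D \<inter> A) \<union> (D' \<inter> B))"
      using D(2) D'(2) in_B A B by (intro null_Un inter_in)
    then have "null (D \<inter> D' \<inter> (A \<union> B))"
      by (rule null_subset) (auto intro!: inter_in union_in in_B A B)
    ultimately show False
      using M(1) by (simp add: proper_filter_def)
  qed
  then have "prime_filter M"
    using M(1) by (simp add: prime_filter_def proper_filter_def)
  with M(2) show thesis
    using that by blast
qed

text \<open>If U describes the position on a path after a letter a, this describes the position
  before it.\<close>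

definition pullback :: "'a \<Rightarrow> 'v set set \<Rightarrow> 'v set set" where
  "pullback a U = {A \<in> \<B>. rel_range E A [a] \<in> U}"

text \<open>The map A -> r(A,a) preserves unions, null sets and, by weak left-resolution,
  intersections, which is what a preimage of a prime filter requires.\<close>

lemma prime_filter_pullback:
  assumes U: "prime_filter U" and a: "a \<in> alphabet E"
  shows "prime_filter (pullback a U)"
  unfolding prime_filter_def
proof (intro conjI ballI impI)
  show "pullback a U \<subseteq> \<B>"
    by (auto simp: pullback_def)
  fix A assume "A \<in> pullback a U"
  then have A: "A \<in> \<B>" "rel_range E A [a] \<in> U"
    by (auto simp: pullback_def)
  show "\<not> null A"
    using prime_filter_not_null [OF U A(2)] null_rel_range [OF A(1) _ a] by blast
  show "A \<inter> B \<in> pullback a U" if "B \<in> pullback a U" for B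
    using that A a prime_filter_Int [OF U A(2)] by (simp add: pullback_def inter_in rel_range_Int)
  show "B \<in> pullback a U" if "B \<in> \<B>" "A \<subseteq> B" for B
    using prime_filter_mono [OF U A(2) rel_range_single_in [OF that(1) a] rel_range_mono [OF that(2)]] that
    by (simp add: pullback_def)
next
  fix A B assume "A \<in> \<B>" "B \<in> \<B>" "A \<union> B \<in> pullback a U"
  then show "A \<in> pullback a U \<or> B \<in> pullback a U"
    using prime_filter_Un [OF U, of "rel_range E A [a]" "rel_range E B [a]"] a
    by (simp add: pullback_def rel_range_Un rel_range_single_in)
qed

text \<open>
  Set-finiteness enters here: if every letter emitted by \<open>A\<close> killed some member of \<open>U\<close>, the
  intersection of these finitely many members with \<open>A\<close> would be null.
\<close>
lemma ex_pullback:
  assumes U: "prime_filter U" and A: "A \<in> U"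
  shows "\<exists>a U'. a \<in> \<A>\<^sub>R \<and> prime_filter U' \<and> path_range E [a] \<in> U' \<and> U = pullback a U'"
proof -
  have A_in: "A \<in> \<B>"
    using U A by (rule prime_filter_in)
  have "\<exists>a\<in>emitted_labels E A. \<forall>B\<in>U. \<not> null (rel_range E B [a])"
  proof (rule ccontr)
    assume "\<not> ?thesis"
    then have "\<forall>a\<in>emitted_labels E A. \<exists>B. B \<in> U \<and> null (rel_range E B [a])"
      by blast
    then obtain B where B: "\<And>a. a \<in> emitted_labels E A \<Longrightarrow> B a \<in> U"
        "\<And>a. a \<in> emitted_labels E A \<Longrightarrow> null (rel_range E (B a) [a])"
      by metis
    have "\<exists>D\<in>U. D \<subseteq> A \<and> (\<forall>a\<in>L. D \<subseteq> B a)" if "finite L" "L \<subseteq> emitted_labels E A" for L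
      using that
    proof (induction L)
      case empty
      then show ?case
        using A by blast
    next
      case (insert a L)
      then obtain D where D: "D \<in> U" "D \<subseteq> A" "\<forall>a\<in>L. D \<subseteq> B a"
        by auto
      have "D \<inter> B a \<in> U"
        using D(1) B(1) insert.prems by (intro prime_filter_Int [OF U]) auto
      then show ?case
        using D by (intro bexI [of _ "D \<inter> B a"]) auto
    qed
    from this [OF finite_emitted [OF A_in] subset_refl]
    obtain D where D: "D \<in> U" "D \<subseteq> A" "\<And>a. a \<in> emitted_labels E A \<Longrightarrow> D \<subseteq> B a"
      by blast
    have D_in: "D \<in> \<B>"
      using U D(1) by (rule prime_filter_in)
    have "null D"
    proof (rule null_of_letters [OF D_in])
      fix a assume "a \<in> \<A>\<^sub>R"
      then have a: "a \<in> alphabet E"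
        by (rule quotient_alphabetD)
      show "null (rel_range E D [a])"
      proof (cases "a \<in> emitted_labels E A")
        case True
        have "B a \<in> \<B>"
          using U B(1) [OF True] by (rule prime_filter_in)
        with a D_in show ?thesis
          by (intro null_subset [OF B(2) [OF True] rel_range_mono [OF D(3) [OF True]]] rel_range_single_in)
      next
        case False
        then have "rel_range E D [a] = {}"
          using rel_range_mono [OF D(2)] unfolding emitted_iff by blast
        then show ?thesis by simp
      qed
    qed
    then show False
      using prime_filter_not_null [OF U D(1)] by blast
  qed
  then obtain a where a: "a \<in> emitted_labels E A" "\<And>B. B \<in> U \<Longrightarrow> \<not> null (rel_range E B [a])"
    by blast
  have a_in: "a \<in> alphabet E"
    using a(1) emitted_subset by blast
  \<comment> \<open>The sets r(B,a) for B in U are not null by the choice of a, and directed because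
    r is monotone; any prime filter containing them pulls back to a filter containing U.\<close>
  obtain U' where U': "prime_filter U'" "(\<lambda>B. rel_range E B [a]) ` U \<subseteq> U'"
  proof (rule ex_prime_filter)
    show "(\<lambda>B. rel_range E B [a]) ` U \<subseteq> \<B>"
      using prime_filter_in [OF U] rel_range_single_in [OF _ a_in] by blast
    show "\<not> null D" if "D \<in> (\<lambda>B. rel_range E B [a]) ` U" for D
      using that a(2) by blast
    fix D D' assume "D \<in> (\<lambda>B. rel_range E B [a]) ` U" "D' \<in> (\<lambda>B. rel_range E B [a]) ` U"
    then obtain B B' where B: "B \<in> U" "D = rel_range E B [a]" "B' \<in> U" "D' = rel_range E B' [a]"
      by blast
    have "rel_range E (B \<inter> B') [a] \<subseteq> D \<inter> D'"
      unfolding B by (intro Int_greatest rel_range_mono) auto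
    then show "\<exists>X\<in>(\<lambda>B. rel_range E B [a]) ` U. X \<subseteq> D \<inter> D'"
      using prime_filter_Int [OF U B(1,3)] by blast
  qed
  have rA: "rel_range E A [a] \<in> U'"
    using U'(2) A by blast
  have range: "path_range E [a] \<in> U'"
    by (rule prime_filter_mono [OF U'(1) rA range_single_in [OF a_in] rel_range_subset])
  have "a \<in> \<A>\<^sub>R"
    using prime_filter_not_null [OF U'(1) range] a_in by (simp add: quotient_alphabet_iff)
  moreover have "U = pullback a U'"
  proof (intro Set.set_eqI iffI)
    fix B assume "B \<in> U"
    then show "B \<in> pullback a U'"
      using U'(2) prime_filter_in [OF U] by (auto simp: pullback_def)
  next
    fix B assume "B \<in> pullback a U'"
    then have B: "B \<in> \<B>" "rel_range E B [a] \<in> U'"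
      by (auto simp: pullback_def)
    \<comment> \<open>Primality of U forces equality: otherwise A - B is in U, and U' would contain
      r(A - B,a) and r(B,a), whose intersection is r({},a) = {} by weak left-resolution.\<close>
    show "B \<in> U"
    proof (rule ccontr)
      assume "B \<notin> U"
      then have "A \<inter> B \<notin> U"
        using prime_filter_mono [OF U _ B(1), of "A \<inter> B"] by blast
      then have "A - B \<in> U"
        using prime_filter_diff [OF U A B(1)] by blast
      then have "rel_range E (A - B) [a] \<in> U'"
        using U'(2) by blast
      then have "rel_range E (A - B) [a] \<inter> rel_range E B [a] \<in> U'"
        using B(2) by (rule prime_filter_Int [OF U'(1)])
      moreover have "rel_range E (A - B) [a] \<inter> rel_range E B [a] = rel_range E ((A - B) \<inter> B) [a]"
        using A_in B(1) a_in by (intro rel_range_Int [symmetric] diff_in)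
      moreover have "(A - B) \<inter> B = {}"
        by blast
      ultimately show False
        using prime_filter_not_null [OF U'(1), of "{}"] by simp
    qed
  qed
  ultimately show ?thesis
    using U'(1) range by blast
qed

section \<open>Points, their shift and their extension by a letter\<close>

text \<open>
  A point is a sequence of pairs of a letter \<open>a\<^sub>n\<close> and a prime filter \<open>U\<^sub>n\<close> of sets containing the
  \<open>n\<close>-th vertex of an imaginary infinite path with labels \<open>a\<^sub>0, a\<^sub>1, \<dots>\<close>. The filter \<open>U\<^sub>0\<close> may be
  empty: then the point lies in no set \<open>X\<^sub>A\<close>.
\<close>
definition point :: "(nat \<Rightarrow> 'a \<times> 'v set set) \<Rightarrow> bool" where
  "point x \<longleftrightarrow> (\<forall>n. fst (x n) \<in> \<A>\<^sub>R \<and> prime_filter (snd (x n)) \<and>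
    path_range E [fst (x n)] \<in> snd (x (Suc n)) \<and> snd (x n) = pullback (fst (x n)) (snd (x (Suc n))))"

lemma point_label: "point x \<Longrightarrow> fst (x n) \<in> \<A>\<^sub>R"
  and point_filter: "point x \<Longrightarrow> prime_filter (snd (x n))"
  and point_range: "point x \<Longrightarrow> path_range E [fst (x n)] \<in> snd (x (Suc n))"
  and point_pullback: "point x \<Longrightarrow> snd (x n) = pullback (fst (x n)) (snd (x (Suc n)))"
  unfolding point_def by blast+

definition shift :: "(nat \<Rightarrow> 'a \<times> 'v set set) \<Rightarrow> nat \<Rightarrow> 'a \<times> 'v set set" where
  "shift x n = x (Suc n)"

definition push :: "'a \<Rightarrow> (nat \<Rightarrow> 'a \<times> 'v set set) \<Rightarrow> nat \<Rightarrow> 'a \<times> 'v set set" where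
  "push a x = case_nat (a, pullback a (snd (x 0))) x"

lemma shift_push [simp]: "shift (push a x) = x"
  by (rule ext) (simp add: shift_def push_def)

lemma push_shift:
  assumes "point x"
  shows "push (fst (x 0)) (shift x) = x"
proof
  fix n
  have "(fst (x 0), pullback (fst (x 0)) (snd (x (Suc 0)))) = x 0"
    unfolding point_pullback [OF assms, of 0, symmetric] by simp
  then show "push (fst (x 0)) (shift x) n = x n"
    by (cases n) (simp_all add: push_def shift_def)
qed

lemma point_shift: "point x \<Longrightarrow> point (shift x)"
  unfolding point_def shift_def by blast

lemma point_push:
  assumes x: "point x" and a: "a \<in> \<A>\<^sub>R" "path_range E [a] \<in> snd (x 0)"
  shows "point (push a x)"
  unfolding point_def
proof
  fix n
  have "prime_filter (pullback a (snd (x 0)))"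
    using quotient_alphabetD [OF a(1)] by (intro prime_filter_pullback point_filter x)
  with a show "fst (push a x n) \<in> \<A>\<^sub>R \<and> prime_filter (snd (push a x n)) \<and>
    path_range E [fst (push a x n)] \<in> snd (push a x (Suc n)) \<and>
    snd (push a x n) = pullback (fst (push a x n)) (snd (push a x (Suc n)))"
  proof (cases n)
    case (Suc m)
    then show ?thesis
      unfolding push_def Suc nat.case by (intro conjI point_label point_filter point_range point_pullback x)
  qed (simp add: push_def)
qed

text \<open>Iterates \<open>ex_pullback\<close> by dependent choice. The filter after an entry must
  suit the letter just chosen, so \<open>?P\<close> records that a fitting V exists and the next
  entry takes V for its own filter; V contains r(a), hence is nonempty and the iteration
  continues.\<close>

lemma ex_point:
  assumes "A \<in> \<B>" "\<not> null A"
  obtains x where "point x" "A \<in> snd (x 0)"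
proof -
  obtain U where U: "prime_filter U" "{A} \<subseteq> U"
  proof (rule ex_prime_filter)
    show "{A} \<subseteq> \<B>" "\<And>B. B \<in> {A} \<Longrightarrow> \<not> null B" "\<And>B D. B \<in> {A} \<Longrightarrow> D \<in> {A} \<Longrightarrow> \<exists>X\<in>{A}. X \<subseteq> B \<inter> D"
      using assms by auto
  qed
  let ?P = "\<lambda>(n::nat) y. fst y \<in> \<A>\<^sub>R \<and> prime_filter (snd y) \<and> snd y \<noteq> {} \<and> (n = 0 \<longrightarrow> A \<in> snd y) \<and>
    (\<exists>V. prime_filter V \<and> path_range E [fst y] \<in> V \<and> snd y = pullback (fst y) V)"
  let ?Q = "\<lambda>(n::nat) y z. path_range E [fst y] \<in> snd z \<and> snd y = pullback (fst y) (snd z)"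
  have start: "\<exists>y. ?P n y \<and> snd y = V" if V: "prime_filter V" "B \<in> V" "n = 0 \<longrightarrow> A \<in> V" for n V B
  proof -
    obtain a V' where "a \<in> \<A>\<^sub>R" "prime_filter V'" "path_range E [a] \<in> V'" "V = pullback a V'"
      using ex_pullback [OF V(1,2)] by blast
    with V show ?thesis
      by (intro exI [of _ "(a, V)"]) auto
  qed
  have "\<exists>x. \<forall>n. ?P n (x n) \<and> ?Q n (x n) (x (Suc n))"
  proof (rule dependent_nat_choice)
    have AU: "A \<in> U"
      using U(2) by simp
    have "\<exists>y. ?P 0 y \<and> snd y = U"
      by (rule start [OF U(1) AU]) (simp add: AU)
    then obtain y where "?P 0 y \<and> snd y = U"
      by (rule exE)
    then have "?P 0 y"
      by (rule conjunct1)
    then show "\<exists>y. ?P 0 y"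
      by (rule exI)
  next
    fix y n assume "?P n y"
    then obtain V where V: "prime_filter V" "path_range E [fst y] \<in> V" "snd y = pullback (fst y) V"
      by blast
    have "\<exists>z. ?P (Suc n) z \<and> snd z = V"
      by (rule start [OF V(1,2)]) simp
    then obtain z where z: "?P (Suc n) z \<and> snd z = V"
      by (rule exE)
    have "?Q n y z"
      unfolding conjunct2 [OF z] using V(2,3) by (rule conjI)
    with conjunct1 [OF z] have "?P (Suc n) z \<and> ?Q n y z"
      by (rule conjI)
    then show "\<exists>z. ?P (Suc n) z \<and> ?Q n y z"
      by (rule exI)
  qed
  then obtain x where x: "\<And>n. ?P n (x n) \<and> ?Q n (x n) (x (Suc n))"
    by blast
  have "point x"
    unfolding point_def using x by blast
  moreover have "A \<in> snd (x 0)"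
    using x [of 0] by (elim conjE mp) (rule refl)
  ultimately show thesis
    by (rule that)
qed

end

section \<open>The representation on the orbit of a point\<close>

context quotient_setting
begin

lemma prime_filter_empty_notin: "prime_filter U \<Longrightarrow> {} \<notin> U"
  using prime_filter_not_null by blast

text \<open>
  The operators act on \<open>\<ell>\<^sup>2\<close> of the orbit of one point under shifting and pushing, which is
  countable; this keeps the resulting C*-algebra of the size of the continuum.
\<close>
lemma ex_nonzero_quotient_rep:
  assumes A0: "A0 \<in> \<B>" "\<not> null A0"
  shows "\<exists>T P. quotient_rep E \<B> R ell2_operators T P \<and> P (R `` {A0}) \<noteq> 0"
proof -
  let ?O = "ell2_operators"
  obtain x0 where x0: "point x0" "A0 \<in> snd (x0 0)"
    using ex_point [OF A0] .
  \<comment> \<open>Pushes after shifts are enough, for a shift undoes a push. Words run over the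
    whole countable alphabet, and the clause \<open>point y\<close> sorts out the illegitimate
    ones.\<close>
  define Y where "Y = {y. point y \<and> (\<exists>w\<in>lists (alphabet E). \<exists>n. y = foldr push w ((shift ^^ n) x0))}"
  have "countable ((\<lambda>(w, n). foldr push w ((shift ^^ n) x0)) ` (lists (alphabet E) \<times> (UNIV :: nat set)))"
    by (intro countable_image countable_SIGMA countable_lists countable_alphabet) simp
  moreover have "Y \<subseteq> (\<lambda>(w, n). foldr push w ((shift ^^ n) x0)) ` (lists (alphabet E) \<times> (UNIV :: nat set))"
    unfolding Y_def by fast
  ultimately have "countable Y"
    by (rule countable_subset [rotated])
  then obtain \<iota> :: "_ \<Rightarrow> nat" where \<iota>: "inj_on \<iota> Y"
    by (auto simp: countable_def)
  have Y_point: "point y" if "y \<in> Y" for y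
    using that by (simp add: Y_def)
  have x0_Y: "x0 \<in> Y"
    unfolding Y_def using x0(1) by (auto intro!: bexI [of _ "[]"] exI [of _ 0])
  have Y_shift: "shift y \<in> Y" if y: "y \<in> Y" for y
  proof -
    obtain w n where w: "w \<in> lists (alphabet E)" "y = foldr push w ((shift ^^ n) x0)"
      using y by (auto simp: Y_def)
    have "\<exists>w\<in>lists (alphabet E). \<exists>n. shift y = foldr push w ((shift ^^ n) x0)"
    proof (cases w)
      case Nil
      then have "shift y = foldr push [] ((shift ^^ Suc n) x0)"
        using w by simp
      then show ?thesis
        by (intro bexI [of _ "[]"] exI [of _ "Suc n"]) auto
    next
      case (Cons a v)
      then have "shift y = foldr push v ((shift ^^ n) x0)" "v \<in> lists (alphabet E)"
        using w by simp_all
      then show ?thesis by blast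
    qed
    with point_shift [OF Y_point [OF y]] show ?thesis
      by (simp add: Y_def)
  qed
  have Y_push: "push a y \<in> Y" if y: "y \<in> Y" and a: "a \<in> \<A>\<^sub>R" "path_range E [a] \<in> snd (y 0)" for a y
  proof -
    obtain w n where w: "w \<in> lists (alphabet E)" "y = foldr push w ((shift ^^ n) x0)"
      using y by (auto simp: Y_def)
    have "push a y = foldr push (a # w) ((shift ^^ n) x0)" "a # w \<in> lists (alphabet E)"
      using w quotient_alphabetD [OF a(1)] by simp_all
    with point_push [OF Y_point [OF y] a] show ?thesis
      unfolding Y_def by blast
  qed
  define dec where "dec = inv_into Y \<iota>"
  have dec [simp]: "dec (\<iota> y) = y" if "y \<in> Y" for y
    unfolding dec_def using \<iota> that by simp
  define X where "X A = \<iota> ` {y \<in> Y. A \<in> snd (y 0)}" for A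
  have X_iff: "\<iota> y \<in> X A \<longleftrightarrow> A \<in> snd (y 0)" if "y \<in> Y" for y A
    unfolding X_def using inj_onD [OF \<iota>] that by blast
  have X_sub: "X A \<subseteq> \<iota> ` Y" for A
    unfolding X_def by blast
  have X_eqI: "Z = X A" if "Z \<subseteq> \<iota> ` Y" "\<And>y. y \<in> Y \<Longrightarrow> \<iota> y \<in> Z \<longleftrightarrow> A \<in> snd (y 0)" for Z A
    using that X_iff X_sub [of A] by blast
  \<comment> \<open>Pull-back along g_a sends the basis vector of z to that of
    \<open>push a z\<close> when this is a point, and to 0 otherwise.\<close>
  define g where "g a m = (if m \<in> \<iota> ` Y \<and> fst (dec m 0) = a then Some (\<iota> (shift (dec m))) else None)" for a m
  have g: "g a (\<iota> y) = (if fst (y 0) = a then Some (\<iota> (shift y)) else None)" if "y \<in> Y" for a y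
    using that by (simp add: g_def)
  have g_outside: "g a m = None" if "m \<notin> \<iota> ` Y" for a m
    using that by (simp add: g_def)
  have g_SomeE: "\<exists>y\<in>Y. m = \<iota> y \<and> fst (y 0) = a \<and> n = \<iota> (shift y)" if m: "g a m = Some n" for a m n
  proof -
    obtain y where y: "y \<in> Y" "m = \<iota> y"
      using m g_outside [of m a] by auto
    with m show ?thesis
      by (auto simp: g split: if_splits)
  qed
  have g_inj: "partial_inj (g a)" for a
    unfolding partial_inj_def
  proof (rule inj_onI)
    fix m m' assume "m \<in> dom (g a)" "m' \<in> dom (g a)" and eq: "g a m = g a m'"
    then obtain n where n: "g a m = Some n" "g a m' = Some n"
      by auto
    obtain y where y: "y \<in> Y" "m = \<iota> y" "fst (y 0) = a" "n = \<iota> (shift y)"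
      using g_SomeE [OF n(1)] by blast
    obtain y' where y': "y' \<in> Y" "m' = \<iota> y'" "fst (y' 0) = a" "n = \<iota> (shift y')"
      using g_SomeE [OF n(2)] by blast
    have "shift y = shift y'"
      using inj_onD [OF \<iota>, of "shift y" "shift y'"] y y' Y_shift by simp
    then have "push (fst (y 0)) (shift y) = push (fst (y' 0)) (shift y')"
      using y(3) y'(3) by simp
    then have "y = y'"
      unfolding push_shift [OF Y_point [OF y(1)]] push_shift [OF Y_point [OF y'(1)]] .
    with y y' show "m = m'" by simp
  qed
  \<comment> \<open>T_a\<dagger>T_a is thereby the projection onto the points that can be extended
    by a: membership of r(a) in the first filter is exactly what \<open>point\<close> requires of
    the extension.\<close>
  have ran_g: "ran (g a) = X (path_range E [a])" if a: "a \<in> \<A>\<^sub>R" for a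
  proof (rule X_eqI)
    show "ran (g a) \<subseteq> \<iota> ` Y"
    proof
      fix n assume "n \<in> ran (g a)"
      then obtain m where "g a m = Some n"
        by (auto simp: ran_def)
      then show "n \<in> \<iota> ` Y"
        using g_SomeE Y_shift by blast
    qed
    fix z assume z: "z \<in> Y"
    show "\<iota> z \<in> ran (g a) \<longleftrightarrow> path_range E [a] \<in> snd (z 0)"
    proof
      assume "\<iota> z \<in> ran (g a)"
      then obtain m where "g a m = Some (\<iota> z)"
        by (auto simp: ran_def)
      then obtain y where y: "y \<in> Y" "fst (y 0) = a" "\<iota> z = \<iota> (shift y)"
        using g_SomeE by blast
      have "z = shift y"
        using inj_onD [OF \<iota> y(3) z Y_shift [OF y(1)]] .
      then show "path_range E [a] \<in> snd (z 0)"
        using point_range [OF Y_point [OF y(1)], of 0] y(2) by (simp add: shift_def)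
    next
      assume "path_range E [a] \<in> snd (z 0)"
      then have "push a z \<in> Y"
        by (rule Y_push [OF z a])
      then have "g a (\<iota> (push a z)) = Some (\<iota> z)"
        unfolding g [OF \<open>push a z \<in> Y\<close>] by (simp add: push_def [of a z])
          (simp flip: push_def)
      then show "\<iota> z \<in> ran (g a)"
        by (rule ranI)
    qed
  qed
  define T where "T a = shuffle_op (g a)" for a
  define V where "V A = shuffle_op (Some |` X A)" for A
  define P where "P K = V (SOME A. A \<in> K)" for K
  have X_class: "X A = X B" if "A \<in> \<B>" "B \<in> \<B>" "R `` {A} = R `` {B}" for A B
  proof (rule X_eqI [OF X_sub])
    fix y assume y: "y \<in> Y"
    show "\<iota> y \<in> X A \<longleftrightarrow> B \<in> snd (y 0)"
      unfolding X_iff [OF y] using that by (intro prime_filter_class point_filter Y_point y)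
  qed
  have P: "P (R `` {A}) = V A" if A: "A \<in> \<B>" for A
  proof -
    define B where "B = (SOME B. B \<in> R `` {A})"
    have "A \<in> R `` {A}"
      using equiv A by (auto simp: equiv_def refl_on_def)
    then have "B \<in> R `` {A}"
      unfolding B_def by (rule someI)
    then have AB: "(A, B) \<in> R"
      by simp
    then have "B \<in> \<B>"
      using equiv_type [OF equiv] by blast
    then have "X B = X A"
      using equiv_class_eq [OF equiv AB] by (intro X_class A) simp_all
    then show ?thesis
      by (simp only: P_def V_def B_def)
  qed
  have T_adj: "(T a)\<^sup>\<dagger>\<^bsub>?O\<^esub> = shuffle_op (partial_inv (g a))" for a
    unfolding T_def by (rule shuffle_op_adj [OF g_inj])
  have X_empty: "X {} = {}"
    unfolding X_def using prime_filter_empty_notin [OF point_filter [OF Y_point]] by blast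
  have X_Int: "X A \<inter> X B = X (A \<inter> B)" if "A \<in> \<B>" "B \<in> \<B>" for A B
  proof (rule X_eqI)
    show "X A \<inter> X B \<subseteq> \<iota> ` Y"
      using X_sub by blast
    fix y assume y: "y \<in> Y"
    have U: "prime_filter (snd (y 0))"
      by (intro point_filter Y_point y)
    show "\<iota> y \<in> X A \<inter> X B \<longleftrightarrow> A \<inter> B \<in> snd (y 0)"
      unfolding Int_iff X_iff [OF y]
      using prime_filter_Int [OF U] prime_filter_mono [OF U _ that(1)] prime_filter_mono [OF U _ that(2)]
      by blast
  qed
  have X_Un: "X (A \<union> B) = X A \<union> X B" if "A \<in> \<B>" "B \<in> \<B>" for A B
  proof (rule X_eqI [symmetric])
    show "X A \<union> X B \<subseteq> \<iota> ` Y"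
      using X_sub by blast
    fix y assume y: "y \<in> Y"
    have U: "prime_filter (snd (y 0))"
      by (intro point_filter Y_point y)
    show "\<iota> y \<in> X A \<union> X B \<longleftrightarrow> A \<union> B \<in> snd (y 0)"
      unfolding Un_iff X_iff [OF y]
      using prime_filter_Un [OF U that] prime_filter_mono [OF U _ union_in [OF that]]
      by blast
  qed
  have pull: "A \<in> snd (y 0) \<longleftrightarrow> rel_range E A [fst (y 0)] \<in> snd (shift y 0)"
    if "A \<in> \<B>" "y \<in> Y" for A y
    using point_pullback [OF Y_point [OF that(2)], of 0] that(1) by (simp add: pullback_def shift_def)
  \<comment> \<open>On points starting with a, membership of A in the first filter is membership of
    r(A,a) in the second; this is the pullback condition tying successive filters together.\<close>
  have VT: "V A o\<^sub>L T a = T a o\<^sub>L V (rel_range E A [a])" if A: "A \<in> \<B>" for A a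
  proof -
    have "g a \<circ>\<^sub>m (Some |` X A) = (Some |` X (rel_range E A [a])) \<circ>\<^sub>m g a"
    proof
      fix m
      show "(g a \<circ>\<^sub>m (Some |` X A)) m = ((Some |` X (rel_range E A [a])) \<circ>\<^sub>m g a) m"
      proof (cases "m \<in> \<iota> ` Y")
        case True
        then obtain y where y: "y \<in> Y" "m = \<iota> y"
          by blast
        show ?thesis
          unfolding y(2) using pull [OF A y(1)]
          by (simp add: map_comp_def restrict_map_def g [OF y(1)] X_iff [OF y(1)] X_iff [OF Y_shift [OF y(1)]])
      next
        case False
        then have "m \<notin> X A"
          using X_sub by blast
        with False show ?thesis
          by (simp add: map_comp_def restrict_map_def g_outside)
      qed
    qed
    then show ?thesis
      by (simp add: V_def T_def shuffle_op_comp g_inj)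
  qed
  have assoc: "(S o\<^sub>L S') o\<^sub>L S'' = S o\<^sub>L (S' o\<^sub>L S'')" for S S' S'' :: "ell2 \<Rightarrow>\<^sub>L ell2"
    by (rule blinfun_eqI) simp
  have TT: "T a o\<^sub>L shuffle_op (partial_inv (g a)) = shuffle_op (Some |` dom (g a))" for a
    by (simp add: T_def shuffle_op_comp g_inj partial_inj_inv partial_inv_comp)
  have "quotient_rep E \<B> R ?O T P"
    unfolding quotient_rep_def ell2_operators_simps ell2_operators_sub
  proof (intro conjI ballI impI)
    show "is_projection ?O (P K)" if "K \<in> \<B> // R" for K
      unfolding P_def V_def by (rule projection_restrict)
    show "is_partial_isometry ?O (T a)" for a
      unfolding T_def by (rule partial_isometry_shuffle [OF g_inj])
    show "P (R `` {{}}) = 0"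
      by (simp add: P [OF empty_in] V_def X_empty)
    show "P (R `` {A}) o\<^sub>L P (R `` {B}) = P (R `` {A \<inter> B})" if "A \<in> \<B>" "B \<in> \<B>" for A B
      using that by (simp add: P inter_in V_def shuffle_op_restrict_comp X_Int)
    show "P (R `` {A \<union> B}) = P (R `` {A}) + P (R `` {B}) - P (R `` {A \<inter> B})" if "A \<in> \<B>" "B \<in> \<B>" for A B
      using that by (simp add: P inter_in union_in V_def X_Un X_Int shuffle_op_restrict_Un)
    show "P (R `` {A}) o\<^sub>L T a = T a o\<^sub>L P (R `` {rel_range E A [a]})" if "A \<in> \<B>" "a \<in> \<A>\<^sub>R" for A a
      using that quotient_alphabetD [OF that(2)] by (simp add: P rel_range_single_in VT)
    show "(T a)\<^sup>\<dagger>\<^bsub>?O\<^esub> o\<^sub>L T a = P (R `` {path_range E [a]})" if "a \<in> \<A>\<^sub>R" for a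
      unfolding T_adj P [OF range_single_in [OF quotient_alphabetD [OF that]]]
      unfolding T_def V_def shuffle_op_adj_comp [OF g_inj g_inj] comp_partial_inv [OF g_inj]
        ran_g [OF that] ..
    show "(T a)\<^sup>\<dagger>\<^bsub>?O\<^esub> o\<^sub>L T b = 0" if "a \<noteq> b" for a b
    proof -
      have "(g b \<circ>\<^sub>m partial_inv (g a)) n = None" for n
      proof (cases "partial_inv (g a) n")
        case (Some m)
        then have "g a m = Some n"
          by (simp only: partial_inv_eq_Some_iff [OF g_inj])
        then obtain y where "y \<in> Y" "m = \<iota> y" "fst (y 0) = a"
          using g_SomeE by blast
        then have "g b m = None"
          using that by (simp add: g)
        with Some show ?thesis
          by (simp add: map_comp_def)
      qed (simp add: map_comp_def)
      then have "g b \<circ>\<^sub>m partial_inv (g a) = Map.empty"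
        by (rule ext)
      then show ?thesis
        unfolding T_adj unfolding T_def by (simp add: shuffle_op_adj_comp g_inj)
    qed
    fix A assume A: "A \<in> \<B>"
    let ?F = "{a \<in> emitted_labels E A. \<not> null (rel_range E A [a])}"
    let ?D = "\<lambda>a. X A \<inter> dom (g a)"
    have term_eq: "T a o\<^sub>L P (R `` {rel_range E A [a]}) o\<^sub>L (T a)\<^sup>\<dagger>\<^bsub>?O\<^esub> = shuffle_op (Some |` ?D a)"
      if "a \<in> emitted_labels E A" for a
    proof -
      have "rel_range E A [a] \<in> \<B>"
        using that emitted_subset [of A] by (intro rel_range_single_in A) auto
      then have "T a o\<^sub>L P (R `` {rel_range E A [a]}) = V A o\<^sub>L T a"
        by (simp add: P VT [OF A])
      then have "T a o\<^sub>L P (R `` {rel_range E A [a]}) o\<^sub>L (T a)\<^sup>\<dagger>\<^bsub>?O\<^esub> =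
          V A o\<^sub>L (T a o\<^sub>L shuffle_op (partial_inv (g a)))"
        by (simp add: T_adj assoc)
      then show ?thesis
        by (simp add: TT V_def shuffle_op_restrict_comp)
    qed
    \<comment> \<open>Every point has exactly one first letter, so X_A splits by first letters; the
      letters that occur have r(A,a) in a prime filter, hence not null.\<close>
    have "(\<Union>a\<in>?F. ?D a) = X A"
    proof (rule X_eqI)
      show "(\<Union>a\<in>?F. ?D a) \<subseteq> \<iota> ` Y"
        using X_sub [of A] by blast
      fix y assume y: "y \<in> Y"
      show "\<iota> y \<in> (\<Union>a\<in>?F. ?D a) \<longleftrightarrow> A \<in> snd (y 0)"
      proof
        assume "A \<in> snd (y 0)"
        then have yA: "\<iota> y \<in> X A" and r: "rel_range E A [fst (y 0)] \<in> snd (shift y 0)"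
          using X_iff [OF y] pull [OF A y] by simp_all
        have nn: "\<not> null (rel_range E A [fst (y 0)])"
          by (rule prime_filter_not_null [OF point_filter [OF Y_point [OF Y_shift [OF y]]] r])
        then have "fst (y 0) \<in> emitted_labels E A"
          unfolding emitted_iff by auto
        moreover have "\<iota> y \<in> dom (g (fst (y 0)))"
          by (simp add: dom_def g [OF y])
        ultimately show "\<iota> y \<in> (\<Union>a\<in>?F. ?D a)"
          using yA nn by blast
      qed (use X_iff [OF y] in blast)
    qed
    moreover have "finprod (additive ?O) (\<lambda>a. shuffle_op (Some |` ?D a)) ?F = shuffle_op (Some |` (\<Union>a\<in>?F. ?D a))"
    proof (rule finprod_shuffle_op_restrict)
      show "finite ?F"
        using finite_emitted [OF A] by simp
      show "?D a \<inter> ?D b = {}" if "a \<noteq> b" for a b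
        using that g_SomeE inj_onD [OF \<iota>] by (auto simp: dom_def) (metis g_SomeE g option.distinct(1))
    qed
    moreover have "finprod (additive ?O) (\<lambda>a. T a o\<^sub>L P (R `` {rel_range E A [a]}) o\<^sub>L (T a)\<^sup>\<dagger>\<^bsub>?O\<^esub>) ?F =
        finprod (additive ?O) (\<lambda>a. shuffle_op (Some |` ?D a)) ?F"
    proof -
      interpret pre_cstar_algebra ?O
        by (rule pre_cstar_algebra_ell2_operators)
      show ?thesis
        by (rule add.finprod_cong') (auto simp: term_eq shuffle_op_closed)
    qed
    ultimately have "P (R `` {A}) = finprod (additive ?O)
        (\<lambda>a. T a o\<^sub>L P (R `` {rel_range E A [a]}) o\<^sub>L (T a)\<^sup>\<dagger>\<^bsub>?O\<^esub>) ?F"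
      by (simp only: P [OF A] V_def)
    then show "P (R `` {A}) = finprod (additive ?O)
        (\<lambda>a. T a o\<^sub>L P (R `` {rel_range E A [a]}) o\<^sub>L (T a)\<^sup>\<dagger>\<^bsub>?O\<^esub>)
        {a \<in> class_emitted_labels E R A \<inter> \<A>\<^sub>R. \<not> null (rel_range E A [a])}"
      unfolding quotient_index_set [OF A] .
  qed
  moreover have "P (R `` {A0}) \<noteq> 0"
  proof -
    have "\<iota> x0 \<in> X A0"
      using X_iff [OF x0_Y] x0(2) by simp
    then show ?thesis
      unfolding P [OF A0(1)] V_def shuffle_op_restrict_eq_0_iff by blast
  qed
  ultimately show ?thesis
    by blast
qed

text \<open>A vanishing q_[A] would be sent to 0 in every representation that the universal property
  reaches. The operators on \<open>ell2\<close> are among them because the universe has at least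
  continuum many elements.\<close>

lemma class_projection_nonzero:
  fixes D :: "'u cstar_data"
  assumes universe: "(UNIV :: real set) \<lesssim> (UNIV :: 'u set)"
    and D: "is_quotient_cstar E \<B> R D t q" and A: "A \<in> \<B>" "\<not> null A"
  shows "q (R `` {A}) \<noteq> \<^bold>0\<^bsub>D\<^esub>"
proof
  assume q: "q (R `` {A}) = \<^bold>0\<^bsub>D\<^esub>"
  obtain T P where rep: "quotient_rep E \<B> R ell2_operators T P" and P: "P (R `` {A}) \<noteq> 0"
    using ex_nonzero_quotient_rep [OF A] by blast
  have small: "carrier ell2_operators \<lesssim> (UNIV :: 'u set)"
    using ell2_operators_lepoll_reals universe by (rule lepoll_trans)
  show False
  proof (rule quotient_cstar_universal [OF D cstar_algebra_ell2_operators rep small finite_quotient_index_set])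
    show "rel_range E A [a] \<in> \<B>" if "A \<in> \<B>" "a \<in> \<A>\<^sub>R" for A a
      using that by (intro rel_range_single_in quotient_alphabetD)
    show "A \<union> B \<in> \<B> \<and> A \<inter> B \<in> \<B>" if "A \<in> \<B>" "B \<in> \<B>" for A B
      using that by (intro conjI union_in inter_in)
    fix \<rho> assume \<rho>: "star_hom D ell2_operators \<rho>"
      and "\<And>A. A \<in> \<B> \<Longrightarrow> \<rho> (q (R `` {A})) = P (R `` {A})"
    then have \<rho>A: "\<rho> (q (R `` {A})) = P (R `` {A})"
      using A(1) by blast
    have "cstar_algebra D"
      using D by (simp add: is_quotient_cstar_def)
    then interpret \<rho>: cstar_hom D ell2_operators \<rho>
      by (intro cstar_hom.intro cstar_hom_axioms.intro cstar_algebra_ell2_operators \<rho>)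
    show False
      using \<rho>A P \<rho>.hom_zero by (simp add: q)
  qed
qed

end

theorem corollary4p3:
  fixes E :: "('v, 'e, 'a) lgraph"
    and \<B> :: "'v set set"
    and R :: "'v set rel"
    and C D :: "'u cstar_data"
    and s :: "'a \<Rightarrow> 'u" and p :: "'v set \<Rightarrow> 'u"
    and t :: "'a \<Rightarrow> 'u" and q :: "'v set set \<Rightarrow> 'u"
    and I :: "'u set"
  assumes universe: "(UNIV :: real set) \<lesssim> (UNIV :: 'u set)"
    and "labelled_space E \<B>"
    and "set_finite E \<B>"
    and "receiver_set_finite E \<B>"
    and "weakly_left_resolving E \<B>"
    and "no_sinks E"
    and "closed_under_relative_complements \<B>"
    and "quotient_labelled_space E \<B> R"
    and "quotient_weakly_left_resolving E \<B> R"
    and "is_quotient_cstar E \<B> R D t q"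
    and "is_labelled_space_cstar E \<B> C s p"
    and I: "I = generated_ideal C {p A | A. A \<in> \<B> \<and> R `` {A} = R `` {{}}}"
  shows "quotient_alphabet E R = {a \<in> alphabet E. p (path_range E [a]) \<notin> I} \<and>
    (\<exists>\<phi>. star_iso D (quotient_cstar C I) \<phi> \<and>
      (\<forall>b\<in>quotient_alphabet E R. \<phi> (t b) = coset C I (s b)) \<and>
      (\<forall>A\<in>\<B>. \<phi> (q (R `` {A})) = coset C I (p A)))"
proof -
  interpret quotient_setting E \<B> R
    using assms by (intro quotient_setting.intro quotient_setting_axioms.intro)
  have C: "cstar_algebra C" "labelled_space_rep E \<B> C s p"
      "generated_cstar_subalgebra C (s ` alphabet E \<union> p ` \<B>) = carrier C"
    using \<open>is_labelled_space_cstar E \<B> C s p\<close> by (simp_all only: is_labelled_space_cstar_def)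
  interpret labelled_cstar E \<B> R C s p
    by (intro labelled_cstar.intro labelled_cstar_axioms.intro quotient_setting_axioms C)
  have nonzero: "q (R `` {A}) \<noteq> \<^bold>0\<^bsub>D\<^esub>" if "A \<in> \<B>" "\<not> null A" for A
    using universe \<open>is_quotient_cstar E \<B> R D t q\<close> that by (rule class_projection_nonzero)
  have "I = null_ideal"
    by (simp only: assms null_ideal_def)
  then show ?thesis
    using quotient_isomorphism [OF \<open>is_labelled_space_cstar E \<B> C s p\<close>
        \<open>is_quotient_cstar E \<B> R D t q\<close> nonzero] by (simp only: simp_thms)
qed

end
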